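(* Let $M$ be a weakly $1$-pseudoconcave locally closed smooth real submanifold of a complex manifold $X$ and $E$ a discrete subset of $M$. Assume that (i) the set $M_{\mathrm{reg}}$ of CR-regular points of $M$ is open and dense in $M$ and is a generic CR submanifold of $X$; (ii) $M\setminus E$ has at each point the holomorphic extension property. Then, for each relative domain $\omega\subset M$ (connected open subset of $M$), there is an ambient domain $\Omega\subset X$ with $\omega=\Omega\cap M$ such that all LACR functions on $\omega$ have a unique holomorphic extension to $\Omega$. In particular, every LACR function defined on some open subset of $M$ is $\mathcal{C}^\infty$-smooth, and $\tilde{\mathscr{O}}_M=\mathscr{O}_{M,0}$.
   Context: Discrete subset of $M$ means relatively closed with only isolated points. CR notions. Let $M$ be a smooth real submanifold of codimension $k$ of a complex manifold $X$ with complex structure $J$, locally defined near $p\in M$ by $\rho_1=\dots=\rho_k=0$ with $\rho_j$ smooth real valued and $d\rho_1\wedge\dots\wedge d\rho_k\ne0$. $T^{1,0}_pM=\{w\in T^{1,0}_pX\mid\partial\rho_j(w)=0,\ j=1,\dots,k\}$ and its complex dimension is the CR dimension of $M$ at $p$. $p$ is CR-regular if the CR dimension is constant near $p$ in $M$, CR-singular otherwise. $M$ is a CR submanifold if its CR dimension is constant, and it is generic if $T_pM+J(T_pM)=T_pX$ for all $p\in M$. $M$ is weakly $q$-pseudoconcave at $p$ if, for all $c\in\mathbb{R}^k$, the complex Hessian of $\sum_jc_j\rho_j$ at $p$ has at least $q$ nonpositive eigenvalues on $T^{1,0}_pM$; weakly $q$-pseudoconcave means so at all points (CR-singular ones included).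 LACR functions. For $A\subseteq X$ locally closed, $\mathcal{C}_A$ is the sheaf of germs of continuous complex valued functions on $A$, and $\mathscr{O}_A=\mathscr{O}_{A,0}\subseteq\mathcal{C}_A$ is the subsheaf of germs of functions that are, near each point, restrictions to $A$ of holomorphic functions on open subsets of $X$. For a set $\mathcal{H}$ of germs of continuous functions on $A$ and $U$ open in $A$, $\mathcal{H}(U)$ is the set of continuous functions on $U$ all of whose germs belong to $\mathcal{H}$; $\mathcal{H}^c$ is the set of germs $f_{(x)}$ having, on some open neighbourhood $U_x$ of $x$ in $A$, a representative which is the limit, uniformly on compact subsets of $U_x$, of a sequence in $\mathcal{H}(U_x)$. $\mathcal{H}^{(c)}$ is the smallest set of germs that contains $\mathcal{H}$ and is stable under $\mathcal{H}\mapsto\mathcal{H}^c$. The sheaf of LACR functions is $\tilde{\mathscr{O}}_A=\mathscr{O}_A^{(c)}$; LACR functions on an open set are its sections. $M$ has the holomorphic extension property at $p\in M$ if every LACR function defined on $M$ near $p$ has a holomorphic extension to an open neighbourhood of $p$ in $X$. *)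

theory Defs
  imports "HOL-Analysis.Analysis"
begin

section \<open>Smooth and holomorphic maps between coordinate spaces\<close>

text \<open>\<open>Ck_on m S f\<close>: \<open>f\<close> is of class \<open>C\<^sup>m\<close> on the open subset \<open>S\<close> of a finite-dimensional space.\<close>

primrec Ck_on :: "nat \<Rightarrow> 'a::euclidean_space set \<Rightarrow> ('a \<Rightarrow> 'b::real_normed_vector) \<Rightarrow> bool" where
  "Ck_on 0 S f \<longleftrightarrow> continuous_on S f"
| "Ck_on (Suc m) S f \<longleftrightarrow> (\<forall>x\<in>S. f differentiable (at x)) \<and>
     (\<forall>v. Ck_on m S (\<lambda>x. frechet_derivative f (at x) v))"

definition Cinf_on :: "'a::euclidean_space set \<Rightarrow> ('a \<Rightarrow> 'b::real_normed_vector) \<Rightarrow> bool" where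
  "Cinf_on S f \<longleftrightarrow> (\<forall>m. Ck_on m S f)"

text \<open>Holomorphic functions of several variables: the Frechet derivative exists and is complex
  linear at every point of the open set \<open>S\<close>.\<close>

definition holo_on :: "(complex^'n) set \<Rightarrow> (complex^'n \<Rightarrow> complex) \<Rightarrow> bool" where
  "holo_on S f \<longleftrightarrow>
     (\<forall>z\<in>S. \<exists>D. (f has_derivative D) (at z) \<and> (\<forall>a v. D (a *s v) = a * D v))"

text \<open>Wirtinger derivatives \<open>\<partial>f/\<partial>z\<^sub>i\<close> and \<open>\<partial>f/\<partial>\<close>\<open>conj(z\<^sub>i)\<close>.\<close>

definition dz :: "(complex^'n \<Rightarrow> complex) \<Rightarrow> complex^'n \<Rightarrow> 'n \<Rightarrow> complex" where
  "dz f z i = (frechet_derivative f (at z) (axis i 1)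
     - \<i> * frechet_derivative f (at z) (axis i \<i>)) / 2"

definition dzbar :: "(complex^'n \<Rightarrow> complex) \<Rightarrow> complex^'n \<Rightarrow> 'n \<Rightarrow> complex" where
  "dzbar f z i = (frechet_derivative f (at z) (axis i 1)
     + \<i> * frechet_derivative f (at z) (axis i \<i>)) / 2"

definition complex_hessian :: "(complex^'n \<Rightarrow> complex) \<Rightarrow> complex^'n \<Rightarrow> complex^'n^'n" where
  "complex_hessian f z = (\<chi> i j. dz (\<lambda>u. dzbar f u j) z i)"

section \<open>Eigenvalues of a Hermitian form on a complex subspace\<close>

definition herm_inner :: "complex^'n \<Rightarrow> complex^'n \<Rightarrow> complex" where
  "herm_inner w v = (\<Sum>i\<in>UNIV. w $ i * cnj (v $ i))"

definition herm_form :: "complex^'n^'n \<Rightarrow> complex^'n \<Rightarrow> complex^'n \<Rightarrow> complex" where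
  "herm_form H w v = (\<Sum>i\<in>UNIV. \<Sum>j\<in>UNIV. H $ i $ j * w $ i * cnj (v $ j))"

text \<open>The eigenspace, for the real number \<open>r\<close>, of the self-adjoint endomorphism of the subspace \<open>T\<close>
  that represents the restriction to \<open>T\<close> of the Hermitian form \<open>H\<close>.\<close>

definition eigenspace_on ::
  "complex^'n^'n \<Rightarrow> (complex^'n) set \<Rightarrow> real \<Rightarrow> (complex^'n) set" where
  "eigenspace_on H T r =
     {w \<in> T. \<forall>v\<in>T. herm_form H w v = complex_of_real r * herm_inner w v}"

text \<open>The number of nonpositive eigenvalues on \<open>T\<close>, counted with multiplicity. The index set is
  finite because eigenvectors for distinct eigenvalues are linearly independent.\<close>

definition num_nonpos_eigenvalues :: "complex^'n^'n \<Rightarrow> (complex^'n) set \<Rightarrow> nat" where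
  "num_nonpos_eigenvalues H T =
     (\<Sum>r | r \<le> 0 \<and> (\<exists>w\<in>eigenspace_on H T r. w \<noteq> 0). vec.dim (eigenspace_on H T r))"

section \<open>Complex manifolds\<close>

text \<open>A complex manifold is a second countable Hausdorff space, here a type \<open>'x\<close>, with a
  holomorphic atlas whose charts take values in \<open>complex^'n\<close>.\<close>

type_synonym ('x, 'n) chart = "'x set \<times> ('x \<Rightarrow> complex^'n)"

definition complex_atlas ::
  "('x::{t2_space, second_countable_topology}, 'n::finite) chart set \<Rightarrow> bool" where
  "complex_atlas \<A> \<longleftrightarrow>
     (\<forall>(U, \<phi>)\<in>\<A>. open U \<and> open (\<phi> ` U) \<and> (\<exists>\<psi>. homeomorphism U (\<phi> ` U) \<phi> \<psi>)) \<and>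
     (\<Union>(U, \<phi>)\<in>\<A>. U) = UNIV \<and>
     (\<forall>(U, \<phi>)\<in>\<A>. \<forall>(V, \<psi>)\<in>\<A>. \<forall>i. holo_on (\<phi> ` (U \<inter> V)) (\<lambda>z. \<psi> (inv_into U \<phi> z) $ i))"

definition holomorphic_fun ::
  "('x::topological_space, 'n::finite) chart set \<Rightarrow> 'x set \<Rightarrow> ('x \<Rightarrow> complex) \<Rightarrow> bool" where
  "holomorphic_fun \<A> W F \<longleftrightarrow> (\<forall>(U, \<phi>)\<in>\<A>. holo_on (\<phi> ` (U \<inter> W)) (\<lambda>z. F (inv_into U \<phi> z)))"

definition smooth_fun ::
  "('x::topological_space, 'n::finite) chart set \<Rightarrow> 'x set \<Rightarrow> ('x \<Rightarrow> 'b::real_normed_vector) \<Rightarrow> bool" where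
  "smooth_fun \<A> W F \<longleftrightarrow> (\<forall>(U, \<phi>)\<in>\<A>. Cinf_on (\<phi> ` (U \<inter> W)) (\<lambda>z. F (inv_into U \<phi> z)))"

text \<open>The tangent space at \<open>p\<close>, and likewise the holomorphic tangent space \<open>T\<^sup>1\<^sup>,\<^sup>0\<close>, is identified
  with \<open>complex^'n\<close> by means of one chosen chart around \<open>p\<close>; the complex structure \<open>J\<close> is then
  multiplication by \<open>\<i>\<close>. All notions below are independent of the choice.\<close>

definition chart_at :: "('x, 'n) chart set \<Rightarrow> 'x \<Rightarrow> ('x, 'n) chart" where
  "chart_at \<A> p = (SOME c. c \<in> \<A> \<and> p \<in> fst c)"

definition coord_at :: "('x, 'n) chart set \<Rightarrow> 'x \<Rightarrow> complex^'n" where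
  "coord_at \<A> p = snd (chart_at \<A> p) p"

definition local_rep :: "('x, 'n) chart set \<Rightarrow> 'x \<Rightarrow> ('x \<Rightarrow> 'b) \<Rightarrow> complex^'n \<Rightarrow> 'b" where
  "local_rep \<A> p F = (\<lambda>z. F (inv_into (fst (chart_at \<A> p)) (snd (chart_at \<A> p)) z))"

definition differential ::
  "('x, 'n::finite) chart set \<Rightarrow> 'x \<Rightarrow> ('x \<Rightarrow> real) \<Rightarrow> complex^'n \<Rightarrow> real" where
  "differential \<A> p \<rho> v = frechet_derivative (local_rep \<A> p \<rho>) (at (coord_at \<A> p)) v"

definition del ::
  "('x, 'n::finite) chart set \<Rightarrow> 'x \<Rightarrow> ('x \<Rightarrow> real) \<Rightarrow> complex^'n \<Rightarrow> complex" where
  "del \<A> p \<rho> w =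
     (\<Sum>i\<in>UNIV. dz (local_rep \<A> p (\<lambda>x. complex_of_real (\<rho> x))) (coord_at \<A> p) i * w $ i)"

definition hessian_at ::
  "('x, 'n::finite) chart set \<Rightarrow> 'x \<Rightarrow> ('x \<Rightarrow> real) \<Rightarrow> complex^'n^'n" where
  "hessian_at \<A> p \<rho> =
     complex_hessian (local_rep \<A> p (\<lambda>x. complex_of_real (\<rho> x))) (coord_at \<A> p)"

text \<open>The wedge product of \<open>k\<close> real covectors, evaluated on \<open>k\<close> tangent vectors.\<close>

definition wedge :: "nat \<Rightarrow> (nat \<Rightarrow> 'v \<Rightarrow> real) \<Rightarrow> (nat \<Rightarrow> 'v) \<Rightarrow> real" where
  "wedge k \<alpha> v = (\<Sum>\<pi> | \<pi> permutes {..<k}. of_int (sign \<pi>) * (\<Prod>j<k. \<alpha> j (v (\<pi> j))))"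

section \<open>Real submanifolds and CR notions\<close>

text \<open>\<open>M\<close> is defined near \<open>p\<close>, on the open set \<open>W\<close>, by \<open>\<rho>\<^sub>0 = \<dots> = \<rho>\<^sub>k\<^sub>-\<^sub>1 = 0\<close>.\<close>

definition defining_functions ::
  "('x::topological_space, 'n::finite) chart set \<Rightarrow> nat \<Rightarrow> 'x set \<Rightarrow> 'x \<Rightarrow> 'x set
     \<Rightarrow> (nat \<Rightarrow> 'x \<Rightarrow> real) \<Rightarrow> bool" where
  "defining_functions \<A> k M p W \<rho> \<longleftrightarrow>
     open W \<and> p \<in> W \<and> (\<forall>j<k. smooth_fun \<A> W (\<rho> j)) \<and>
     M \<inter> W = {x \<in> W. \<forall>j<k. \<rho> j x = 0} \<and>
     (\<forall>x\<in>W. \<exists>v. wedge k (\<lambda>j. differential \<A> x (\<rho> j)) v \<noteq> 0)"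

definition real_submanifold ::
  "('x::topological_space, 'n::finite) chart set \<Rightarrow> nat \<Rightarrow> 'x set \<Rightarrow> bool" where
  "real_submanifold \<A> k M \<longleftrightarrow> (\<forall>p\<in>M. \<exists>W \<rho>. defining_functions \<A> k M p W \<rho>)"

text \<open>In the next definitions, all systems of defining functions near \<open>p\<close> give the same answer.\<close>

definition tangent_space ::
  "('x::topological_space, 'n::finite) chart set \<Rightarrow> nat \<Rightarrow> 'x set \<Rightarrow> 'x \<Rightarrow> (complex^'n) set" where
  "tangent_space \<A> k M p =
     {v. \<forall>W \<rho>. defining_functions \<A> k M p W \<rho> \<longrightarrow> (\<forall>j<k. differential \<A> p (\<rho> j) v = 0)}"

definition T10 ::
  "('x::topological_space, 'n::finite) chart set \<Rightarrow> nat \<Rightarrow> 'x set \<Rightarrow> 'x \<Rightarrow> (complex^'n) set" where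
  "T10 \<A> k M p =
     {w. \<forall>W \<rho>. defining_functions \<A> k M p W \<rho> \<longrightarrow> (\<forall>j<k. del \<A> p (\<rho> j) w = 0)}"

definition CR_dim ::
  "('x::topological_space, 'n::finite) chart set \<Rightarrow> nat \<Rightarrow> 'x set \<Rightarrow> 'x \<Rightarrow> nat" where
  "CR_dim \<A> k M p = vec.dim (T10 \<A> k M p)"

definition CR_regular ::
  "('x::topological_space, 'n::finite) chart set \<Rightarrow> nat \<Rightarrow> 'x set \<Rightarrow> 'x \<Rightarrow> bool" where
  "CR_regular \<A> k M p \<longleftrightarrow>
     (\<exists>U. openin (top_of_set M) U \<and> p \<in> U \<and> (\<forall>x\<in>U. CR_dim \<A> k M x = CR_dim \<A> k M p))"

definition reg_points ::
  "('x::topological_space, 'n::finite) chart set \<Rightarrow> nat \<Rightarrow> 'x set \<Rightarrow> 'x set" where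
  "reg_points \<A> k M = {p \<in> M. CR_regular \<A> k M p}"

definition CR_submanifold ::
  "('x::topological_space, 'n::finite) chart set \<Rightarrow> nat \<Rightarrow> 'x set \<Rightarrow> bool" where
  "CR_submanifold \<A> k M \<longleftrightarrow>
     real_submanifold \<A> k M \<and> (\<exists>d. \<forall>p\<in>M. CR_dim \<A> k M p = d)"

definition generic ::
  "('x::topological_space, 'n::finite) chart set \<Rightarrow> nat \<Rightarrow> 'x set \<Rightarrow> bool" where
  "generic \<A> k M \<longleftrightarrow>
     (\<forall>p\<in>M. {v + \<i> *s w | v w. v \<in> tangent_space \<A> k M p \<and> w \<in> tangent_space \<A> k M p} = UNIV)"

definition weakly_pseudoconcave ::
  "('x::topological_space, 'n::finite) chart set \<Rightarrow> nat \<Rightarrow> nat \<Rightarrow> 'x set \<Rightarrow> bool" where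
  "weakly_pseudoconcave \<A> k q M \<longleftrightarrow>
     (\<forall>p\<in>M. \<forall>W \<rho>. defining_functions \<A> k M p W \<rho> \<longrightarrow>
        (\<forall>c :: nat \<Rightarrow> real.
           q \<le> num_nonpos_eigenvalues (hessian_at \<A> p (\<lambda>x. \<Sum>j<k. c j * \<rho> j x)) (T10 \<A> k M p)))"

definition locally_closed :: "'x::topological_space set \<Rightarrow> bool" where
  "locally_closed A \<longleftrightarrow> (\<exists>U C. open U \<and> closed C \<and> A = U \<inter> C)"

section \<open>Germs and LACR functions\<close>

text \<open>The germ at \<open>x\<close> of a function on a neighbourhood of \<open>x\<close> in \<open>A\<close>. Functions are represented by
  total functions; their values off the neighbourhood are irrelevant. The base point is recorded.\<close>

type_synonym 'x germ = "'x \<times> ('x \<Rightarrow> complex) set"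

definition germ :: "'x::topological_space set \<Rightarrow> 'x \<Rightarrow> ('x \<Rightarrow> complex) \<Rightarrow> 'x germ" where
  "germ A x f = (x, {g. \<exists>U. openin (top_of_set A) U \<and> x \<in> U \<and> (\<forall>y\<in>U. g y = f y)})"

definition continuous_germs :: "'x::topological_space set \<Rightarrow> 'x germ set" where
  "continuous_germs A =
     {germ A x f | x f. \<exists>U. openin (top_of_set A) U \<and> x \<in> U \<and> continuous_on U f}"

definition sections :: "'x::topological_space set \<Rightarrow> 'x germ set \<Rightarrow> 'x set \<Rightarrow> ('x \<Rightarrow> complex) set" where
  "sections A \<H> U = {f. continuous_on U f \<and> (\<forall>x\<in>U. germ A x f \<in> \<H>)}"

definition holomorphic_germs ::
  "('x::topological_space, 'n::finite) chart set \<Rightarrow> 'x set \<Rightarrow> 'x germ set" where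
  "holomorphic_germs \<A> A =
     {germ A x F | x F. x \<in> A \<and> (\<exists>W. open W \<and> x \<in> W \<and> holomorphic_fun \<A> W F)}"

text \<open>The operation \<open>\<H> \<mapsto> \<H>\<^sup>c\<close>.\<close>

definition limit_germs :: "'x::topological_space set \<Rightarrow> 'x germ set \<Rightarrow> 'x germ set" where
  "limit_germs A \<H> =
     {germ A x f | x f. \<exists>U. openin (top_of_set A) U \<and> x \<in> U \<and> continuous_on U f \<and>
        (\<exists>s. (\<forall>m::nat. s m \<in> sections A \<H> U) \<and>
             (\<forall>K. compact K \<and> K \<subseteq> U \<longrightarrow> uniform_limit K s f sequentially))}"

text \<open>\<open>\<H>\<^sup>(\<^sup>c\<^sup>)\<close>, the smallest set of germs containing \<open>\<H>\<close> and stable under \<^const>\<open>limit_germs\<close>.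
  It exists because \<^const>\<open>limit_germs\<close> is monotone.\<close>

definition limit_closure :: "'x::topological_space set \<Rightarrow> 'x germ set \<Rightarrow> 'x germ set" where
  "limit_closure A \<H> =
     \<Inter>{\<K>. \<K> \<subseteq> continuous_germs A \<and> \<H> \<subseteq> \<K> \<and> limit_germs A \<K> \<subseteq> \<K>}"

definition LACR_germs ::
  "('x::topological_space, 'n::finite) chart set \<Rightarrow> 'x set \<Rightarrow> 'x germ set" where
  "LACR_germs \<A> A = limit_closure A (holomorphic_germs \<A> A)"

definition LACR ::
  "('x::topological_space, 'n::finite) chart set \<Rightarrow> 'x set \<Rightarrow> 'x set \<Rightarrow> ('x \<Rightarrow> complex) set" where
  "LACR \<A> A U = sections A (LACR_germs \<A> A) U"

definition holo_extension_at ::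
  "('x::topological_space, 'n::finite) chart set \<Rightarrow> 'x set \<Rightarrow> 'x \<Rightarrow> bool" where
  "holo_extension_at \<A> M p \<longleftrightarrow>
     (\<forall>U f. openin (top_of_set M) U \<and> p \<in> U \<and> f \<in> LACR \<A> M U \<longrightarrow>
        (\<exists>W F. open W \<and> p \<in> W \<and> holomorphic_fun \<A> W F \<and> (\<forall>x\<in>W \<inter> U. F x = f x)))"

text \<open>Smoothness of a function on a relatively open subset \<open>U\<close> of a smooth submanifold: locally it
  is the restriction of a smooth function on an open subset of the ambient manifold.\<close>

definition smooth_on_subset ::
  "('x::topological_space, 'n::finite) chart set \<Rightarrow> 'x set \<Rightarrow> ('x \<Rightarrow> complex) \<Rightarrow> bool" where
  "smooth_on_subset \<A> U f \<longleftrightarrow>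
     (\<forall>p\<in>U. \<exists>W F. open W \<and> p \<in> W \<and> smooth_fun \<A> W F \<and> (\<forall>x\<in>W \<inter> U. F x = f x))"

end

theory Submission
  imports Defs "HOL-Complex_Analysis.Great_Picard"
begin

text \<open>Because \<open>\<H>\<^sup>(\<^sup>c\<^sup>)\<close> is a smallest set, it suffices to see that a locally uniform limit \<open>f\<close> of
  functions on \<open>M\<close> with local holomorphic extensions again has one near each point \<open>p\<close> of \<open>M\<close>.
  Genericity on a dense set makes germs of extensions unique. Away from \<open>E\<close> extension is given;
  applied to all 0-1 series formed from multiples of the differences \<open>d\<^sub>j\<close> of a rapidly converging
  subsequence it yields, by Baire and Montel, extensions of the \<open>d\<^sub>j\<close> to a common neighbourhood of
  a small sphere in \<open>M\<close> around \<open>p\<close>, bounded by \<open>C 2\<^sup>-\<^sup>j\<close>, so that there the iterated directional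
  derivatives of \<open>d\<^sub>j\<close> obey Cauchy's estimates. Weak 1-pseudoconcavity gives the maximum principle
  on \<open>M\<close>, so the same estimates hold at \<open>p\<close>; the Taylor series of the \<open>d\<^sub>j\<close> at \<open>p\<close> converge in a
  common ball, and their sum extends \<open>f\<close>. A second use of Baire's theorem gives domains of
  extension that do not depend on the function.\<close>

section \<open>Holomorphic functions of several variables\<close>

text \<open>The hypothesis off \<open>E\<close> speaks of one function at a time and yields neither
  a common domain nor a bound, whereas a limit needs both. Testing it on a whole Cantor set of
  series made from one sequence turns the qualitative assumption into a quantitative one. This is
  why the convergence has to be rapid: differences of size \<open>4^-j\<close> can be multiplied by
  \<open>2^j\<close> and still be summed, and undoing the multiplication leaves the decay
  \<open>2^-j\<close>. At a point of \<open>E\<close> nothing is assumed, so all information has to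
  come from a sphere around it. The maximum principle does not apply to the extensions, which live
  on separate balls around points of the sphere, but only to functions on \<open>M\<close>.
  Derivatives must therefore make sense as functions on \<open>M\<close>, and this rests on the
  uniqueness of germs. Finally, the Taylor series at \<open>p\<close> of a difference is known to
  agree with it only near \<open>p\<close>, on a set that may shrink with the index; local
  connectedness of \<open>M\<close> removes this dependence.\<close>

lemma norm_vector_smult: "norm (c *s (v :: complex^'n)) = cmod c * norm v"
  by (simp add: norm_vec_def vector_scalar_mult_def norm_mult L2_set_right_distrib)

lemma bounded_linear_smult_left: "bounded_linear (\<lambda>t. t *s (v :: complex^'n))"
proof (rule bounded_linear_intro[where K = "norm v"])
qed (auto simp: vec_eq_iff norm_vector_smult algebra_simps)

lemma continuous_on_smult [continuous_intros]:
  "continuous_on A f \<Longrightarrow> continuous_on A (\<lambda>x. f x *s (v :: complex^'n))"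
  using bounded_linear.continuous_on[OF bounded_linear_smult_left] .

text \<open>The point comes last, so that \<open>ddir v\<close> is an operator on functions and
  \<open>ddir v ^^ m\<close> its \<open>m\<close>-th iterate.\<close>

abbreviation ddir :: "complex^'n \<Rightarrow> (complex^'n \<Rightarrow> complex) \<Rightarrow> complex^'n \<Rightarrow> complex" where
  "ddir v f \<equiv> \<lambda>z. frechet_derivative f (at z) v"

lemma holo_on_has_derivative:
  "holo_on S f \<Longrightarrow> z \<in> S \<Longrightarrow> (f has_derivative frechet_derivative f (at z)) (at z)"
  unfolding holo_on_def by (metis differentiableI frechet_derivative_works)

lemma holo_on_differentiable: "holo_on S f \<Longrightarrow> z \<in> S \<Longrightarrow> f differentiable (at z)"
  unfolding holo_on_def by (metis differentiableI)

lemma holo_on_smult: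
  "holo_on S f \<Longrightarrow> z \<in> S \<Longrightarrow>
     frechet_derivative f (at z) (a *s v) = a * frechet_derivative f (at z) v"
  unfolding holo_on_def by (metis frechet_derivative_at)

lemma holo_on_linear: "holo_on S f \<Longrightarrow> z \<in> S \<Longrightarrow> linear (frechet_derivative f (at z))"
  using holo_on_has_derivative has_derivative_linear by blast

lemma holo_on_subset: "holo_on S f \<Longrightarrow> T \<subseteq> S \<Longrightarrow> holo_on T f"
  unfolding holo_on_def by blast

lemma holo_on_continuous: "holo_on S f \<Longrightarrow> continuous_on S f"
  by (meson continuous_at_imp_continuous_on differentiable_imp_continuous_within holo_on_differentiable)

lemma holo_on_const [simp]: "holo_on S (\<lambda>z. c)"
  unfolding holo_on_def by (auto intro!: exI[of _ "\<lambda>_. 0"])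

lemma holo_on_comp_nth [simp]: "holo_on S (\<lambda>z. z $ i)"
  unfolding holo_on_def by (auto intro!: exI[of _ "\<lambda>z. z $ i"] bounded_linear_imp_has_derivative bounded_linear_vec_nth)

lemma holo_on_add: assumes "holo_on S f" "holo_on S g" shows "holo_on S (\<lambda>z. f z + g z)"
  unfolding holo_on_def
proof
  fix z assume z: "z \<in> S"
  have "((\<lambda>z. f z + g z) has_derivative
      (\<lambda>h. frechet_derivative f (at z) h + frechet_derivative g (at z) h)) (at z)"
    by (rule has_derivative_add[OF holo_on_has_derivative[OF assms(1) z] holo_on_has_derivative[OF assms(2) z]])
  then show "\<exists>D. ((\<lambda>z. f z + g z) has_derivative D) (at z) \<and> (\<forall>a v. D (a *s v) = a * D v)"
    by (force simp: holo_on_smult[OF assms(1) z] holo_on_smult[OF assms(2) z] algebra_simps)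
qed

lemma holo_on_mult: assumes "holo_on S f" "holo_on S g" shows "holo_on S (\<lambda>z. f z * g z)"
  unfolding holo_on_def
proof
  fix z assume z: "z \<in> S"
  have "((\<lambda>z. f z * g z) has_derivative
      (\<lambda>h. f z * frechet_derivative g (at z) h + frechet_derivative f (at z) h * g z)) (at z)"
    by (rule has_derivative_mult[OF holo_on_has_derivative[OF assms(1) z] holo_on_has_derivative[OF assms(2) z]])
  then show "\<exists>D. ((\<lambda>z. f z * g z) has_derivative D) (at z) \<and> (\<forall>a v. D (a *s v) = a * D v)"
    by (force simp: holo_on_smult[OF assms(1) z] holo_on_smult[OF assms(2) z] algebra_simps)
qed

lemma holo_on_cmult: "holo_on S f \<Longrightarrow> holo_on S (\<lambda>z. c * f z)"
  by (intro holo_on_mult holo_on_const)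

lemma holo_on_diff: "holo_on S f \<Longrightarrow> holo_on S g \<Longrightarrow> holo_on S (\<lambda>z. f z - g z)"
  using holo_on_add[of S f "\<lambda>z. (-1) * g z"] holo_on_cmult[of S g "-1"] by simp

lemma holo_on_sum: "(\<And>i. i \<in> I \<Longrightarrow> holo_on S (f i)) \<Longrightarrow> holo_on S (\<lambda>z. \<Sum>i\<in>I. f i z)"
  by (induction I rule: infinite_finite_induct) (auto intro: holo_on_add)

lemma holo_on_cong:
  assumes "holo_on S f" "open S" "\<And>z. z \<in> S \<Longrightarrow> g z = f z" shows "holo_on S g"
  unfolding holo_on_def
proof
  fix z assume z: "z \<in> S"
  obtain D where D: "(f has_derivative D) (at z)" "\<forall>a v. D (a *s v) = a * D v"
    using assms(1) z unfolding holo_on_def by blast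
  have "(g has_derivative D) (at z)"
    using has_derivative_transform_within_open[OF D(1) assms(2) z] assms(3) by metis
  then show "\<exists>D. (g has_derivative D) (at z) \<and> (\<forall>a v. D (a *s v) = a * D v)"
    using D(2) by blast
qed

lemma holo_on_local:
  "(\<And>z. z \<in> S \<Longrightarrow> \<exists>T. z \<in> T \<and> holo_on T f) \<Longrightarrow> holo_on S f"
  unfolding holo_on_def by blast

lemma holo_on_vector_derivative:
  fixes T :: "complex^'n \<Rightarrow> complex^'m"
  assumes "\<And>i. holo_on S (\<lambda>z. T z $ i)" "z \<in> S"
  obtains D where "(T has_derivative D) (at z)" "\<And>a v. D (a *s v) = a *s D v"
proof
  let ?D = "\<lambda>v. \<chi> i. frechet_derivative (\<lambda>z. T z $ i) (at z) v"
  show "(T has_derivative ?D) (at z)"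
    unfolding has_derivative_componentwise_within[of T ?D z UNIV]
  proof (rule ballI)
    fix b :: "complex^'m" assume "b \<in> Basis"
    then obtain i u where b: "b = axis i u" by (auto simp: Basis_vec_def)
    have "((\<lambda>z. T z $ i \<bullet> u) has_derivative (\<lambda>v. frechet_derivative (\<lambda>z. T z $ i) (at z) v \<bullet> u)) (at z)"
      by (intro has_derivative_inner_left holo_on_has_derivative[OF assms])
    then show "((\<lambda>x. T x \<bullet> b) has_derivative (\<lambda>x. ?D x \<bullet> b)) (at z)"
      by (simp add: b inner_axis)
  qed
  show "?D (a *s v) = a *s ?D v" for a v
    by (simp add: vec_eq_iff holo_on_smult[OF assms])
qed

lemma holo_on_compose:
  fixes T :: "complex^'n \<Rightarrow> complex^'m"
  assumes "holo_on S f" "\<And>i. holo_on R (\<lambda>z. T z $ i)" "T ` R \<subseteq> S"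
  shows "holo_on R (\<lambda>z. f (T z))"
  unfolding holo_on_def
proof
  fix z assume z: "z \<in> R"
  obtain D where D: "(T has_derivative D) (at z)" "\<And>a v. D (a *s v) = a *s D v"
    using holo_on_vector_derivative[OF assms(2) z] by blast
  have Tz: "T z \<in> S" using z assms(3) by blast
  have "((\<lambda>z. f (T z)) has_derivative (\<lambda>v. frechet_derivative f (at (T z)) (D v))) (at z)"
    using diff_chain_at[OF D(1) holo_on_has_derivative[OF assms(1) Tz]] by (simp add: o_def)
  then show "\<exists>D. ((\<lambda>z. f (T z)) has_derivative D) (at z) \<and> (\<forall>a v. D (a *s v) = a * D v)"
    by (force simp: D(2) holo_on_smult[OF assms(1) Tz])
qed

lemma holo_on_compose_translate:
  "holo_on S f \<Longrightarrow> (\<lambda>z. z + c) ` R \<subseteq> S \<Longrightarrow> holo_on R (\<lambda>z. f (z + c))"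
  by (rule holo_on_compose) (auto intro!: holo_on_add)

lemma ddir_eq_on_open:
  assumes "open S" "z \<in> S" "\<And>w. w \<in> S \<Longrightarrow> f w = g w"
  shows "frechet_derivative f (at z) = frechet_derivative g (at z)"
  unfolding frechet_derivative_def
  using has_derivative_transform_within_open[OF _ assms(1,2)] assms(3) by metis

text \<open>Complex lines are the bridge to one variable: Cauchy's estimates, the Taylor expansion
  and the identity theorem below are obtained for \<open>t \<mapsto> f (z + t *s v)\<close> and read
  off at a single value of \<open>t\<close>.\<close>

lemma has_field_derivative_line:
  assumes "holo_on S f" "z + t *s v \<in> S"
  shows "((\<lambda>t. f (z + t *s v)) has_field_derivative frechet_derivative f (at (z + t *s v)) v) (at t)"
proof -
  have "((\<lambda>t. z + t *s v) has_derivative (\<lambda>s. s *s v)) (at t)"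
    by (auto intro!: derivative_eq_intros bounded_linear_imp_has_derivative bounded_linear_smult_left)
  from diff_chain_at[OF this holo_on_has_derivative[OF assms]]
  have "((\<lambda>t. f (z + t *s v)) has_derivative (\<lambda>s. frechet_derivative f (at (z + t *s v)) (s *s v))) (at t)"
    by (simp add: o_def)
  then show ?thesis
    by (simp add: has_field_derivative_def holo_on_smult[OF assms] mult.commute[of _ "frechet_derivative f (at (z + t *s v)) v"] fun_eq_iff)
qed

lemma holomorphic_on_line:
  assumes "holo_on S f" "\<And>t. t \<in> R \<Longrightarrow> z + t *s v \<in> S"
  shows "(\<lambda>t. f (z + t *s v)) holomorphic_on R"
  using has_field_derivative_line[OF assms(1) assms(2)] holomorphic_on_def
  by (metis has_field_derivative_at_within field_differentiable_def)

lemma ball_line: "cmod t * norm v < r \<Longrightarrow> z + t *s v \<in> ball z r"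
  by (simp add: dist_norm norm_vector_smult)

lemma Cauchy_bound_ddir:
  assumes f: "holo_on (ball z r) f" and B: "\<And>w. w \<in> ball z r \<Longrightarrow> cmod (f w) \<le> B" and r: "r > 0"
  shows "cmod (frechet_derivative f (at z) v) \<le> 2 * B / r * norm v"
proof (cases "v = 0")
  case True
  then show ?thesis using linear_0[OF holo_on_linear[OF f, of z]] r by simp
next
  case False
  then have v: "norm v > 0" by simp
  \<comment> \<open>Half of the largest admissible radius, so that the closed disc is still mapped
    into the open ball; this is the origin of the factor 2 in the bound.\<close>
  define \<rho> where "\<rho> = r / (2 * norm v)"
  have \<rho>: "\<rho> > 0" using r v by (simp add: \<rho>_def)
  have in_ball: "z + t *s v \<in> ball z r" if "cmod t \<le> \<rho>" for t
  proof (rule ball_line)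
    have "cmod t * norm v \<le> \<rho> * norm v" using that by (simp add: mult_right_mono)
    also have "\<dots> < r" using v r by (simp add: \<rho>_def)
    finally show "cmod t * norm v < r" .
  qed
  have hol: "(\<lambda>t. f (z + t *s v)) holomorphic_on (cball 0 \<rho>)"
    by (rule holomorphic_on_line[OF f]) (use in_ball in auto)
  have "cmod ((deriv ^^ 1) (\<lambda>t. f (z + t *s v)) 0) \<le> fact 1 * B / \<rho> ^ 1"
  proof (rule Cauchy_inequality)
    show "(\<lambda>t. f (z + t *s v)) holomorphic_on ball 0 \<rho>"
      using hol by (rule holomorphic_on_subset) auto
    show "continuous_on (cball 0 \<rho>) (\<lambda>t. f (z + t *s v))"
      using hol by (rule holomorphic_on_imp_continuous_on)
  qed (use \<rho> in_ball B in auto)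
  moreover have "deriv (\<lambda>t. f (z + t *s v)) 0 = frechet_derivative f (at z) v"
    using DERIV_imp_deriv[OF has_field_derivative_line[OF f, of z 0 v]] r by simp
  ultimately show ?thesis by (simp add: \<rho>_def field_simps)
qed


text \<open>Cauchy's estimate for the differences \<open>f n - f m\<close> makes the derivatives
  uniformly Cauchy on a smaller ball. Termwise differentiation then applies, and complex linearity
  of the derivative passes to the pointwise limit.\<close>

lemma holo_on_uniform_limit:
  assumes f: "\<And>n. holo_on S (f n)" and S: "open S" and lim: "uniform_limit S f g sequentially"
  shows "holo_on S g"
  unfolding holo_on_def
proof
  fix z assume "z \<in> S"
  then obtain R where R: "R > 0" "ball z R \<subseteq> S" using S open_contains_ball by blast
  define r where "r = R / 2"
  have r: "r > 0" using R by (simp add: r_def)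
  have sub: "ball x r \<subseteq> S" if "x \<in> ball z r" for x
  proof
    fix y assume "y \<in> ball x r"
    then have "dist z y < R"
      using that dist_triangle_half_l[of z x R y] by (simp add: r_def dist_commute)
    then show "y \<in> S" using R by auto
  qed
  let ?D = "\<lambda>n x h. frechet_derivative (f n) (at x) h"
  have diff: "cmod (?D n x h - ?D m x h) \<le> 2 * e / r * norm h"
    if x: "x \<in> ball z r" and e: "\<And>y. y \<in> S \<Longrightarrow> cmod (f n y - f m y) \<le> e" for n m x h e
  proof -
    have xS: "x \<in> S" using sub[OF x] r by (meson centre_in_ball subsetD)
    have "frechet_derivative (\<lambda>y. f n y - f m y) (at x) = (\<lambda>h. ?D n x h - ?D m x h)"
      by (rule frechet_derivative_at[symmetric], rule has_derivative_diff)
         (use holo_on_has_derivative[OF f xS] in auto)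
    moreover have "cmod (frechet_derivative (\<lambda>y. f n y - f m y) (at x) h) \<le> 2 * e / r * norm h"
    proof (rule Cauchy_bound_ddir)
      show "holo_on (ball x r) (\<lambda>y. f n y - f m y)"
        by (rule holo_on_subset[OF holo_on_diff[OF f f] sub[OF x]])
      show "cmod (f n w - f m w) \<le> e" if "w \<in> ball x r" for w
        using e sub[OF x] that by blast
    qed (rule r)
    ultimately show ?thesis by simp
  qed
  have unif: "\<exists>N. \<forall>n\<ge>N. \<forall>m\<ge>N. \<forall>x\<in>ball z r. \<forall>h. cmod (?D n x h - ?D m x h) \<le> e * norm h" if "e > 0" for e
  proof -
    \<comment> \<open>Two functions within \<open>e * r / 4\<close> of the limit differ by at most
      \<open>e * r / 2\<close>, which the factor \<open>2 / r\<close> of the Cauchy bound turns into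
      \<open>e\<close>.\<close>
    have "e * r / 4 > 0" using that r by simp
    from uniform_limitD[OF lim this] obtain N where
      N: "\<And>n y. n \<ge> N \<Longrightarrow> y \<in> S \<Longrightarrow> dist (f n y) (g y) < e * r / 4"
      unfolding eventually_sequentially by blast
    have "cmod (?D n x h - ?D m x h) \<le> e * norm h"
      if "n \<ge> N" "m \<ge> N" "x \<in> ball z r" for n m x h
    proof -
      have "cmod (f n y - f m y) \<le> e * r / 2" if "y \<in> S" for y
        using N[OF \<open>n \<ge> N\<close> that] N[OF \<open>m \<ge> N\<close> that] dist_triangle2[of "f n y" "f m y" "g y"]
        by (simp add: dist_norm)
      from diff[OF \<open>x \<in> ball z r\<close> this] have "cmod (?D n x h - ?D m x h) \<le> 2 * (e * r / 2) / r * norm h" .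
      then show ?thesis using r by simp
    qed
    then show ?thesis by blast
  qed
  define D where "D x h = lim (\<lambda>n. ?D n x h)" for x h
  have conv: "(\<lambda>n. ?D n x h) \<longlonglongrightarrow> D x h" if x: "x \<in> ball z r" for x h
  proof -
    have "Cauchy (\<lambda>n. ?D n x h)"
    proof (rule metric_CauchyI)
      fix e :: real assume e: "e > 0"
      have "e / (norm h + 1) > 0" using e by (simp add: add_nonneg_pos)
      from unif[OF this] obtain N where
        N: "\<And>n m. n \<ge> N \<Longrightarrow> m \<ge> N \<Longrightarrow> cmod (?D n x h - ?D m x h) \<le> e / (norm h + 1) * norm h"
        using x by blast
      have "e / (norm h + 1) * norm h < e"
        using e by (simp add: pos_divide_less_eq add_nonneg_pos distrib_left)
      then show "\<exists>M. \<forall>m\<ge>M. \<forall>n\<ge>M. dist (?D m x h) (?D n x h) < e"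
        using N unfolding dist_norm by (meson le_less_trans)
    qed
    then show ?thesis unfolding D_def using Cauchy_convergent_iff convergent_LIMSEQ_iff by blast
  qed
  have "\<exists>g'. \<forall>x\<in>ball z r. (\<lambda>n. f n x) \<longlonglongrightarrow> g' x \<and> (g' has_derivative D x) (at x within ball z r)"
  proof (rule has_derivative_sequence)
    show "(f n has_derivative ?D n x) (at x within ball z r)" if "x \<in> ball z r" for n x
      using holo_on_has_derivative[OF f, of x n] sub[OF that] r that
      by (meson centre_in_ball has_derivative_at_withinI subsetD)
    show "\<forall>\<^sub>F n in sequentially. \<forall>x\<in>ball z r. \<forall>h. cmod (?D n x h - D x h) \<le> e * norm h" if "e > 0" for e
    proof -
      from unif[OF that] obtain N where
        N: "\<And>n m x h. n \<ge> N \<Longrightarrow> m \<ge> N \<Longrightarrow> x \<in> ball z r \<Longrightarrow> cmod (?D n x h - ?D m x h) \<le> e * norm h"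
        by blast
      have "cmod (?D n x h - D x h) \<le> e * norm h" if "n \<ge> N" "x \<in> ball z r" for n x h
      proof (rule tendsto_upperbound)
        show "(\<lambda>m. cmod (?D n x h - ?D m x h)) \<longlonglongrightarrow> cmod (?D n x h - D x h)"
          by (intro tendsto_intros conv that)
        show "\<forall>\<^sub>F m in sequentially. cmod (?D n x h - ?D m x h) \<le> e * norm h"
          using N[OF that(1) _ that(2)] eventually_sequentially by blast
      qed simp
      then show ?thesis unfolding eventually_sequentially by blast
    qed
    show "z \<in> ball z r" using r by simp
    show "(\<lambda>n. f n z) \<longlonglongrightarrow> g z" by (rule tendsto_uniform_limitI[OF lim \<open>z \<in> S\<close>])
  qed simp
  then obtain g' where g': "\<And>x. x \<in> ball z r \<Longrightarrow> (\<lambda>n. f n x) \<longlonglongrightarrow> g' x"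
      "\<And>x. x \<in> ball z r \<Longrightarrow> (g' has_derivative D x) (at x within ball z r)" by blast
  have eq: "g' x = g x" if "x \<in> ball z r" for x
    using g'(1)[OF that] tendsto_uniform_limitI[OF lim] LIMSEQ_unique sub[OF that] r
    by (meson centre_in_ball subsetD)
  have "(g' has_derivative D z) (at z)"
    using g'(2)[of z] r at_within_open[of z "ball z r"] by simp
  then have "(g has_derivative D z) (at z)"
    by (rule has_derivative_transform_within_open[of _ _ _ UNIV "ball z r"]) (use r eq in auto)
  moreover have "D z (a *s v) = a * D z v" for a v
  proof (rule LIMSEQ_unique)
    have "z \<in> ball z r" using r by simp
    show "(\<lambda>n. ?D n z (a *s v)) \<longlonglongrightarrow> D z (a *s v)" by (rule conv) fact
    show "(\<lambda>n. ?D n z (a *s v)) \<longlonglongrightarrow> a * D z v"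
      unfolding holo_on_smult[OF f \<open>z \<in> S\<close>] by (intro tendsto_intros conv) fact
  qed
  ultimately show "\<exists>D. (g has_derivative D) (at z) \<and> (\<forall>a v. D (a *s v) = a * D v)" by blast
qed

text \<open>A Taylor remainder, with the second derivative controlled by Cauchy's inequality:
  circles of radius \<open>\<rho>/4\<close> about points of the disc of radius
  \<open>\<rho>/2\<close> give \<open>2 B / (\<rho>/4)^2 = 32 B / \<rho>^2\<close>. Only
  \<open>B\<close> and \<open>\<rho>\<close> enter, so the bound serves a whole family of parallel
  lines at once.\<close>

lemma difference_quotient_bound:
  assumes g: "g holomorphic_on (ball 0 \<rho>)" and B: "\<And>t. t \<in> ball 0 \<rho> \<Longrightarrow> cmod (g t) \<le> B"
    and \<rho>: "\<rho> > 0" and h: "h \<noteq> 0" "cmod h < \<rho> / 2"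
  shows "cmod ((g h - g 0) / h - deriv g 0) \<le> 32 * B / \<rho>\<^sup>2 * cmod h"
proof -
  have d2: "cmod ((deriv ^^ 2) g x) \<le> 32 * B / \<rho>\<^sup>2" if x: "x \<in> ball 0 (\<rho>/2)" for x
  proof -
    have sub: "cball x (\<rho>/4) \<subseteq> ball 0 \<rho>"
    proof
      fix y assume "y \<in> cball x (\<rho>/4)"
      then show "y \<in> ball 0 \<rho>"
        using x \<rho> dist_triangle[of 0 y x] by (simp add: dist_commute)
    qed
    have "cmod ((deriv ^^ 2) g x) \<le> fact 2 * B / (\<rho>/4) ^ 2"
    proof (rule Cauchy_inequality)
      show "g holomorphic_on ball x (\<rho>/4)"
        using g sub by (meson ball_subset_cball holomorphic_on_subset order_trans)
      show "continuous_on (cball x (\<rho>/4)) g"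
        using g sub holomorphic_on_imp_continuous_on continuous_on_subset by blast
      show "cmod (g y) \<le> B" if "cmod (x - y) = \<rho>/4" for y
        using B sub that by (auto simp: dist_norm subset_iff)
    qed (use \<rho> in auto)
    then show ?thesis using \<rho> by (simp add: power2_eq_square field_simps)
  qed
  have "cmod ((deriv ^^ 0) g h - (\<Sum>i\<le>1. (deriv ^^ i) g 0 * (h - 0) ^ i / fact i))
      \<le> 32 * B / \<rho>\<^sup>2 * cmod (h - 0) ^ Suc 1 / fact 1"
  proof (rule complex_Taylor)
    show "((deriv ^^ i) g has_field_derivative (deriv ^^ Suc i) g x) (at x within ball 0 (\<rho>/2))"
      if "x \<in> ball 0 (\<rho>/2)" for i x
    proof -
      have "(deriv ^^ i) g holomorphic_on ball 0 \<rho>" by (rule holomorphic_higher_deriv[OF g]) simp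
      then have "((deriv ^^ i) g has_field_derivative deriv ((deriv ^^ i) g) x) (at x)"
        by (rule holomorphic_derivI) (use that \<rho> in auto)
      then show ?thesis by (simp add: has_field_derivative_at_within)
    qed
    show "cmod ((deriv ^^ Suc 1) g x) \<le> 32 * B / \<rho>\<^sup>2" if "x \<in> ball 0 (\<rho>/2)" for x
      using d2[OF that] by (simp add: numeral_2_eq_2)
  qed (use h \<rho> in auto)
  then have *: "cmod (g h - g 0 - deriv g 0 * h) \<le> 32 * B / \<rho>\<^sup>2 * cmod h * cmod h"
    by (simp add: power2_eq_square algebra_simps)
  have "(g h - g 0) / h - deriv g 0 = (g h - g 0 - deriv g 0 * h) / h"
    using h by (simp add: field_simps)
  then have "cmod ((g h - g 0) / h - deriv g 0) = cmod (g h - g 0 - deriv g 0 * h) / cmod h"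
    by (simp add: norm_divide)
  also have "\<dots> \<le> 32 * B / \<rho>\<^sup>2 * cmod h * cmod h / cmod h"
    using * by (intro divide_right_mono) auto
  also have "\<dots> = 32 * B / \<rho>\<^sup>2 * cmod h" using h by simp
  finally show ?thesis .
qed

text \<open>Difference quotients are holomorphic, being made of translates of \<open>f\<close>, and
  they converge locally uniformly to the derivative by \<open>difference_quotient_bound\<close>,
  applied on all lines parallel to \<open>v\<close>.\<close>

lemma holo_on_ddir:
  assumes f: "holo_on S f" and S: "open S"
  shows "holo_on S (ddir v f)"
proof (rule holo_on_local)
  fix z assume "z \<in> S"
  then obtain R where R: "R > 0" "cball z R \<subseteq> S" using S open_contains_cball by blast
  define r where "r = R / 2"
  have r: "r > 0" using R by (simp add: r_def)
  have "compact (f ` cball z R)"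
    using holo_on_continuous[OF f] R(2) by (meson compact_cball compact_continuous_image continuous_on_subset)
  then obtain B where B: "\<And>w. w \<in> cball z R \<Longrightarrow> cmod (f w) \<le> B"
    by (meson bounded_iff compact_imp_bounded image_eqI)
  have sub: "ball x r \<subseteq> cball z R" if "x \<in> ball z r" for x
  proof
    fix y assume "y \<in> ball x r"
    then show "y \<in> cball z R"
      using that dist_triangle_half_l[of z x R y] by (simp add: r_def dist_commute)
  qed
  \<comment> \<open>The summand 1 covers \<open>v = 0\<close>.\<close>
  define \<rho> where "\<rho> = r / (norm v + 1)"
  have v1: "norm v + 1 > 0" by (simp add: add_nonneg_pos)
  have \<rho>: "\<rho> > 0" using r v1 by (simp add: \<rho>_def)
  have line: "x + t *s v \<in> cball z R" if "x \<in> ball z r" "t \<in> ball 0 \<rho>" for x t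
  proof -
    have "cmod t * norm v \<le> cmod t * (norm v + 1)" by (simp add: mult_left_mono)
    also have "\<dots> < r" using that v1 by (simp add: \<rho>_def field_simps)
    finally have "x + t *s v \<in> ball x r" by (rule ball_line)
    then show ?thesis using sub[OF that(1)] by blast
  qed
  have lineS: "x + t *s v \<in> S" if "x \<in> ball z r" "t \<in> ball 0 \<rho>" for x t
    using line[OF that] R(2) by blast
  \<comment> \<open>Starting at \<open>N0\<close> makes every step \<open>h n\<close> short enough,
    so that all quotients, and not only the late ones, are defined and holomorphic on the
    ball.\<close>
  obtain N0 :: nat where N0: "1 / real (Suc N0) < \<rho> / 2"
    using \<rho> nat_approx_posE[of "\<rho>/2"] by auto
  define h where "h n = complex_of_real (1 / real (Suc (N0 + n)))" for n
  have h: "h n \<noteq> 0" "cmod (h n) < \<rho> / 2" for n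
  proof -
    show "h n \<noteq> 0" by (simp add: h_def del: of_nat_Suc)
    have "cmod (h n) = 1 / real (Suc (N0 + n))" unfolding h_def norm_of_real by simp
    also have "\<dots> \<le> 1 / real (Suc N0)" by (simp add: frac_le)
    finally show "cmod (h n) < \<rho> / 2" using N0 by simp
  qed
  have hlim: "(\<lambda>n. cmod (h n)) \<longlonglongrightarrow> 0"
  proof -
    have "(\<lambda>n. 1 / real (Suc n)) \<longlonglongrightarrow> 0" using LIMSEQ_inverse_real_of_nat by (simp add: inverse_eq_divide)
    from LIMSEQ_ignore_initial_segment[OF this, of N0]
    show ?thesis by (simp add: h_def norm_divide add.commute del: of_nat_Suc)
  qed
  let ?q = "\<lambda>n x. (f (x + h n *s v) - f x) * (1 / h n)"
  have "holo_on (ball z r) (ddir v f)"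
  proof (rule holo_on_uniform_limit)
    show "holo_on (ball z r) (?q n)" for n
    proof (intro holo_on_mult holo_on_diff holo_on_const)
      show "holo_on (ball z r) (\<lambda>x. f (x + h n *s v))"
        by (rule holo_on_compose_translate[OF f]) (use lineS[where t = "h n"] h[of n] \<rho> in \<open>auto simp: dist_norm\<close>)
      show "holo_on (ball z r) f"
        by (rule holo_on_subset[OF f]) (use R in \<open>auto simp: r_def\<close>)
    qed
    show "uniform_limit (ball z r) ?q (ddir v f) sequentially"
    proof (rule uniform_limitI)
      fix e :: real assume e: "e > 0"
      have "(\<lambda>n. 32 * B / \<rho>\<^sup>2 * cmod (h n)) \<longlonglongrightarrow> 32 * B / \<rho>\<^sup>2 * 0"
        by (intro tendsto_intros hlim)
      then have ev: "\<forall>\<^sub>F n in sequentially. 32 * B / \<rho>\<^sup>2 * cmod (h n) < e"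
        using e by (auto dest: order_tendstoD(2))
      show "\<forall>\<^sub>F n in sequentially. \<forall>x\<in>ball z r. dist (?q n x) (ddir v f x) < e"
        using ev
      proof eventually_elim
        case (elim n)
        show ?case
        proof
          fix x assume x: "x \<in> ball z r"
          let ?g = "\<lambda>t. f (x + t *s v)"
          have hol: "?g holomorphic_on ball 0 \<rho>"
            using holomorphic_on_line[OF f] lineS[OF x] by blast
          have "deriv ?g 0 = ddir v f x"
            using DERIV_imp_deriv[OF has_field_derivative_line[OF f lineS[OF x, of 0]]] \<rho> by simp
          moreover have "cmod ((?g (h n) - ?g 0) / h n - deriv ?g 0) \<le> 32 * B / \<rho>\<^sup>2 * cmod (h n)"
            by (rule difference_quotient_bound[OF hol _ \<rho> h]) (use B line[OF x] in blast)
          ultimately show "dist (?q n x) (ddir v f x) < e"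
            using elim by (simp add: dist_norm)
        qed
      qed
    qed
  qed simp
  then show "\<exists>T. z \<in> T \<and> holo_on T (ddir v f)" using r by (intro exI[of _ "ball z r"]) auto
qed

lemma holo_on_imp_Cinf_on:
  assumes "holo_on S f" "open S" shows "Cinf_on S f"
proof -
  have "Ck_on m S f" if "holo_on S f" for m f
    using that
  proof (induction m arbitrary: f)
    case 0 then show ?case by (simp add: holo_on_continuous)
  next
    case (Suc m)
    then show ?case using holo_on_ddir[OF Suc.prems assms(2)] holo_on_differentiable[OF Suc.prems] by simp
  qed
  then show ?thesis using assms unfolding Cinf_on_def by blast
qed

section \<open>Iterated directional derivatives\<close>

lemma ddir_cmult:
  assumes "holo_on S f" "z \<in> S"
  shows "ddir v (\<lambda>z. c * f z) z = c * ddir v f z"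
proof -
  have "((\<lambda>z. c * f z) has_derivative (\<lambda>h. c * frechet_derivative f (at z) h)) (at z)"
    by (rule has_derivative_mult_right[OF holo_on_has_derivative[OF assms]])
  from fun_cong[OF frechet_derivative_at[OF this], of v] show ?thesis by simp
qed

lemma ddir_add:
  assumes "holo_on S f" "holo_on S g" "z \<in> S"
  shows "ddir v (\<lambda>z. f z + g z) z = ddir v f z + ddir v g z"
proof -
  have "((\<lambda>z. f z + g z) has_derivative
     (\<lambda>h. frechet_derivative f (at z) h + frechet_derivative g (at z) h)) (at z)"
    by (rule has_derivative_add[OF holo_on_has_derivative[OF assms(1,3)] holo_on_has_derivative[OF assms(2,3)]])
  from fun_cong[OF frechet_derivative_at[OF this], of v] show ?thesis by simp
qed

lemma ddir_const [simp]: "ddir v (\<lambda>z. c) z = 0"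
proof -
  have "((\<lambda>z. c) has_derivative (\<lambda>h. 0)) (at z)" by simp
  from fun_cong[OF frechet_derivative_at[OF this], of v] show ?thesis by simp
qed

lemma iter_ddir_cong:
  assumes "open S" "\<And>z. z \<in> S \<Longrightarrow> f z = g z" "z \<in> S"
  shows "(ddir v ^^ m) f z = (ddir v ^^ m) g z"
  using assms(3)
proof (induction m arbitrary: z)
  case (Suc m)
  then show ?case
    using ddir_eq_on_open[OF assms(1) Suc.prems, of "(ddir v ^^ m) f" "(ddir v ^^ m) g"] by simp
qed (simp add: assms(2))

lemma holo_on_iter_ddir: "holo_on S f \<Longrightarrow> open S \<Longrightarrow> holo_on S ((ddir v ^^ m) f)"
  by (induction m) (auto intro: holo_on_ddir)

lemma iter_ddir_cmult:
  assumes "holo_on S f" "open S" "z \<in> S"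
  shows "(ddir v ^^ m) (\<lambda>z. c * f z) z = c * (ddir v ^^ m) f z"
  using assms(3)
proof (induction m arbitrary: z)
  case (Suc m)
  have "ddir v ((ddir v ^^ m) (\<lambda>z. c * f z)) z = ddir v (\<lambda>z. c * (ddir v ^^ m) f z) z"
    by (rule fun_cong[OF ddir_eq_on_open[OF assms(2) Suc.prems Suc.IH]])
  then show ?case
    using ddir_cmult[OF holo_on_iter_ddir[OF assms(1,2)] Suc.prems] by simp
qed simp

lemma iter_ddir_add:
  assumes "holo_on S f" "holo_on S g" "open S" "z \<in> S"
  shows "(ddir v ^^ m) (\<lambda>z. f z + g z) z = (ddir v ^^ m) f z + (ddir v ^^ m) g z"
  using assms(4)
proof (induction m arbitrary: z)
  case (Suc m)
  have "ddir v ((ddir v ^^ m) (\<lambda>z. f z + g z)) z = ddir v (\<lambda>z. (ddir v ^^ m) f z + (ddir v ^^ m) g z) z"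
    by (rule fun_cong[OF ddir_eq_on_open[OF assms(3) Suc.prems Suc.IH]])
  then show ?case
    using ddir_add[OF holo_on_iter_ddir[OF assms(1,3)] holo_on_iter_ddir[OF assms(2,3)] Suc.prems] by simp
qed simp

lemma iter_ddir_zero [simp]: "(ddir v ^^ m) (\<lambda>z. 0) = (\<lambda>z. 0)"
  by (induction m) auto

lemma iter_ddir_sum:
  assumes "\<And>i. i \<in> I \<Longrightarrow> holo_on S (f i)" "open S" "z \<in> S"
  shows "(ddir v ^^ m) (\<lambda>z. \<Sum>i\<in>I. f i z) z = (\<Sum>i\<in>I. (ddir v ^^ m) (f i) z)"
  using assms(1)
proof (induction I rule: infinite_finite_induct)
  case (insert i I)
  then have "holo_on S (f i)" "holo_on S (\<lambda>z. \<Sum>i\<in>I. f i z)" by (auto intro: holo_on_sum)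
  then show ?case
    using insert iter_ddir_add[OF _ _ assms(2,3), where f = "f i" and g = "\<lambda>z. \<Sum>i\<in>I. f i z"] by simp
qed auto

lemma ddir_axis_expansion:
  assumes "holo_on S f" "z \<in> S"
  shows "ddir v f z = (\<Sum>i\<in>UNIV. v $ i * ddir (axis i 1) f z)"
proof -
  have "ddir v f z = ddir (\<Sum>i\<in>UNIV. v $ i *s axis i 1) f z"
    by (simp add: basis_expansion)
  then show ?thesis
    by (simp add: linear_sum[OF holo_on_linear[OF assms]] holo_on_smult[OF assms])
qed

lemma iter_ddir_smult:
  assumes "holo_on S f" "open S" "z \<in> S"
  shows "(ddir (c *s v) ^^ m) f z = c ^ m * (ddir v ^^ m) f z"
  using assms(3)
proof (induction m arbitrary: z)
  case (Suc m)
  have "ddir (c *s v) ((ddir (c *s v) ^^ m) f) z = ddir (c *s v) (\<lambda>z. c ^ m * (ddir v ^^ m) f z) z"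
    by (rule fun_cong[OF ddir_eq_on_open[OF assms(2) Suc.prems Suc.IH]])
  also have "\<dots> = c ^ m * (c * ddir v ((ddir v ^^ m) f) z)"
    unfolding ddir_cmult[OF holo_on_iter_ddir[OF assms(1,2)] Suc.prems]
      holo_on_smult[OF holo_on_iter_ddir[OF assms(1,2)] Suc.prems] ..
  finally show ?case by (simp add: mult_ac)
qed simp

text \<open>In the direction \<open>v\<close> this is a homogeneous polynomial of degree
  \<open>m\<close>. The induction splits off the innermost derivative: its coefficients
  \<open>v $ i\<close> are constant in the space variable and can be pulled out of the remaining
  ones. This makes the Taylor polynomials of \<open>f\<close> at \<open>p\<close> holomorphic
  functions.\<close>

lemma holo_on_iter_ddir_direction:
  assumes "holo_on S f" "open S" "p \<in> S"
  shows "holo_on UNIV (\<lambda>v. (ddir v ^^ m) f p)"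
  using assms(1)
proof (induction m arbitrary: f)
  case (Suc m)
  have "(ddir v ^^ Suc m) f p = (\<Sum>i\<in>UNIV. v $ i * (ddir v ^^ m) (ddir (axis i 1) f) p)" for v
  proof -
    have "(ddir v ^^ Suc m) f p = (ddir v ^^ m) (ddir v f) p" by (simp only: funpow_Suc_right o_apply)
    also have "\<dots> = (ddir v ^^ m) (\<lambda>z. \<Sum>i\<in>UNIV. v $ i * ddir (axis i 1) f z) p"
      by (rule iter_ddir_cong[OF assms(2) ddir_axis_expansion[OF Suc.prems] assms(3)])
    also have "\<dots> = (\<Sum>i\<in>UNIV. (ddir v ^^ m) (\<lambda>z. v $ i * ddir (axis i 1) f z) p)"
      by (intro iter_ddir_sum[OF _ assms(2,3)] holo_on_cmult holo_on_ddir[OF Suc.prems assms(2)])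
    also have "\<dots> = (\<Sum>i\<in>UNIV. v $ i * (ddir v ^^ m) (ddir (axis i 1) f) p)"
      by (intro sum.cong refl iter_ddir_cmult[OF _ assms(2,3)] holo_on_ddir[OF Suc.prems assms(2)])
    finally show ?thesis .
  qed
  then have eq: "(\<lambda>v. (ddir v ^^ Suc m) f p) = (\<lambda>v. \<Sum>i\<in>UNIV. v $ i * (ddir v ^^ m) (ddir (axis i 1) f) p)"
    by (rule ext)
  show ?case
    unfolding eq
  proof (rule holo_on_sum)
    fix i
    have "holo_on UNIV (\<lambda>v. (ddir v ^^ m) (ddir (axis i 1) f) p)"
      by (rule Suc.IH[OF holo_on_ddir[OF Suc.prems assms(2)]])
    then show "holo_on UNIV (\<lambda>v. v $ i * (ddir v ^^ m) (ddir (axis i 1) f) p)"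
      by (rule holo_on_mult[OF holo_on_comp_nth])
  qed
qed simp

section \<open>Taylor series, identity theorem, normal families\<close>

lemma open_line: "open S \<Longrightarrow> open {t. z + t *s (v :: complex^'n) \<in> S}"
  using open_vimage[of S "\<lambda>t. z + t *s v"] by (simp add: vimage_def continuous_intros)

lemma higher_deriv_line:
  assumes "holo_on S f" "open S" "z + t *s v \<in> S"
  shows "(deriv ^^ m) (\<lambda>t. f (z + t *s v)) t = (ddir v ^^ m) f (z + t *s v)"
  using assms(3)
proof (induction m arbitrary: t)
  case (Suc m)
  have "((\<lambda>t. (ddir v ^^ m) f (z + t *s v)) has_field_derivative (ddir v ^^ Suc m) f (z + t *s v)) (at t)"
    using has_field_derivative_line[OF holo_on_iter_ddir[OF assms(1,2)] Suc.prems] by simp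
  then have "((deriv ^^ m) (\<lambda>t. f (z + t *s v)) has_field_derivative (ddir v ^^ Suc m) f (z + t *s v)) (at t)"
    by (rule has_field_derivative_transform_within_open[OF _ open_line[OF assms(2), of z v]])
       (use Suc in auto)
  then show ?case using DERIV_imp_deriv by fastforce
qed simp

text \<open>The direction carries the radius: for \<open>norm v < r\<close> the unit disc of the
  line stays in the ball, so Cauchy's inequality is used with radius 1.
  \<open>Taylor_extension\<close> takes estimates of exactly this form as its hypothesis.\<close>

lemma iter_ddir_bound:
  assumes f: "holo_on (ball z r) f" and B: "\<And>w. w \<in> ball z r \<Longrightarrow> cmod (f w) \<le> B" and v: "norm v < r"
  shows "cmod ((ddir v ^^ m) f z) \<le> fact m * B"
proof -
  have r: "r > 0" using v norm_ge_zero[of v] by linarith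
  have in_ball: "z + t *s v \<in> ball z r" if "cmod t \<le> 1" for t
  proof (rule ball_line)
    have "cmod t * norm v \<le> 1 * norm v" by (rule mult_right_mono) (use that in auto)
    then show "cmod t * norm v < r" using v by simp
  qed
  have hol: "(\<lambda>t. f (z + t *s v)) holomorphic_on (cball 0 1)"
    by (rule holomorphic_on_line[OF f]) (use in_ball in auto)
  have "cmod ((deriv ^^ m) (\<lambda>t. f (z + t *s v)) 0) \<le> fact m * B / 1 ^ m"
  proof (rule Cauchy_inequality)
    show "(\<lambda>t. f (z + t *s v)) holomorphic_on ball 0 1"
      using hol by (rule holomorphic_on_subset) auto
    show "continuous_on (cball 0 1) (\<lambda>t. f (z + t *s v))"
      using hol by (rule holomorphic_on_imp_continuous_on)
  qed (use in_ball B in auto)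
  then show ?thesis using higher_deriv_line[OF f, of z 0 v m] r by simp
qed

lemma iter_ddir_sums:
  assumes f: "holo_on (ball p \<rho>) f" and x: "x \<in> ball p \<rho>"
  shows "(\<lambda>m. (ddir (x - p) ^^ m) f p / fact m) sums f x"
proof -
  have \<rho>: "\<rho> > 0" using x by (metis ball_eq_empty empty_iff not_le)
  \<comment> \<open>The disc of radius \<open>s\<close> is mapped into the ball and contains
    \<open>t = 1\<close>, where the line passes through \<open>x\<close>. For \<open>x = p\<close>
    the line is constant, and 2 is an arbitrary value above 1.\<close>
  define s where "s = (if x = p then 2 else \<rho> / norm (x - p))"
  have s: "s > 1" using x by (simp add: s_def dist_norm norm_minus_commute)
  have line: "p + t *s (x - p) \<in> ball p \<rho>" if "t \<in> ball 0 s" for t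
    by (rule ball_line, use that x \<rho> in \<open>auto simp: s_def field_simps split: if_splits\<close>)
  have "(\<lambda>t. f (p + t *s (x - p))) holomorphic_on ball 0 s"
    by (rule holomorphic_on_line[OF f line])
  from holomorphic_power_series[OF this, of 1] s
  have "(\<lambda>m. (deriv ^^ m) (\<lambda>t. f (p + t *s (x - p))) 0 / fact m) sums f x" by simp
  then show ?thesis using higher_deriv_line[OF f, of p 0 "x - p"] \<rho> by simp
qed

text \<open>Homogeneity of degree \<open>m\<close> exchanges half of the radius for the factor
  \<open>(1/2)^m\<close>, so the series is dominated by a geometric one with sum
  \<open>2 * B\<close>. The domain of the sum depends on \<open>r\<close> alone; in contrast
  \<open>\<delta>\<close> depends on \<open>S\<close>, and agreement on a set independent of the
  function is left to \<open>eq_near_connected\<close>.\<close>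

lemma Taylor_extension:
  assumes f: "holo_on S f" and S: "open S" "p \<in> S" and r: "r > 0"
    and B: "\<And>v m. norm v < r \<Longrightarrow> cmod ((ddir v ^^ m) f p) \<le> fact m * B"
  obtains H \<delta> where "holo_on (ball p (r/2)) H" "\<And>x. x \<in> ball p (r/2) \<Longrightarrow> cmod (H x) \<le> 2 * B"
    "\<delta> > 0" "\<And>x. x \<in> ball p \<delta> \<Longrightarrow> H x = f x"
proof -
  have B0: "B \<ge> 0" using B[of 0 0] r by (simp add: order_trans[OF norm_ge_zero])
  define t where "t m x = (ddir (x - p) ^^ m) f p / fact m" for m x
  have t_bound: "cmod (t m x) \<le> B * (1/2) ^ m" if "x \<in> ball p (r/2)" for m x
  proof -
    have eq: "x - p = (1/2) *s (2 *s (x - p))" by (simp add: vec_eq_iff)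
    have "norm (2 *s (x - p)) < r" using that by (simp only: norm_vector_smult) (simp add: dist_norm norm_minus_commute)
    then have "cmod ((ddir (2 *s (x - p)) ^^ m) f p) \<le> fact m * B" by (rule B)
    moreover have "cmod ((ddir (x - p) ^^ m) f p) = (1/2) ^ m * cmod ((ddir (2 *s (x - p)) ^^ m) f p)"
    proof -
      have "(ddir (x - p) ^^ m) f p = (1/2) ^ m * (ddir (2 *s (x - p)) ^^ m) f p"
        by (subst eq) (rule iter_ddir_smult[OF f S])
      then show ?thesis by (simp only: norm_mult norm_power norm_divide norm_one norm_numeral)
    qed
    ultimately have "cmod ((ddir (x - p) ^^ m) f p) \<le> (1/2) ^ m * (fact m * B)" by (simp add: mult_left_mono)
    then show ?thesis by (simp add: t_def norm_divide divide_simps mult_ac)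
  qed
  have summ: "summable (\<lambda>m. B * (1/2) ^ m)" by (intro summable_mult summable_geometric) simp
  define H where "H x = (\<Sum>m. t m x)" for x
  obtain \<rho> where \<rho>: "\<rho> > 0" "ball p \<rho> \<subseteq> S" using S open_contains_ball by blast
  show ?thesis
  proof
    show "holo_on (ball p (r/2)) H"
    proof (rule holo_on_uniform_limit)
      show "uniform_limit (ball p (r/2)) (\<lambda>n x. \<Sum>m<n. t m x) H sequentially"
        unfolding H_def by (rule Weierstrass_m_test[OF t_bound summ])
      have "holo_on UNIV (\<lambda>x. (ddir (x + - p) ^^ m) f p)" for m
        by (rule holo_on_compose_translate[OF holo_on_iter_ddir_direction[OF f S]]) simp
      then have "holo_on UNIV (\<lambda>x. (1 / fact m) * (ddir (x + - p) ^^ m) f p)" for m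
        by (rule holo_on_cmult)
      then have "holo_on UNIV (t m)" for m
        unfolding t_def by simp
      then show "holo_on (ball p (r/2)) (\<lambda>x. \<Sum>m<n. t m x)" for n
        by (intro holo_on_sum) (meson holo_on_subset subset_UNIV)
    qed simp
    show "cmod (H x) \<le> 2 * B" if x: "x \<in> ball p (r/2)" for x
    proof -
      have "cmod (H x) \<le> (\<Sum>m. B * (1/2) ^ m)"
        unfolding H_def by (rule norm_suminf_le[OF t_bound[OF x] summ])
      also have "\<dots> = 2 * B" by (subst suminf_mult) (auto simp: suminf_geometric)
      finally show ?thesis .
    qed
    show "\<rho> > 0" by fact
    show "H x = f x" if "x \<in> ball p \<rho>" for x
      unfolding H_def t_def by (rule sums_unique[OF iter_ddir_sums[OF holo_on_subset[OF f \<rho>(2)] that], symmetric])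
  qed
qed

text \<open>The complex line through \<open>y\<close> and \<open>x\<close> meets the ball in a
  convex, hence connected, open subset of the plane, and the function vanishes near the parameter 0;
  the identity theorem of one variable reaches the parameter 1.\<close>

lemma holo_on_eq_0_ball:
  assumes f: "holo_on (ball w \<rho>) f" and y: "y \<in> ball w \<rho>" and r: "r > 0"
    and 0: "\<And>x. x \<in> ball y r \<inter> ball w \<rho> \<Longrightarrow> f x = 0" and x: "x \<in> ball w \<rho>"
  shows "f x = 0"
proof -
  let ?L = "{t. y + t *s (x - y) \<in> ball w \<rho>}" and ?g = "\<lambda>t. f (y + t *s (x - y))"
  let ?K = "{t. y + t *s (x - y) \<in> ball w \<rho> \<inter> ball y r}"
  have lin: "linear (\<lambda>t. t *s (x - y))"
    using bounded_linear_smult_left bounded_linear.linear by blast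
  have "?L = (\<lambda>t. t *s (x - y)) -` ball (w - y) \<rho>"
  proof -
    have eq: "dist w (y + v) = dist (w - y) v" for v by (simp only: dist_norm diff_diff_eq)
    show ?thesis unfolding vimage_def mem_ball eq ..
  qed
  then have "convex ?L"
    using convex_linear_vimage[OF lin convex_ball] by simp
  then have "connected ?L" by (rule convex_connected)
  have "?g 1 = 0"
  proof (rule analytic_continuation_open[of ?K ?L ?g "\<lambda>_. 0"])
    show "open ?K" "open ?L" by (intro open_line open_Int open_ball)+
    have "0 \<in> ?K" using y r by simp
    then show "?K \<noteq> {}" by blast
    show "?g holomorphic_on ?L" by (rule holomorphic_on_line[OF f]) simp
    show "connected ?L" by fact
    show "?K \<subseteq> ?L" by blast
    show "?g t = 0" if "t \<in> ?K" for t using 0 that by blast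
    show "1 \<in> ?L" using x by simp
  qed simp
  then show ?thesis by simp
qed

text \<open>Cauchy's estimate on balls of radius \<open>r/2\<close> about points of the half ball
  gives the common Lipschitz constant \<open>4 * B / r\<close>, hence equicontinuity; the rest is
  Arzela-Ascoli.\<close>

lemma Montel_ball:
  assumes F: "\<And>n. holo_on (ball z r) (F n)" and B: "\<And>n x. x \<in> ball z r \<Longrightarrow> cmod (F n x) \<le> B" and r: "r > 0"
  obtains G k where "strict_mono (k :: nat \<Rightarrow> nat)" "holo_on (ball z (r/2)) G"
    "\<And>x. x \<in> ball z (r/2) \<Longrightarrow> (\<lambda>n. F (k n) x) \<longlonglongrightarrow> G x" "\<And>x. x \<in> ball z (r/2) \<Longrightarrow> cmod (G x) \<le> B"
proof -
  have sub: "ball x (r/2) \<subseteq> ball z r" if "x \<in> cball z (r/2)" for x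
  proof
    fix y assume "y \<in> ball x (r/2)"
    then show "y \<in> ball z r" using that dist_triangle[of z y x] by simp
  qed
  have B0: "B \<ge> 0" using B[of z 0] r by (meson centre_in_ball norm_ge_zero order_trans)
  let ?K = "4 * B / r"
  have K0: "?K \<ge> 0" using B0 r by simp
  have lip: "cmod (F n x - F n y) \<le> ?K * norm (x - y)" if xy: "x \<in> cball z (r/2)" "y \<in> cball z (r/2)" for n x y
  proof (rule differentiable_bound[OF convex_cball])
    fix a assume a: "a \<in> cball z (r/2)"
    show "(F n has_derivative frechet_derivative (F n) (at a)) (at a within cball z (r/2))"
      using holo_on_has_derivative[OF F, of a n] sub[OF a] r
      by (meson centre_in_ball has_derivative_at_withinI half_gt_zero subsetD)
    show "onorm (frechet_derivative (F n) (at a)) \<le> ?K"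
    proof (rule onorm_le)
      fix v
      have "cmod (ddir v (F n) a) \<le> 2 * B / (r/2) * norm v"
        by (rule Cauchy_bound_ddir[OF holo_on_subset[OF F sub[OF a]]]) (use B sub[OF a] r in auto)
      then show "cmod (ddir v (F n) a) \<le> ?K * norm v" by simp
    qed
  qed (use xy in auto)
  obtain g k where g: "continuous_on (cball z (r/2)) g" "strict_mono (k :: nat \<Rightarrow> nat)"
    "\<And>e. 0 < e \<Longrightarrow> \<exists>N. \<forall>n x. n \<ge> N \<and> x \<in> cball z (r/2) \<longrightarrow> cmod (F (k n) x - g x) < e"
  proof (rule Arzela_Ascoli[of "cball z (r/2)" F B])
    show "cmod (F n x) \<le> B" if "x \<in> cball z (r/2)" for n x
      using B that r by auto
    show "\<exists>d>0. \<forall>n y. y \<in> cball z (r/2) \<and> norm (x - y) < d \<longrightarrow> cmod (F n x - F n y) < e"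
      if "x \<in> cball z (r/2)" "0 < e" for x e
    proof (intro exI conjI allI impI)
      show "e / (?K + 1) > 0" using K0 \<open>0 < e\<close> by simp
      fix n y assume y: "y \<in> cball z (r/2) \<and> norm (x - y) < e / (?K + 1)"
      have "cmod (F n x - F n y) \<le> ?K * norm (x - y)" using lip that y by blast
      also have "\<dots> \<le> (?K + 1) * norm (x - y)" by (rule mult_right_mono) auto
      also have "\<dots> < e"
      proof -
        have "?K + 1 > 0" using K0 by linarith
        then show ?thesis using y by (simp only: pos_less_divide_eq mult.commute)
      qed
      finally show "cmod (F n x - F n y) < e" .
    qed
  qed (auto intro: that)
  have unif: "uniform_limit (ball z (r/2)) (\<lambda>n. F (k n)) g sequentially"
  proof (rule uniform_limitI)
    fix e :: real assume "e > 0"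
    from g(3)[OF this] show "\<forall>\<^sub>F n in sequentially. \<forall>x\<in>ball z (r/2). dist (F (k n) x) (g x) < e"
      unfolding eventually_sequentially dist_norm by (meson ball_subset_cball subsetD)
  qed
  show ?thesis
  proof
    show "strict_mono k" by fact
    show "holo_on (ball z (r/2)) g"
    proof (rule holo_on_uniform_limit[OF _ _ unif])
      show "holo_on (ball z (r/2)) (F (k n))" for n
        by (rule holo_on_subset[OF F]) (use r in auto)
    qed simp
    show lim: "(\<lambda>n. F (k n) x) \<longlonglongrightarrow> g x" if "x \<in> ball z (r/2)" for x
      using tendsto_uniform_limitI[OF unif that] .
    show "cmod (g x) \<le> B" if "x \<in> ball z (r/2)" for x
      by (rule LIMSEQ_le_const2[OF tendsto_norm[OF lim[OF that]]]) (use B that r in auto)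
  qed
qed

section \<open>Defining functions and curves\<close>

text \<open>Composition with the transposition of \<open>i\<close> and \<open>j\<close> permutes the
  summands and changes their signs, so the sum equals its own negative.\<close>

lemma wedge_eq_0:
  assumes "i < k" "j < k" "i \<noteq> j" and eq: "\<alpha> i = \<alpha> j"
  shows "wedge k \<alpha> v = 0"
proof -
  let ?\<tau> = "Transposition.transpose i j" and ?F = "\<lambda>\<pi>. of_int (sign \<pi>) * (\<Prod>l<k. \<alpha> l (v (\<pi> l)))"
  have \<tau>: "?\<tau> permutes {..<k}" using assms by (intro permutes_swap_id) auto
  have F: "?F (\<pi> \<circ> ?\<tau>) = - ?F \<pi>" if "\<pi> permutes {..<k}" for \<pi>
  proof -
    have "permutation \<pi>" "permutation ?\<tau>"
      using that permutation_permutes by (blast, simp add: permutation_swap_id)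
    then have "sign (\<pi> \<circ> ?\<tau>) = - sign \<pi>"
      using assms by (simp add: sign_compose sign_swap_id)
    moreover have "(\<Prod>l<k. \<alpha> l (v ((\<pi> \<circ> ?\<tau>) l))) = (\<Prod>l<k. \<alpha> l (v (\<pi> l)))"
    proof -
      have "(\<Prod>l<k. \<alpha> l (v (\<pi> l))) = (\<Prod>l<k. \<alpha> (?\<tau> l) (v (\<pi> (?\<tau> l))))"
        using prod.permute[OF \<tau>, of "\<lambda>l. \<alpha> l (v (\<pi> l))"] by (simp add: o_def)
      moreover have "\<alpha> (?\<tau> l) = \<alpha> l" for l using eq by (cases "l = i \<or> l = j") auto
      ultimately show ?thesis by simp
    qed
    ultimately show ?thesis by simp
  qed
  have "(\<Sum>\<pi> | \<pi> permutes {..<k}. ?F (\<pi> \<circ> ?\<tau>)) = (\<Sum>\<pi> | \<pi> permutes {..<k}. - ?F \<pi>)"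
    by (rule sum.cong[OF refl], rule F) simp
  then have "wedge k \<alpha> v = - wedge k \<alpha> v"
    unfolding wedge_def using sum_permutations_compose_right[OF \<tau>, of ?F] by (simp add: sum_negf)
  then show ?thesis by simp
qed

text \<open>The dual vectors are given by the rule for inverting a matrix through its cofactors.\<close>

lemma wedge_dual_vectors:
  fixes \<alpha> :: "nat \<Rightarrow> 'v::real_vector \<Rightarrow> real"
  assumes lin: "\<And>j. j < k \<Longrightarrow> linear (\<alpha> j)" and nz: "wedge k \<alpha> v \<noteq> 0"
  obtains u where "\<And>i j. i < k \<Longrightarrow> j < k \<Longrightarrow> \<alpha> i (u j) = (if i = j then 1 else 0)"
proof
  define c where "c j \<pi> = of_int (sign \<pi>) * (\<Prod>l\<in>{..<k}-{j}. \<alpha> l (v (\<pi> l)))" for j \<pi>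
  define u where "u j = (1 / wedge k \<alpha> v) *\<^sub>R (\<Sum>\<pi> | \<pi> permutes {..<k}. c j \<pi> *\<^sub>R v (\<pi> j))" for j
  fix i j assume ij: "i < k" "j < k"
  have "\<alpha> i (u j) = (\<Sum>\<pi> | \<pi> permutes {..<k}. c j \<pi> * \<alpha> i (v (\<pi> j))) / wedge k \<alpha> v"
    unfolding u_def using lin[OF ij(1)] by (simp add: linear_cmul linear_sum) (simp only: sum_divide_distrib)
  \<comment> \<open>Expansion along row \<open>j\<close> of the determinant in which row
    \<open>j\<close> has been replaced by row \<open>i\<close>; for \<open>i \<noteq> j\<close> two
    of its rows are equal.\<close>
  also have "(\<Sum>\<pi> | \<pi> permutes {..<k}. c j \<pi> * \<alpha> i (v (\<pi> j))) = wedge k (\<alpha>(j := \<alpha> i)) v"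
    unfolding wedge_def
  proof (rule sum.cong[OF refl])
    fix \<pi> :: "nat \<Rightarrow> nat"
    have "(\<Prod>l<k. (\<alpha>(j := \<alpha> i)) l (v (\<pi> l)))
        = \<alpha> i (v (\<pi> j)) * (\<Prod>l\<in>{..<k}-{j}. (\<alpha>(j := \<alpha> i)) l (v (\<pi> l)))"
      using ij by (subst prod.remove[of _ j]) auto
    also have "(\<Prod>l\<in>{..<k}-{j}. (\<alpha>(j := \<alpha> i)) l (v (\<pi> l))) = (\<Prod>l\<in>{..<k}-{j}. \<alpha> l (v (\<pi> l)))"
      by (rule prod.cong) auto
    finally show "c j \<pi> * \<alpha> i (v (\<pi> j))
        = of_int (sign \<pi>) * (\<Prod>l<k. (\<alpha>(j := \<alpha> i)) l (v (\<pi> l)))"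
      by (simp add: c_def)
  qed
  finally have eq: "\<alpha> i (u j) = wedge k (\<alpha>(j := \<alpha> i)) v / wedge k \<alpha> v" .
  show "\<alpha> i (u j) = (if i = j then 1 else 0)"
  proof (cases "i = j")
    case True
    then show ?thesis using eq nz by simp
  next
    case False
    then have "wedge k (\<alpha>(j := \<alpha> i)) v = 0" by (intro wedge_eq_0[OF ij]) auto
    then show ?thesis using eq False by simp
  qed
qed

text \<open>The map \<open>z \<mapsto> z - a + \<Sum>\<^sub>j (\<rho>\<^sub>j z - d\<rho>\<^sub>j(a)(z - a)) u\<^sub>j\<close> has the identity as derivative at \<open>a\<close>
  and carries \<open>\<rho>\<^sub>j\<close> to the linear form \<open>d\<rho>\<^sub>j(a)\<close>; \<open>\<Psi>\<close> is its local inverse.\<close>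

lemma straighten_defining_functions:
  fixes \<rho> :: "nat \<Rightarrow> 'a::euclidean_space \<Rightarrow> real"
  assumes W: "open W" "a \<in> W" and C1: "\<And>j. j < k \<Longrightarrow> Ck_on (Suc 0) W (\<rho> j)"
    and \<rho>0: "\<And>j. j < k \<Longrightarrow> \<rho> j a = 0"
    and dual: "\<And>i j. i < k \<Longrightarrow> j < k \<Longrightarrow> frechet_derivative (\<rho> i) (at a) (u j) = (if i = j then 1 else 0)"
  obtains V \<Psi> where "open V" "0 \<in> V" "\<Psi> 0 = a" "(\<Psi> has_derivative (\<lambda>x. x)) (at 0)"
    "\<And>T. T \<subseteq> V \<Longrightarrow> open T \<Longrightarrow> open (\<Psi> ` T)" "continuous_on V \<Psi>" "\<Psi> ` V \<subseteq> W"
    "\<And>j y. j < k \<Longrightarrow> y \<in> V \<Longrightarrow> \<rho> j (\<Psi> y) = frechet_derivative (\<rho> j) (at a) y"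
proof -
  define D where "D j z = frechet_derivative (\<rho> j) (at z)" for j z
  have der: "(\<rho> j has_derivative D j z) (at z)" if "j < k" "z \<in> W" for j z
    using C1[OF that(1)] that(2) by (simp add: D_def frechet_derivative_works)
  have cont: "continuous_on W (\<lambda>z. D j z h)" if "j < k" for j h
    using C1[OF that] by (simp add: D_def)
  have blin: "bounded_linear (D j z)" if "j < k" "z \<in> W" for j z
    using der[OF that] has_derivative_bounded_linear by blast
  note lin = bounded_linear.linear[OF blin]
  define f where "f z = (z - a) + (\<Sum>j<k. (\<rho> j z - D j a (z - a)) *\<^sub>R u j)" for z
  define f' where "f' z = Blinfun (\<lambda>h. h + (\<Sum>j<k. (D j z h - D j a h) *\<^sub>R u j))" for z
  have bl: "bounded_linear (\<lambda>h. h + (\<Sum>j<k. (D j z h - D j a h) *\<^sub>R u j))" if "z \<in> W" for z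
    using blin[OF _ that] blin[OF _ W(2)]
    by (intro bounded_linear_add bounded_linear_ident bounded_linear_sum
        bounded_linear_scaleR_const bounded_linear_sub) auto
  have f'_app: "blinfun_apply (f' z) = (\<lambda>h. h + (\<Sum>j<k. (D j z h - D j a h) *\<^sub>R u j))" if "z \<in> W" for z
    unfolding f'_def by (rule bounded_linear_Blinfun_apply[OF bl[OF that]])
  have f_der: "(f has_derivative blinfun_apply (f' z)) (at z)" if z: "z \<in> W" for z
  proof -
    have "((\<lambda>z. (\<rho> j z - D j a (z - a)) *\<^sub>R u j) has_derivative (\<lambda>h. (D j z h - D j a h) *\<^sub>R u j)) (at z)"
      if "j < k" for j
    proof -
      have "((\<lambda>z. D j a (z - a)) has_derivative D j a) (at z)"
        by (rule has_derivative_eq_rhs[OF bounded_linear.has_derivative[OF blin[OF that W(2)]]])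
           (auto intro!: derivative_eq_intros)
      then show ?thesis
        by (intro has_derivative_scaleR_left has_derivative_diff der[OF that z])
    qed
    then have "((\<lambda>z. \<Sum>j<k. (\<rho> j z - D j a (z - a)) *\<^sub>R u j) has_derivative
        (\<lambda>h. \<Sum>j<k. (D j z h - D j a h) *\<^sub>R u j)) (at z)"
      by (intro has_derivative_sum) auto
    moreover have "((\<lambda>z. z - a) has_derivative (\<lambda>h. h)) (at z)" by (auto intro!: derivative_eq_intros)
    ultimately show ?thesis
      unfolding f'_app[OF z] f_def by (rule has_derivative_add[rotated])
  qed
  have f'_cont: "continuous_on W f'"
  proof (rule continuous_on_blinfun_componentwise)
    fix i :: 'a
    have "continuous_on W (\<lambda>z. i + (\<Sum>j<k. (D j z i - D j a i) *\<^sub>R u j))"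
      by (intro continuous_intros cont) auto
    then show "continuous_on W (\<lambda>z. blinfun_apply (f' z) i)"
      by (rule continuous_on_eq) (simp add: f'_app)
  qed
  have f'a: "f' a = id_blinfun"
    by (rule blinfun_eqI) (simp add: f'_app[OF W(2)])
  have f'a_inv: "id_blinfun o\<^sub>L f' a = id_blinfun"
    by (rule blinfun_eqI) (simp add: f'a)
  have fa: "f a = 0"
    using lin[OF _ W(2)] by (simp add: f_def \<rho>0 linear_0)
  have "\<exists>U' V g g'. open U' \<and> U' \<subseteq> W \<and> a \<in> U' \<and> open V \<and> f a \<in> V \<and> homeomorphism U' V f g \<and>
    (\<forall>y\<in>V. (g has_derivative g' y) (at y)) \<and> (\<forall>y\<in>V. g' y = inv (blinfun_apply (f' (g y))))"
  proof (rule inverse_function_theorem[OF W(1) f_der f'_cont W(2) f'a_inv], goal_cases)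
    case (2 U' V g g')
    show ?case
      by (rule exI[of _ U'], rule exI[of _ V], rule exI[of _ g], rule exI[of _ g'], intro conjI ballI 2)
  qed assumption
  then obtain U' V g g' where g: "open U'" "U' \<subseteq> W" "a \<in> U'" "open V" "f a \<in> V" "homeomorphism U' V f g"
    "\<And>y. y \<in> V \<Longrightarrow> (g has_derivative g' y) (at y)"
    "\<And>y. y \<in> V \<Longrightarrow> g' y = inv (blinfun_apply (f' (g y)))"
    by (elim exE conjE) (simp add: Ball_def)
  have g0: "g 0 = a" using g(3,6) fa by (metis homeomorphism_apply1)
  have V0: "0 \<in> V" using g(5) fa by simp
  have "g' 0 = (\<lambda>x. x)"
  proof -
    have "blinfun_apply (f' (g 0)) = id" using f'a g0 by (simp add: id_def fun_eq_iff)
    then show ?thesis using g(8)[OF V0] by (simp add: inv_id id_def)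
  qed
  then have g_der: "(g has_derivative (\<lambda>x. x)) (at 0)" using g(7)[OF V0] by simp
  have gV: "g ` V = U'" using g(6) by (simp add: homeomorphism_def)
  show ?thesis
  proof
    show "open (g ` T)" if T: "T \<subseteq> V" "open T" for T
    proof -
      have "openin (top_of_set V) T" using T by (simp add: openin_open_eq[OF g(4)])
      then have "openin (top_of_set U') (g ` T)"
        using homeomorphism_imp_open_map[OF homeomorphism_symD[OF g(6)]] by blast
      then show ?thesis using openin_open_trans g(1) by blast
    qed
    show "continuous_on V g" using g(6) by (simp add: homeomorphism_def)
    show "g ` V \<subseteq> W" using gV g(2) by simp
    show "\<rho> j (g y) = frechet_derivative (\<rho> j) (at a) y" if j: "j < k" and y: "y \<in> V" for j y
    proof -
      \<comment> \<open>The form \<open>D j a\<close>, applied to \<open>y = f (g y)\<close>, sees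
        only the \<open>j\<close>-th term of the sum by duality; there the linear parts cancel and
        the value of the defining function remains.\<close>
      have "y = f (g y)" using g(6) y by (simp add: homeomorphism_apply2)
      then have "D j a y = D j a (f (g y))" by simp
      also have "\<dots> = D j a (g y - a) + (\<Sum>i<k. (\<rho> i (g y) - D i a (g y - a)) * D j a (u i))"
        unfolding f_def using lin[OF j W(2)] by (simp add: linear_add linear_sum linear_cmul)
      also have "(\<Sum>i<k. (\<rho> i (g y) - D i a (g y - a)) * D j a (u i))
          = (\<Sum>i<k. if i = j then \<rho> j (g y) - D j a (g y - a) else 0)"
        by (rule sum.cong) (use dual[OF j] in \<open>auto simp: D_def\<close>)
      finally show ?thesis using j by (simp add: D_def)
    qed
  qed (fact g(4) V0 g0 g_der)+
qed

text \<open>The curve is the image of the line \<open>t *\<^sub>R v\<close> under the straightening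
  map: the linear forms vanish along it, and the derivative of the map at 0 is the identity.\<close>

lemma tangent_curve:
  fixes \<rho> :: "nat \<Rightarrow> 'a::euclidean_space \<Rightarrow> real"
  assumes W: "open W" "a \<in> W" and C1: "\<And>j. j < k \<Longrightarrow> Ck_on (Suc 0) W (\<rho> j)"
    and \<rho>0: "\<And>j. j < k \<Longrightarrow> \<rho> j a = 0"
    and dual: "\<And>i j. i < k \<Longrightarrow> j < k \<Longrightarrow> frechet_derivative (\<rho> i) (at a) (u j) = (if i = j then 1 else 0)"
    and v: "\<And>j. j < k \<Longrightarrow> frechet_derivative (\<rho> j) (at a) v = 0"
  obtains \<gamma> \<delta> where "\<gamma> 0 = a" "(\<gamma> has_vector_derivative v) (at 0)" "\<delta> > (0::real)"
    "\<And>t. \<bar>t\<bar> < \<delta> \<Longrightarrow> \<gamma> t \<in> W" "\<And>t j. \<bar>t\<bar> < \<delta> \<Longrightarrow> j < k \<Longrightarrow> \<rho> j (\<gamma> t) = 0"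
proof -
  obtain V \<Psi> where V: "open V" "0 \<in> V" and \<Psi>: "\<Psi> 0 = a" "(\<Psi> has_derivative (\<lambda>x. x)) (at 0)"
    "\<Psi> ` V \<subseteq> W" "\<And>j y. j < k \<Longrightarrow> y \<in> V \<Longrightarrow> \<rho> j (\<Psi> y) = frechet_derivative (\<rho> j) (at a) y"
    using straighten_defining_functions[of W a k \<rho> u, OF W C1 \<rho>0 dual] by metis
  have "open ((\<lambda>t. t *\<^sub>R v) -` V)" by (rule open_vimage[OF V(1)]) (auto intro!: continuous_intros)
  then obtain \<delta> where \<delta>: "\<delta> > 0" "ball 0 \<delta> \<subseteq> (\<lambda>t. t *\<^sub>R v) -` V"
    using V(2) open_contains_ball[of "(\<lambda>t. t *\<^sub>R v) -` V"] by (metis scaleR_zero_left vimageI)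
  have tV: "t *\<^sub>R v \<in> V" if "\<bar>t\<bar> < \<delta>" for t
    using that \<delta>(2) by (auto simp: subset_iff)
  show ?thesis
  proof
    show "\<Psi> (0 *\<^sub>R v) = a" using \<Psi>(1) by simp
    have "((\<lambda>t. t *\<^sub>R v) has_derivative (\<lambda>t. t *\<^sub>R v)) (at 0)" by (auto intro!: derivative_eq_intros)
    from diff_chain_at[OF this, of \<Psi>] \<Psi>(2)
    show "((\<lambda>t. \<Psi> (t *\<^sub>R v)) has_vector_derivative v) (at 0)"
      by (simp add: has_vector_derivative_def o_def)
    show "\<delta> > 0" by (fact \<delta>(1))
    show "\<Psi> (t *\<^sub>R v) \<in> W" if "\<bar>t\<bar> < \<delta>" for t using tV[OF that] \<Psi>(3) by blast
    show "\<rho> j (\<Psi> (t *\<^sub>R v)) = 0" if "\<bar>t\<bar> < \<delta>" "j < k" for t j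
    proof -
      have "linear (frechet_derivative (\<rho> j) (at a))"
        using C1[OF that(2)] W(2) by (simp add: linear_frechet_derivative)
      then show ?thesis using \<Psi>(4)[OF that(2) tV[OF that(1)]] v[OF that(2)] by (simp add: linear_cmul)
    qed
  qed
qed

text \<open>In straightened coordinates the zero set is a ball intersected with a linear subspace,
  which is convex.\<close>

lemma connected_neighbourhood_in_zero_set:
  fixes \<rho> :: "nat \<Rightarrow> 'a::euclidean_space \<Rightarrow> real"
  assumes W: "open W" "a \<in> W" and C1: "\<And>j. j < k \<Longrightarrow> Ck_on (Suc 0) W (\<rho> j)"
    and \<rho>0: "\<And>j. j < k \<Longrightarrow> \<rho> j a = 0"
    and dual: "\<And>i j. i < k \<Longrightarrow> j < k \<Longrightarrow> frechet_derivative (\<rho> i) (at a) (u j) = (if i = j then 1 else 0)"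
  obtains N where "open N" "a \<in> N" "N \<subseteq> W" "connected {z \<in> N. \<forall>j<k. \<rho> j z = 0}"
proof -
  obtain V \<Psi> where V: "open V" "0 \<in> V" and \<Psi>: "\<Psi> 0 = a"
    "\<And>T. T \<subseteq> V \<Longrightarrow> open T \<Longrightarrow> open (\<Psi> ` T)" "continuous_on V \<Psi>" "\<Psi> ` V \<subseteq> W"
    "\<And>j y. j < k \<Longrightarrow> y \<in> V \<Longrightarrow> \<rho> j (\<Psi> y) = frechet_derivative (\<rho> j) (at a) y"
    using straighten_defining_functions[of W a k \<rho> u, OF W C1 \<rho>0 dual] by metis
  obtain e where e: "e > 0" "ball 0 e \<subseteq> V" using V open_contains_ball by blast
  let ?T = "ball 0 e \<inter> {y. \<forall>j<k. frechet_derivative (\<rho> j) (at a) y = 0}"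
  have lin: "linear (frechet_derivative (\<rho> j) (at a))" if "j < k" for j
    using C1[OF that] W(2) by (simp add: linear_frechet_derivative)
  have "convex {y. \<forall>j<k. frechet_derivative (\<rho> j) (at a) y = 0}"
    using lin by (auto simp: convex_def linear_add linear_cmul)
  then have "convex ?T" by (intro convex_Int convex_ball)
  then have "connected (\<Psi> ` ?T)"
    using \<Psi>(3) e(2) by (meson connected_continuous_image continuous_on_subset convex_connected inf.coboundedI1)
  moreover have "\<Psi> ` ?T = {z \<in> \<Psi> ` ball 0 e. \<forall>j<k. \<rho> j z = 0}"
    using \<Psi>(5) e(2) by (auto simp: image_iff subset_iff)
  ultimately have "connected {z \<in> \<Psi> ` ball 0 e. \<forall>j<k. \<rho> j z = 0}" by simp
  moreover have "open (\<Psi> ` ball 0 e)" by (rule \<Psi>(2)[OF e(2) open_ball])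
  moreover have "a \<in> \<Psi> ` ball 0 e" using \<Psi>(1) e(1) by force
  moreover have "\<Psi> ` ball 0 e \<subseteq> W" using \<Psi>(4) e(2) by blast
  ultimately show ?thesis by (intro that[of "\<Psi> ` ball 0 e"])
qed

section \<open>Second order behaviour along a curve\<close>

lemma vector_derivative_quotient_tendsto:
  fixes \<gamma> :: "real \<Rightarrow> 'a::real_normed_vector"
  assumes "(\<gamma> has_vector_derivative v) (at 0)"
  shows "((\<lambda>t. (\<gamma> t - \<gamma> 0) /\<^sub>R t) \<longlongrightarrow> v) (at 0)"
proof -
  let ?\<xi> = "\<lambda>t. (\<gamma> t - \<gamma> 0) /\<^sub>R t"
  have lim: "(\<lambda>h. norm (\<gamma> (0 + h) - \<gamma> 0 - h *\<^sub>R v) / norm h) \<midarrow>0\<rightarrow> 0"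
    using assms unfolding has_vector_derivative_def has_derivative_at by blast
  have eq: "norm (\<gamma> (0 + h) - \<gamma> 0 - h *\<^sub>R v) / norm h = norm (?\<xi> h - v)" if "h \<noteq> 0" for h
  proof -
    have "?\<xi> h - v = (\<gamma> (0 + h) - \<gamma> 0 - h *\<^sub>R v) /\<^sub>R h"
      using that by (simp add: scaleR_diff_right)
    then show ?thesis by (simp add: divide_inverse mult.commute)
  qed
  have "(\<lambda>h. norm (?\<xi> h - v)) \<midarrow>0\<rightarrow> 0"
    by (rule Lim_transform_eventually[OF lim]) (simp add: eventually_at_filter eq[simplified])
  then show ?thesis using tendsto_norm_zero_iff LIM_zero_iff by blast
qed

text \<open>Since the gradient vanishes at \<open>a\<close>, the bending of the curve enters only at
  order \<open>o(t^2)\<close>, and the tangent \<open>v\<close> alone decides the quadratic term.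
  Second derivatives are available at \<open>a\<close> only, so the mean value theorem is combined
  with the first order expansion of the gradient at \<open>a\<close>.\<close>

lemma second_order_lower_bound:
  fixes \<phi> :: "'a::euclidean_space \<Rightarrow> real"
  assumes W: "open W" "a \<in> W" and der: "\<And>z. z \<in> W \<Longrightarrow> (\<phi> has_derivative D z) (at z)"
    and der2: "\<And>y. ((\<lambda>z. D z y) has_derivative (\<lambda>x. Q x y)) (at a)"
    and D0: "\<And>y. D a y = 0" and Q: "Q v v \<ge> 0"
    and \<gamma>: "\<gamma> 0 = a" "(\<gamma> has_vector_derivative v) (at (0::real))" and e: "e > 0"
  shows "\<forall>\<^sub>F t in at 0. \<phi> (\<gamma> t) - \<phi> a \<ge> - e * t\<^sup>2"
proof -
  \<comment> \<open>The gradient of \<open>\<phi>\<close>; \<open>L\<close> is its derivative at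
    \<open>a\<close>, that is, the Hessian written as an endomorphism.\<close>
  define g where "g z = (\<Sum>b\<in>Basis. D z b *\<^sub>R b)" for z
  define L where "L x = (\<Sum>b\<in>Basis. Q x b *\<^sub>R b)" for x
  have lin: "linear (D z)" if "z \<in> W" for z
    using der[OF that] has_derivative_linear by blast
  have gD: "D z x = g z \<bullet> x" if "z \<in> W" for z x
  proof -
    have "D z x = D z (\<Sum>b\<in>Basis. (x \<bullet> b) *\<^sub>R b)" by (simp add: euclidean_representation)
    also have "\<dots> = (\<Sum>b\<in>Basis. (x \<bullet> b) * D z b)" using lin[OF that] by (simp add: linear_sum linear_cmul)
    also have "\<dots> = g z \<bullet> x" by (simp add: g_def inner_sum_left inner_commute[of x] mult.commute)
    finally show ?thesis .
  qed
  have gL: "(g has_derivative L) (at a)"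
    unfolding g_def L_def by (intro has_derivative_sum has_derivative_scaleR_left der2)
  have ga: "g a = 0" by (simp add: g_def D0)
  have blL: "bounded_linear L" using gL has_derivative_bounded_linear by blast
  have Lv: "L v \<bullet> v \<ge> 0"
  proof -
    obtain r where r: "r > 0" "ball a r \<subseteq> W" using W open_contains_ball by blast
    have "((\<lambda>z. g z \<bullet> v) has_derivative (\<lambda>x. L x \<bullet> v)) (at a)"
      by (rule has_derivative_inner_left[OF gL])
    then have "((\<lambda>z. D z v) has_derivative (\<lambda>x. L x \<bullet> v)) (at a)"
      by (rule has_derivative_transform_within_open[OF _ W]) (simp add: gD)
    then have "(\<lambda>x. L x \<bullet> v) = (\<lambda>x. Q x v)" using der2 has_derivative_unique by blast
    then show ?thesis using Q by metis
  qed
  define \<xi> where "\<xi> t = (\<gamma> t - a) /\<^sub>R t" for t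
  have \<xi>: "(\<xi> \<longlongrightarrow> v) (at 0)"
    using vector_derivative_quotient_tendsto[OF \<gamma>(2)] by (simp add: \<xi>_def[abs_def] \<gamma>(1))
  define \<eta> where "\<eta> = e / (2 * ((norm v)\<^sup>2 + 1))"
  have v1: "(norm v)\<^sup>2 + 1 > 0" by (simp add: add_nonneg_pos)
  have \<eta>: "\<eta> > 0" "\<eta> * (norm v)\<^sup>2 < e"
  proof -
    show "\<eta> > 0" using e v1 by (simp add: \<eta>_def)
    have "\<eta> * (norm v)\<^sup>2 \<le> \<eta> * ((norm v)\<^sup>2 + 1)" using \<open>\<eta> > 0\<close> by simp
    also have "\<dots> = e / 2" using v1 unfolding \<eta>_def by (simp add: field_simps)
    finally show "\<eta> * (norm v)\<^sup>2 < e" using e by simp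
  qed
  obtain d where d: "d > 0" "\<And>y. norm (y - a) < d \<Longrightarrow> norm (g y - g a - L (y - a)) \<le> \<eta> * norm (y - a)"
    using gL \<eta>(1) unfolding has_derivative_at_alt by blast
  obtain r where r: "r > 0" "ball a r \<subseteq> W" using W open_contains_ball by blast
  \<comment> \<open>The mean value theorem yields the quadratic term times an unknown factor
    \<open>s\<close> between 0 and 1; the minimum with 0 is a bound whichever sign that term
    has.\<close>
  have key: "\<phi> (a + x) - \<phi> a \<ge> min 0 (L x \<bullet> x - \<eta> * (norm x)\<^sup>2)" if x: "norm x < min d r" for x
  proof -
    have seg: "a + s *\<^sub>R x \<in> W" if "0 \<le> s" "s \<le> 1" for s
    proof -
      have "s * norm x \<le> 1 * norm x" by (rule mult_right_mono) (use that in auto)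
      then show ?thesis using that x r(2) by (auto simp: subset_iff dist_norm)
    qed
    have "\<exists>s\<in>{0<..<1}. \<phi> (a + 1 *\<^sub>R x) - \<phi> (a + 0 *\<^sub>R x) = (\<lambda>h. D (a + s *\<^sub>R x) (h *\<^sub>R x)) (1 - 0)"
    proof (rule mvt_simple)
      fix s :: real assume s: "0 \<le> s" "s \<le> 1"
      have "((\<lambda>s. a + s *\<^sub>R x) has_derivative (\<lambda>h. h *\<^sub>R x)) (at s)" by (auto intro!: derivative_eq_intros)
      from diff_chain_at[OF this der[OF seg[OF s]]]
      show "((\<lambda>s. \<phi> (a + s *\<^sub>R x)) has_derivative (\<lambda>h. D (a + s *\<^sub>R x) (h *\<^sub>R x))) (at s within {0..1})"
        by (simp add: o_def has_derivative_at_withinI)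
    qed simp
    then obtain s where s: "0 < s" "s < 1" and eq: "\<phi> (a + x) - \<phi> a = g (a + s *\<^sub>R x) \<bullet> x"
      using seg gD by auto
    have "s * norm x \<le> 1 * norm x" by (rule mult_right_mono) (use s in auto)
    then have "norm (g (a + s *\<^sub>R x) - s *\<^sub>R L x) \<le> \<eta> * (s * norm x)"
      using d(2)[of "a + s *\<^sub>R x"] x s ga blL by (simp add: linear_cmul bounded_linear.linear)
    then have "norm (g (a + s *\<^sub>R x) - s *\<^sub>R L x) * norm x \<le> \<eta> * (s * norm x) * norm x"
      by (rule mult_right_mono) simp
    moreover have "\<bar>(g (a + s *\<^sub>R x) - s *\<^sub>R L x) \<bullet> x\<bar> \<le> norm (g (a + s *\<^sub>R x) - s *\<^sub>R L x) * norm x"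
      by (rule Cauchy_Schwarz_ineq2)
    ultimately have "g (a + s *\<^sub>R x) \<bullet> x - s * (L x \<bullet> x) \<ge> - (\<eta> * (s * norm x) * norm x)"
      by (simp add: inner_diff_left)
    then have "\<phi> (a + x) - \<phi> a \<ge> s * (L x \<bullet> x - \<eta> * (norm x)\<^sup>2)"
      unfolding eq by (simp add: algebra_simps power2_eq_square)
    moreover have "s * c \<ge> min 0 c" for c :: real
      using s by (cases "c \<ge> 0") (auto simp: min_def mult_le_cancel_right2)
    ultimately show ?thesis by (meson order_trans)
  qed
  have "((\<lambda>t. L (\<xi> t) \<bullet> \<xi> t - \<eta> * (norm (\<xi> t))\<^sup>2) \<longlongrightarrow> L v \<bullet> v - \<eta> * (norm v)\<^sup>2) (at 0)"
    by (intro tendsto_intros \<xi> bounded_linear.tendsto[OF blL])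
  moreover have "L v \<bullet> v - \<eta> * (norm v)\<^sup>2 > - e" using Lv \<eta>(2) by linarith
  ultimately have ev1: "\<forall>\<^sub>F t in at 0. L (\<xi> t) \<bullet> \<xi> t - \<eta> * (norm (\<xi> t))\<^sup>2 > - e"
    by (rule order_tendstoD)
  have "continuous (at 0) \<gamma>" using \<gamma>(2) has_vector_derivative_continuous by blast
  then have "(\<gamma> \<longlongrightarrow> a) (at 0)" using \<gamma>(1) by (simp add: continuous_at)
  moreover have "min d r > 0" using d r by simp
  ultimately have ev2: "\<forall>\<^sub>F t in at 0. dist (\<gamma> t) a < min d r" by (rule tendstoD)
  have ev3: "\<forall>\<^sub>F t in at (0::real). t \<noteq> 0" by (simp add: eventually_at_filter)
  from ev1 ev2 ev3 show ?thesis
  proof eventually_elim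
    case (elim t)
    have x: "\<gamma> t - a = t *\<^sub>R \<xi> t" using elim(3) by (simp add: \<xi>_def)
    have "L (\<gamma> t - a) \<bullet> (\<gamma> t - a) - \<eta> * (norm (\<gamma> t - a))\<^sup>2
        = t\<^sup>2 * (L (\<xi> t) \<bullet> \<xi> t - \<eta> * (norm (\<xi> t))\<^sup>2)"
      unfolding x using blL
      by (simp add: linear_cmul bounded_linear.linear power_mult_distrib power2_eq_square algebra_simps)
    also have "\<dots> \<ge> t\<^sup>2 * (- e)" using elim(1) by (intro mult_left_mono) auto
    finally have "L (\<gamma> t - a) \<bullet> (\<gamma> t - a) - \<eta> * (norm (\<gamma> t - a))\<^sup>2 \<ge> - e * t\<^sup>2" by (simp add: mult.commute)
    moreover have "- e * t\<^sup>2 \<le> 0" using e by simp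
    moreover have "\<phi> (a + (\<gamma> t - a)) - \<phi> a
        \<ge> min 0 (L (\<gamma> t - a) \<bullet> (\<gamma> t - a) - \<eta> * (norm (\<gamma> t - a))\<^sup>2)"
      by (rule key) (use elim(2) in \<open>simp add: dist_norm\<close>)
    ultimately show ?case by simp
  qed
qed

section \<open>Levi forms and local maxima\<close>

lemma axis_Re_Im: "axis i z = Re z *\<^sub>R axis i 1 + Im z *\<^sub>R (axis i \<i> :: complex^'n)"
  by (auto simp: vec_eq_iff axis_def complex_eq_iff)

lemma real_linear_expansion:
  fixes l :: "complex^'n \<Rightarrow> complex"
  assumes "linear l"
  shows "l w = (\<Sum>i\<in>UNIV. complex_of_real (Re (w $ i)) * l (axis i 1) + complex_of_real (Im (w $ i)) * l (axis i \<i>))"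
proof -
  have "w = (\<Sum>i\<in>UNIV. axis i (w $ i))"
    by (simp add: vec_eq_iff axis_def sum.delta)
  then have lw: "l w = (\<Sum>i\<in>UNIV. l (axis i (w $ i)))"
    using linear_sum[OF assms, of "\<lambda>i. axis i (w $ i)" UNIV] by simp
  have "l (axis i z) = complex_of_real (Re z) * l (axis i 1) + complex_of_real (Im z) * l (axis i \<i>)" for i z
    by (subst axis_Re_Im) (simp only: linear_add[OF assms] linear_cmul[OF assms], simp only: scaleR_conv_of_real)
  then show ?thesis by (subst lw) (rule sum.cong[OF refl])
qed

text \<open>Both sides are twice the complex linear part of \<open>l\<close> at \<open>w\<close>;
  the next lemma treats the conjugate linear part. Together they free \<open>dz\<close> and
  \<open>dzbar\<close> from coordinates.\<close>

lemma wirtinger_sum: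
  fixes l :: "complex^'n \<Rightarrow> complex"
  assumes "linear l"
  shows "(\<Sum>i\<in>UNIV. w $ i * (l (axis i 1) - \<i> * l (axis i \<i>))) = l w - \<i> * l (\<i> *s w)"
  unfolding real_linear_expansion[OF assms, of w] real_linear_expansion[OF assms, of "\<i> *s w"]
    sum_distrib_left sum_subtractf[symmetric]
proof (rule sum.cong[OF refl])
  fix i
  have w: "w $ i = complex_of_real (Re (w $ i)) + \<i> * complex_of_real (Im (w $ i))"
    by (rule complex_eq)
  show "w $ i * (l (axis i 1) - \<i> * l (axis i \<i>)) =
      complex_of_real (Re (w $ i)) * l (axis i 1) + complex_of_real (Im (w $ i)) * l (axis i \<i>) -
      \<i> * (complex_of_real (Re ((\<i> *s w) $ i)) * l (axis i 1) + complex_of_real (Im ((\<i> *s w) $ i)) * l (axis i \<i>))"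
    by (subst w) (simp add: algebra_simps)
qed

lemma wirtinger_bar_sum:
  fixes l :: "complex^'n \<Rightarrow> complex"
  assumes "linear l"
  shows "(\<Sum>i\<in>UNIV. cnj (w $ i) * (l (axis i 1) + \<i> * l (axis i \<i>))) = l w + \<i> * l (\<i> *s w)"
  unfolding real_linear_expansion[OF assms, of w] real_linear_expansion[OF assms, of "\<i> *s w"]
    sum_distrib_left sum.distrib[symmetric]
proof (rule sum.cong[OF refl])
  fix i
  have w: "cnj (w $ i) = complex_of_real (Re (w $ i)) - \<i> * complex_of_real (Im (w $ i))"
    by (simp add: complex_eq_iff)
  show "cnj (w $ i) * (l (axis i 1) + \<i> * l (axis i \<i>)) =
      complex_of_real (Re (w $ i)) * l (axis i 1) + complex_of_real (Im (w $ i)) * l (axis i \<i>) +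
      \<i> * (complex_of_real (Re ((\<i> *s w) $ i)) * l (axis i 1) + complex_of_real (Im ((\<i> *s w) $ i)) * l (axis i \<i>))"
    by (subst w) (simp add: algebra_simps)
qed

text \<open>Up to the factor 2, the Levi form is the mean of the real Hessian over the directions
  \<open>w\<close> and \<open>\<i> *s w\<close>. The mixed terms carry the factor
  \<open>\<i>\<close> and drop out of the real part.\<close>

lemma Re_herm_form_complex_hessian:
  fixes h :: "complex^'n \<Rightarrow> real"
  assumes W: "open W" "a \<in> W" and der: "\<And>z. z \<in> W \<Longrightarrow> (h has_derivative D z) (at z)"
    and der2: "\<And>y. ((\<lambda>z. D z y) has_derivative (\<lambda>x. Q x y)) (at a)"
  shows "Re (herm_form (complex_hessian (\<lambda>z. complex_of_real (h z)) a) w w)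
    = (Q w w + Q (\<i> *s w) (\<i> *s w)) / 4"
proof -
  let ?f = "\<lambda>z. complex_of_real (h z)"
  define A where "A j x = (complex_of_real (Q x (axis j 1)) + \<i> * complex_of_real (Q x (axis j \<i>))) / 2" for j x
  have D1: "frechet_derivative ?f (at z) = (\<lambda>y. complex_of_real (D z y))" if "z \<in> W" for z
    by (rule frechet_derivative_at[symmetric])
       (use bounded_linear.has_derivative[OF bounded_linear_of_real der[OF that]] in simp)
  have derA: "((\<lambda>z. dzbar ?f z j) has_derivative A j) (at a)" for j
  proof -
    have "((\<lambda>z. (complex_of_real (D z (axis j 1)) + \<i> * complex_of_real (D z (axis j \<i>))) / 2) has_derivative A j) (at a)"
      unfolding A_def
      by (intro bounded_linear.has_derivative[OF bounded_linear_divide] has_derivative_add has_derivative_mult_right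
          bounded_linear.has_derivative[OF bounded_linear_of_real] der2)
    then show ?thesis
      by (rule has_derivative_transform_within_open[OF _ W]) (simp add: dzbar_def D1)
  qed
  have linA: "linear (A j)" for j using derA has_derivative_linear by blast
  \<comment> \<open>Linearity in the second argument is inherited from \<open>D z\<close>, by
    uniqueness of the derivative of \<open>z \<mapsto> D z y\<close> at \<open>a\<close>.\<close>
  have linQ: "linear (Q x)" for x
  proof (rule linearI)
    have linD: "linear (D z)" if "z \<in> W" for z using der[OF that] has_derivative_linear by blast
    fix y y' and r :: real
    have "((\<lambda>z. D z y + D z y') has_derivative (\<lambda>x. Q x y + Q x y')) (at a)"
      by (intro has_derivative_add der2)
    then have "((\<lambda>z. D z (y + y')) has_derivative (\<lambda>x. Q x y + Q x y')) (at a)"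
      by (rule has_derivative_transform_within_open[OF _ W]) (simp add: linD linear_add)
    from has_derivative_unique[OF this der2[of "y + y'"]] show "Q x (y + y') = Q x y + Q x y'" by metis
    have "((\<lambda>z. r *\<^sub>R D z y) has_derivative (\<lambda>x. r *\<^sub>R Q x y)) (at a)"
      by (intro has_derivative_scaleR_right der2)
    then have "((\<lambda>z. D z (r *\<^sub>R y)) has_derivative (\<lambda>x. r *\<^sub>R Q x y)) (at a)"
      by (rule has_derivative_transform_within_open[OF _ W]) (simp add: linD linear_cmul)
    from has_derivative_unique[OF this der2[of "r *\<^sub>R y"]] show "Q x (r *\<^sub>R y) = r *\<^sub>R Q x y" by metis
  qed
  have linQc: "linear (\<lambda>y. complex_of_real (Q x y))" for x
    using linear_compose[OF linQ bounded_linear.linear[OF bounded_linear_of_real]] by (simp add: o_def)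
  have H: "complex_hessian ?f a $ i $ j = (A j (axis i 1) - \<i> * A j (axis i \<i>)) / 2" for i j
    using frechet_derivative_at[OF derA[of j]] by (simp add: complex_hessian_def dz_def)
  have "herm_form (complex_hessian ?f a) w w
      = (\<Sum>j\<in>UNIV. \<Sum>i\<in>UNIV. complex_hessian ?f a $ i $ j * w $ i * cnj (w $ j))"
    unfolding herm_form_def by (rule sum.swap)
  also have "\<dots> = (\<Sum>j\<in>UNIV. cnj (w $ j) / 2 * (\<Sum>i\<in>UNIV. w $ i * (A j (axis i 1) - \<i> * A j (axis i \<i>))))"
    unfolding sum_distrib_left H by (intro sum.cong refl) (simp add: field_simps)
  also have "\<dots> = (\<Sum>j\<in>UNIV. cnj (w $ j) / 2 * (A j w - \<i> * A j (\<i> *s w)))"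
    unfolding wirtinger_sum[OF linA] ..
  also have "\<dots> = (1/4) * (\<Sum>j\<in>UNIV. cnj (w $ j) * (complex_of_real (Q w (axis j 1)) + \<i> * complex_of_real (Q w (axis j \<i>))))
      - (\<i>/4) * (\<Sum>j\<in>UNIV. cnj (w $ j) * (complex_of_real (Q (\<i> *s w) (axis j 1)) + \<i> * complex_of_real (Q (\<i> *s w) (axis j \<i>))))"
    unfolding sum_distrib_left sum_subtractf[symmetric] A_def
    by (intro sum.cong refl) (simp add: field_simps)
  also have "\<dots> = (1/4) * (complex_of_real (Q w w) + \<i> * complex_of_real (Q w (\<i> *s w)))
      - (\<i>/4) * (complex_of_real (Q (\<i> *s w) w) + \<i> * complex_of_real (Q (\<i> *s w) (\<i> *s w)))"
    unfolding wirtinger_bar_sum[OF linQc] ..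
  finally have "herm_form (complex_hessian ?f a) w w = \<dots>" .
  then show ?thesis by simp
qed

section \<open>Maxima of sums of squares on a real submanifold\<close>

lemma holo_on_curve_derivative:
  assumes "holo_on W f" "\<gamma> 0 \<in> W" "(\<gamma> has_vector_derivative v) (at (0::real))"
  shows "((\<lambda>t. f (\<gamma> t)) has_vector_derivative ddir v f (\<gamma> 0)) (at 0)"
proof -
  have "((\<lambda>t. f (\<gamma> t)) has_derivative (\<lambda>t. ddir (t *\<^sub>R v) f (\<gamma> 0))) (at 0)"
    using diff_chain_at[of \<gamma> "\<lambda>t. t *\<^sub>R v" 0 f, OF _ holo_on_has_derivative[OF assms(1,2)]] assms(3)
    by (simp add: has_vector_derivative_def o_def)
  then show ?thesis
    unfolding has_vector_derivative_def by (simp add: linear_cmul[OF holo_on_linear[OF assms(1,2)]])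
qed

lemma norm_square_derivative_0:
  fixes f :: "real \<Rightarrow> 'a::real_inner"
  assumes "(f has_vector_derivative d) (at 0)" "f 0 = 0"
  shows "((\<lambda>t. (norm (f t))\<^sup>2) has_real_derivative 0) (at 0)"
proof -
  have "((\<lambda>t. f t \<bullet> f t) has_derivative (\<lambda>h. f 0 \<bullet> (h *\<^sub>R d) + (h *\<^sub>R d) \<bullet> f 0)) (at 0)"
    using assms(1) unfolding has_vector_derivative_def by (intro has_derivative_inner) auto
  moreover have "(\<lambda>h. 0) = (*) (0::real)" by auto
  ultimately show ?thesis using assms(2) by (simp add: has_field_derivative_def power2_norm_eq_inner)
qed

text \<open>With \<open>b\<^sub>i = g\<^sub>i(a)\<close> and \<open>G = 2 \<Sum>\<^sub>i cnj(b\<^sub>i) g\<^sub>i\<close> one has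
  \<open>\<Sum>\<^sub>i |g\<^sub>i|\<^sup>2 = Re G - \<Sum>\<^sub>i |b\<^sub>i|\<^sup>2 + \<Sum>\<^sub>i |g\<^sub>i - b\<^sub>i|\<^sup>2\<close>: only the pluriharmonic term \<open>Re G\<close>
  contributes to the first derivative at \<open>a\<close>, and the last term is bounded below quadratically.
  Lagrange multipliers \<open>c\<close> make \<open>Re G - \<Sum>\<^sub>j c\<^sub>j \<rho>\<^sub>j\<close> critical at \<open>a\<close>.\<close>

lemma no_local_maximum:
  fixes \<rho> :: "nat \<Rightarrow> complex^'n \<Rightarrow> real" and g :: "'i \<Rightarrow> complex^'n \<Rightarrow> complex"
  assumes W: "open W" "a \<in> W" and smooth: "\<And>j. j < k \<Longrightarrow> Cinf_on W (\<rho> j)"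
    and \<rho>0: "\<And>j. j < k \<Longrightarrow> \<rho> j a = 0"
    and dual: "\<And>i j. i < k \<Longrightarrow> j < k \<Longrightarrow> frechet_derivative (\<rho> i) (at a) (u j) = (if i = j then 1 else 0)"
    and I: "finite I" and g: "\<And>i. i \<in> I \<Longrightarrow> holo_on W (g i)"
    and inj: "\<And>w. (\<And>i. i \<in> I \<Longrightarrow> ddir w (g i) a = 0) \<Longrightarrow> w = 0"
    and max: "\<And>z. z \<in> W \<Longrightarrow> (\<And>j. j < k \<Longrightarrow> \<rho> j z = 0) \<Longrightarrow>
        (\<Sum>i\<in>I. (cmod (g i z))\<^sup>2) \<le> (\<Sum>i\<in>I. (cmod (g i a))\<^sup>2)"
    and concave: "\<And>c. \<exists>w. w \<noteq> 0 \<and>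
        (\<forall>j<k. frechet_derivative (\<rho> j) (at a) w = 0 \<and> frechet_derivative (\<rho> j) (at a) (\<i> *s w) = 0) \<and>
        Re (herm_form (complex_hessian (\<lambda>z. complex_of_real (\<Sum>j<k. c j * \<rho> j z)) a) w w) \<le> 0"
  shows False
proof -
  have C1: "Ck_on (Suc 0) W (\<rho> j)" if "j < k" for j using smooth[OF that] unfolding Cinf_on_def by blast
  have C2: "Ck_on (Suc (Suc 0)) W (\<rho> j)" if "j < k" for j using smooth[OF that] unfolding Cinf_on_def by blast
  define Dr where "Dr j z = frechet_derivative (\<rho> j) (at z)" for j z
  define Qr where "Qr j x y = frechet_derivative (\<lambda>z. Dr j z y) (at a) x" for j x y
  have Dr: "(\<rho> j has_derivative Dr j z) (at z)" if "j < k" "z \<in> W" for j z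
    using C2[OF that(1)] that(2) by (simp add: Dr_def frechet_derivative_works)
  have Qr: "((\<lambda>z. Dr j z y) has_derivative (\<lambda>x. Qr j x y)) (at a)" if "j < k" for j y
    using C2[OF that] W(2) by (simp add: Dr_def Qr_def frechet_derivative_works)
  have linDr: "linear (Dr j a)" if "j < k" for j using Dr[OF that W(2)] has_derivative_linear by blast
  define G where "G z = (\<Sum>i\<in>I. (2 * cnj (g i a)) * g i z)" for z
  have G: "holo_on W G" unfolding G_def by (intro holo_on_sum holo_on_cmult g)
  define R where "R z = (\<Sum>i\<in>I. (cmod (g i z - g i a))\<^sup>2)" for z
  have split: "(\<Sum>i\<in>I. (cmod (g i z))\<^sup>2) = Re (G z) + R z - (\<Sum>i\<in>I. (cmod (g i a))\<^sup>2)" for z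
  proof -
    have eq: "(cmod x)\<^sup>2 = Re (2 * cnj b * x) + (cmod (x - b))\<^sup>2 - (cmod b)\<^sup>2" for x b
      unfolding cmod_power2 by (simp add: power2_eq_square algebra_simps)
    show ?thesis
      unfolding G_def R_def Re_sum sum.distrib[symmetric] sum_subtractf[symmetric]
      by (rule sum.cong[OF refl]) (rule eq)
  qed
  have Ra: "R a = 0" by (simp add: R_def)
  have max': "Re (G z) + R z \<le> Re (G a)" if "z \<in> W" "\<And>j. j < k \<Longrightarrow> \<rho> j z = 0" for z
    using max[OF that] split[of z] split[of a] Ra by linarith
  \<comment> \<open>Along a curve in the zero set the sum of squares \<open>R\<close> vanishes to
    second order at \<open>a\<close>, so maximality makes the derivative of \<open>Re G\<close>
    vanish in every tangent direction.\<close>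
  have crit: "Re (ddir v G a) = 0" if v: "\<And>j. j < k \<Longrightarrow> Dr j a v = 0" for v
  proof -
    obtain \<gamma> \<delta> where \<gamma>: "\<gamma> 0 = a" "(\<gamma> has_vector_derivative v) (at 0)" "\<delta> > (0::real)"
      "\<And>t. \<bar>t\<bar> < \<delta> \<Longrightarrow> \<gamma> t \<in> W" "\<And>t j. \<bar>t\<bar> < \<delta> \<Longrightarrow> j < k \<Longrightarrow> \<rho> j (\<gamma> t) = 0"
      using tangent_curve[of W a k \<rho> u v, OF W C1 \<rho>0 dual v[unfolded Dr_def]] by blast
    have "((\<lambda>t. R (\<gamma> t)) has_real_derivative (\<Sum>i\<in>I. 0)) (at 0)"
      unfolding R_def
    proof (rule DERIV_sum)
      fix i assume i: "i \<in> I"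
      have "((\<lambda>t. g i (\<gamma> t) - g i a) has_vector_derivative ddir v (g i) (\<gamma> 0) - 0) (at 0)"
        using holo_on_curve_derivative[OF g[OF i] _ \<gamma>(2)] \<gamma>(1) W(2) by (intro has_vector_derivative_diff) auto
      then show "((\<lambda>t. (cmod (g i (\<gamma> t) - g i a))\<^sup>2) has_real_derivative 0) (at 0)"
        by (rule norm_square_derivative_0) (simp add: \<gamma>(1))
    qed
    moreover have "((\<lambda>t. Re (G (\<gamma> t))) has_real_derivative Re (ddir v G a)) (at 0)"
      using has_vector_derivative_real_field
        bounded_linear.has_vector_derivative[OF bounded_linear_Re holo_on_curve_derivative[OF G _ \<gamma>(2)]] \<gamma>(1) W(2)
      by (simp add: has_real_derivative_iff_has_vector_derivative)
    ultimately have "((\<lambda>t. Re (G (\<gamma> t)) + R (\<gamma> t)) has_real_derivative Re (ddir v G a) + (\<Sum>i\<in>I. 0)) (at 0)"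
      by (intro DERIV_add)
    then have "Re (ddir v G a) + (\<Sum>i\<in>I. 0) = 0"
    proof (rule DERIV_local_max[OF _ \<gamma>(3)], intro allI impI)
      fix t assume "\<bar>0 - t\<bar> < \<delta>"
      then have "\<bar>t\<bar> < \<delta>" by simp
      from max'[OF \<gamma>(4)[OF this] \<gamma>(5)[OF this]]
      show "Re (G (\<gamma> t)) + R (\<gamma> t) \<le> Re (G (\<gamma> 0)) + R (\<gamma> 0)" by (simp add: \<gamma>(1) Ra)
    qed
    then show ?thesis by simp
  qed
  \<comment> \<open>The Lagrange multipliers are the derivatives of \<open>Re G\<close> along the
    dual vectors.\<close>
  define c where "c j = Re (ddir (u j) G a)" for j
  have linG: "linear (\<lambda>x. ddir x G a)" using holo_on_linear[OF G W(2)] .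
  have lagrange: "Re (ddir x G a) = (\<Sum>j<k. c j * Dr j a x)" for x
  proof -
    \<comment> \<open>Projection of \<open>x\<close> to the tangent space along the dual vectors;
      \<open>crit\<close> applies to it.\<close>
    define y where "y = x - (\<Sum>j<k. Dr j a x *\<^sub>R u j)"
    have "Dr i a y = 0" if "i < k" for i
    proof -
      have "Dr i a y = Dr i a x - (\<Sum>j<k. Dr j a x * Dr i a (u j))"
        unfolding y_def by (simp add: linear_diff[OF linDr[OF that]] linear_sum[OF linDr[OF that]] linear_cmul[OF linDr[OF that]])
      also have "(\<Sum>j<k. Dr j a x * Dr i a (u j)) = (\<Sum>j<k. if i = j then Dr i a x else 0)"
        by (rule sum.cong) (use dual[OF that] in \<open>auto simp: Dr_def\<close>)
      finally show ?thesis using that by simp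
    qed
    then have "Re (ddir y G a) = 0" by (rule crit)
    moreover have "ddir y G a = ddir x G a - (\<Sum>j<k. Dr j a x *\<^sub>R ddir (u j) G a)"
      unfolding y_def by (simp only: linear_diff[OF linG] linear_sum[OF linG] linear_cmul[OF linG])
    ultimately show ?thesis by (simp add: c_def mult.commute)
  qed
  obtain w where w: "w \<noteq> 0" "\<And>j. j < k \<Longrightarrow> Dr j a w = 0 \<and> Dr j a (\<i> *s w) = 0"
    and neg: "Re (herm_form (complex_hessian (\<lambda>z. complex_of_real (\<Sum>j<k. c j * \<rho> j z)) a) w w) \<le> 0"
    using concave[of c] unfolding Dr_def by blast
  define Qh where "Qh x y = (\<Sum>j<k. c j * Qr j x y)" for x y
  have der_h: "((\<lambda>z. \<Sum>j<k. c j * \<rho> j z) has_derivative (\<lambda>y. \<Sum>j<k. c j * Dr j z y)) (at z)" if "z \<in> W" for z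
    by (intro has_derivative_sum has_derivative_mult_right Dr that) simp
  have der2_h: "((\<lambda>z. \<Sum>j<k. c j * Dr j z y) has_derivative (\<lambda>x. Qh x y)) (at a)" for y
    unfolding Qh_def by (intro has_derivative_sum has_derivative_mult_right Qr) simp
  have Qh: "Qh w w + Qh (\<i> *s w) (\<i> *s w) \<le> 0"
  proof -
    have "Re (herm_form (complex_hessian (\<lambda>z. complex_of_real (\<Sum>j<k. c j * \<rho> j z)) a) w w)
        = (Qh w w + Qh (\<i> *s w) (\<i> *s w)) / 4"
      by (rule Re_herm_form_complex_hessian[OF W der_h der2_h])
    from ord_eq_le_trans[OF this[symmetric] neg]
    show ?thesis by simp
  qed
  define Q where "Q x y = Re (ddir x (ddir y G) a) - Qh x y" for x y
  \<comment> \<open>\<open>Re G\<close> is pluriharmonic, so its second derivatives along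
    \<open>w\<close> and \<open>\<i> *s w\<close> cancel. What remains is the nonpositive Levi form
    of the defining functions with reversed sign, whence one of the two directions has a nonnegative
    second derivative.\<close>
  have "(ddir (\<i> *s w) ^^ 2) G a = \<i> ^ 2 * (ddir w ^^ 2) G a" by (rule iter_ddir_smult[OF G W])
  then have "ddir (\<i> *s w) (ddir (\<i> *s w) G) a = - ddir w (ddir w G) a" by (simp add: numeral_2_eq_2)
  then have "Q w w + Q (\<i> *s w) (\<i> *s w) \<ge> 0" using Qh by (simp add: Q_def)
  then have "Q w w \<ge> 0 \<or> Q (\<i> *s w) (\<i> *s w) \<ge> 0" by linarith
  then obtain v where v: "v = w \<or> v = \<i> *s w" "Q v v \<ge> 0" by blast
  have v0: "v \<noteq> 0" using v(1) w(1) by (auto simp: vec_eq_iff)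
  have tan: "Dr j a v = 0" if "j < k" for j using v(1) w(2)[OF that] by auto
  obtain \<gamma> \<delta> where \<gamma>: "\<gamma> 0 = a" "(\<gamma> has_vector_derivative v) (at 0)" "\<delta> > (0::real)"
    "\<And>t. \<bar>t\<bar> < \<delta> \<Longrightarrow> \<gamma> t \<in> W" "\<And>t j. \<bar>t\<bar> < \<delta> \<Longrightarrow> j < k \<Longrightarrow> \<rho> j (\<gamma> t) = 0"
    using tangent_curve[of W a k \<rho> u v, OF W C1 \<rho>0 dual tan[unfolded Dr_def]] by blast
  obtain i where i: "i \<in> I" "ddir v (g i) a \<noteq> 0" using inj[of v] v0 by blast
  define d where "d = ddir v (g i) a"
  have d: "d \<noteq> 0" using i by (simp add: d_def)
  let ?\<phi> = "\<lambda>z. Re (G z) - (\<Sum>j<k. c j * \<rho> j z)"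
  \<comment> \<open>The critical function may decrease at most at the rate
    \<open>1/4 * (cmod d)^2\<close>, while \<open>R\<close> grows at least at the rate
    \<open>9/16 * (cmod d)^2\<close>, the square of the factor \<open>3/4\<close> below. On the zero
    set maximality forbids this, because \<open>?\<phi>\<close> and \<open>Re G\<close> have the
    same increments there.\<close>
  have ev1: "\<forall>\<^sub>F t in at 0. ?\<phi> (\<gamma> t) - ?\<phi> a \<ge> - ((cmod d)\<^sup>2 / 4) * t\<^sup>2"
  proof (rule second_order_lower_bound[where Q = Q and v = v, OF W _ _ _ v(2) \<gamma>(1,2)])
    show "(?\<phi> has_derivative (\<lambda>y. Re (ddir y G z) - (\<Sum>j<k. c j * Dr j z y))) (at z)" if "z \<in> W" for z
      by (intro has_derivative_diff der_h that bounded_linear.has_derivative[OF bounded_linear_Re]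
          holo_on_has_derivative[OF G])
    show "((\<lambda>z. Re (ddir y G z) - (\<Sum>j<k. c j * Dr j z y)) has_derivative (\<lambda>x. Q x y)) (at a)" for y
      unfolding Q_def
      by (intro has_derivative_diff der2_h bounded_linear.has_derivative[OF bounded_linear_Re]
          holo_on_has_derivative[OF holo_on_ddir[OF G W(1)] W(2)])
    show "Re (ddir y G a) - (\<Sum>j<k. c j * Dr j a y) = 0" for y by (simp add: lagrange)
    show "(cmod d)\<^sup>2 / 4 > 0" using d by simp
  qed
  have "((\<lambda>t. g i (\<gamma> t)) has_vector_derivative d) (at 0)"
    using holo_on_curve_derivative[OF g[OF i(1)] _ \<gamma>(2)] \<gamma>(1) W(2) by (simp add: d_def)
  from tendsto_norm[OF vector_derivative_quotient_tendsto[OF this]]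
  have "((\<lambda>t. cmod ((g i (\<gamma> t) - g i a) /\<^sub>R t)) \<longlongrightarrow> cmod d) (at 0)" by (simp add: \<gamma>(1))
  then have ev2: "\<forall>\<^sub>F t in at 0. cmod ((g i (\<gamma> t) - g i a) /\<^sub>R t) > 3/4 * cmod d"
    by (rule order_tendstoD) (use d in simp)
  have ev3: "\<forall>\<^sub>F t in at (0::real). dist t 0 < \<delta>"
    by (rule tendstoD[OF tendsto_ident_at \<gamma>(3)])
  have ev4: "\<forall>\<^sub>F t in at (0::real). t \<noteq> 0" by (simp add: eventually_at_filter)
  from ev1 ev2 ev3 ev4 have "\<forall>\<^sub>F t in at (0::real). False"
  proof eventually_elim
    case (elim t)
    have t: "\<bar>t\<bar> < \<delta>" "t \<noteq> 0" using elim by auto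
    have "Re (G (\<gamma> t)) + R (\<gamma> t) \<le> Re (G a)" by (rule max'[OF \<gamma>(4)[OF t(1)] \<gamma>(5)[OF t(1)]])
    moreover have "?\<phi> (\<gamma> t) - ?\<phi> a = Re (G (\<gamma> t)) - Re (G a)"
      using \<gamma>(5)[OF t(1)] \<rho>0 by simp
    ultimately have "R (\<gamma> t) \<le> (cmod d)\<^sup>2 / 4 * t\<^sup>2" using elim(1) by simp
    moreover have "(cmod (g i (\<gamma> t) - g i a))\<^sup>2 \<le> R (\<gamma> t)"
      unfolding R_def by (rule member_le_sum[OF i(1)]) (auto simp: I)
    moreover have "9/16 * ((cmod d)\<^sup>2 * t\<^sup>2) \<le> (cmod (g i (\<gamma> t) - g i a))\<^sup>2"
    proof -
      have "cmod ((g i (\<gamma> t) - g i a) /\<^sub>R t) = cmod (g i (\<gamma> t) - g i a) / \<bar>t\<bar>"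
        by (simp add: divide_inverse mult.commute)
      then have "3/4 * cmod d < cmod (g i (\<gamma> t) - g i a) / \<bar>t\<bar>" using elim(2) by argo
      then have "3/4 * cmod d * \<bar>t\<bar> < cmod (g i (\<gamma> t) - g i a)"
        using t(2) pos_less_divide_eq[of "\<bar>t\<bar>" "3/4 * cmod d" "cmod (g i (\<gamma> t) - g i a)"]
        unfolding zero_less_abs_iff by blast
      then have "3/4 * cmod d * \<bar>t\<bar> \<le> cmod (g i (\<gamma> t) - g i a)" by (rule less_imp_le)
      then have "(3/4 * cmod d * \<bar>t\<bar>)\<^sup>2 \<le> (cmod (g i (\<gamma> t) - g i a))\<^sup>2"
        by (rule power_mono) simp
      then show ?thesis by (simp only: power_mult_distrib power2_abs) (simp add: power2_eq_square)
    qed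
    ultimately have "9/16 * ((cmod d)\<^sup>2 * t\<^sup>2) \<le> 1/4 * ((cmod d)\<^sup>2 * t\<^sup>2)"
      by linarith
    moreover have "(cmod d)\<^sup>2 * t\<^sup>2 > 0" using d t(2) by simp
    ultimately show False by linarith
  qed
  then show False by simp
qed

section \<open>Extension to a common ball\<close>

text \<open>Baire's theorem for the space of 0-1 sequences: countably many sets
  \<open>{a. P N a}\<close> cover it, so one of them is dense in the cylinder given by the first
  \<open>n\<close> digits of some \<open>a\<close>. Otherwise nested cylinders could be chosen such
  that the one of step \<open>N\<close> avoids \<open>P N\<close>, and their common point would
  satisfy no \<open>P N\<close> at all.\<close>

lemma Cantor_Baire:
  fixes P :: "nat \<Rightarrow> (nat \<Rightarrow> bool) \<Rightarrow> bool"
  assumes cover: "\<And>a. \<exists>N. P N a"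
  shows "\<exists>N a n. \<forall>b m. (\<forall>i<n. b i = a i) \<longrightarrow> (\<exists>c. (\<forall>i<m. c i = b i) \<and> P N c)" (is ?goal)
proof (rule ccontr)
  assume nex: "\<not> ?goal"
  have neg: "\<exists>b m. (\<forall>i<n. b i = a i) \<and> (\<forall>c. (\<forall>i<m. c i = b i) \<longrightarrow> \<not> P N c)" for N a n
  proof (rule ccontr)
    assume h: "\<not> ?thesis"
    have "\<forall>b m. (\<forall>i<n. b i = a i) \<longrightarrow> (\<exists>c. (\<forall>i<m. c i = b i) \<and> P N c)"
    proof (intro allI impI, rule ccontr)
      fix b :: "nat \<Rightarrow> bool" and m :: nat
      assume b: "\<forall>i<n. b i = a i" and nc: "\<nexists>c. (\<forall>i<m. c i = b i) \<and> P N c"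
      have "\<forall>c. (\<forall>i<m. c i = b i) \<longrightarrow> \<not> P N c" using nc by blast
      with b have "(\<forall>i<n. b i = a i) \<and> (\<forall>c. (\<forall>i<m. c i = b i) \<longrightarrow> \<not> P N c)" ..
      then have "\<exists>b m. (\<forall>i<n. b i = a i) \<and> (\<forall>c. (\<forall>i<m. c i = b i) \<longrightarrow> \<not> P N c)" by (intro exI)
      with h show False ..
    qed
    then have ?goal by (intro exI)
    with nex show False ..
  qed
  define Q where "Q N x y \<longleftrightarrow> snd x < snd y \<and> (\<forall>i<snd x. fst y i = fst x i) \<and>
      (\<forall>c. (\<forall>i<snd y. c i = fst y i) \<longrightarrow> \<not> P N c)" for N and x y :: "(nat \<Rightarrow> bool) \<times> nat"
  have "\<exists>f. \<forall>n. True \<and> Q n (f n) (f (Suc n))"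
  proof (rule dependent_nat_choice)
    fix x :: "(nat \<Rightarrow> bool) \<times> nat" and N :: nat
    obtain b m where b: "\<forall>i<snd x. b i = fst x i" "\<forall>c. (\<forall>i<m. c i = b i) \<longrightarrow> \<not> P N c"
      using neg[of "snd x" "fst x" N] by (elim exE conjE)
    \<comment> \<open>The maximum makes the cylinders strictly longer, so that every digit is
      eventually fixed.\<close>
    have "Q N x (b, max m (Suc (snd x)))"
      using b by (auto simp: Q_def)
    then show "\<exists>y. True \<and> Q N x y" by blast
  qed simp
  then obtain f where f: "\<And>n. Q n (f n) (f (Suc n))" by blast
  define a n where "a N = fst (f N)" and "n N = snd (f N)" for N
  have step: "n N < n (Suc N)" "i < n N \<Longrightarrow> a (Suc N) i = a N i"
    "(\<And>i. i < n (Suc N) \<Longrightarrow> c i = a (Suc N) i) \<Longrightarrow> \<not> P N c" for N i c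
    using f[of N] by (auto simp: Q_def a_def n_def)
  have mono: "n N \<le> n M" if "N \<le> M" for N M
    using that step(1) by (simp add: lift_Suc_mono_le less_imp_le)
  have agree: "i < n N \<Longrightarrow> a (N + d) i = a N i" for N d i
  proof (induction d)
    case (Suc d)
    then have "i < n (N + d)" using mono[of N "N + d"] by simp
    then show ?case using step(2) Suc by simp
  qed simp
  have large: "N \<le> n N" for N
  proof (induction N)
    case (Suc N)
    then show ?case using step(1)[of N] by simp
  qed simp
  \<comment> \<open>The point common to all cylinders: digit \<open>i\<close> is fixed from stage
    \<open>Suc i\<close> on, where the cylinder has length at least \<open>Suc i\<close>.\<close>
  define l where "l i = a (Suc i) i" for i
  have l: "l i = a N i" if "i < n N" for i N
  proof (cases "N \<le> Suc i")
    case True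
    then show ?thesis using agree[OF that, of "Suc i - N"] by (simp add: l_def)
  next
    case False
    have "i < n (Suc i)" using large[of "Suc i"] by simp
    from agree[OF this, of "N - Suc i"] show ?thesis using False by (simp add: l_def)
  qed
  have "\<not> P N l" for N by (rule step(3)) (rule l)
  then show False using cover by blast
qed

text \<open>The counterpart in a chart of holomorphic extendibility near a point, with balls as
  neighbourhoods; \<open>ext_at_iff_lext\<close> is the translation.\<close>

definition lext :: "(complex^'n) set \<Rightarrow> (complex^'n \<Rightarrow> complex) \<Rightarrow> complex^'n \<Rightarrow> bool" where
  "lext A s z \<longleftrightarrow> (\<exists>r>0. \<exists>F. holo_on (ball z r) F \<and> (\<forall>x\<in>A \<inter> ball z r. F x = s x))"

lemma lextI: "0 < r \<Longrightarrow> holo_on (ball z r) F \<Longrightarrow> (\<And>x. x \<in> A \<Longrightarrow> x \<in> ball z r \<Longrightarrow> F x = s x) \<Longrightarrow> lext A s z"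
  unfolding lext_def by blast

lemma lext_open:
  assumes "open W" "z \<in> W" "holo_on W F" "\<And>x. x \<in> A \<Longrightarrow> x \<in> W \<Longrightarrow> F x = s x"
  shows "lext A s z"
proof -
  obtain r where "r > 0" "ball z r \<subseteq> W" using assms(1,2) open_contains_ball by blast
  then show ?thesis using assms(3,4) by (meson holo_on_subset lextI subsetD)
qed

lemma lext_obtain:
  assumes "lext A s z" "e > 0"
  obtains r F where "0 < r" "r \<le> e" "holo_on (ball z r) F" "\<And>x. x \<in> A \<Longrightarrow> x \<in> ball z r \<Longrightarrow> F x = s x"
proof -
  obtain r F where r: "r > 0" "holo_on (ball z r) F" "\<forall>x\<in>A \<inter> ball z r. F x = s x"
    using assms(1) unfolding lext_def by blast
  show ?thesis
  proof (rule that[of "min r e" F])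
    show "holo_on (ball z (min r e)) F" by (rule holo_on_subset[OF r(2)]) auto
  qed (use r assms(2) in auto)
qed

lemma lext_const: "lext A (\<lambda>x. c) z"
  by (rule lextI[of 1 _ "\<lambda>_. c"]) auto

lemma lext_add:
  assumes "lext A s z" "lext A t z" shows "lext A (\<lambda>x. s x + t x) z"
proof -
  obtain r F where r: "0 < r" "holo_on (ball z r) F" "\<And>x. x \<in> A \<Longrightarrow> x \<in> ball z r \<Longrightarrow> F x = s x"
    using lext_obtain[OF assms(1) zero_less_one] by metis
  obtain r' F' where r': "0 < r'" "r' \<le> r" "holo_on (ball z r') F'" "\<And>x. x \<in> A \<Longrightarrow> x \<in> ball z r' \<Longrightarrow> F' x = t x"
    using lext_obtain[OF assms(2) r(1)] by metis
  have sub: "ball z r' \<subseteq> ball z r" using r'(2) by auto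
  show ?thesis
    by (rule lextI[OF r'(1) holo_on_add[OF holo_on_subset[OF r(2) sub] r'(3)]]) (use r(3) r'(4) sub in auto)
qed

lemma lext_cmult:
  assumes "lext A s z" shows "lext A (\<lambda>x. c * s x) z"
proof -
  obtain r F where r: "0 < r" "holo_on (ball z r) F" "\<And>x. x \<in> A \<Longrightarrow> x \<in> ball z r \<Longrightarrow> F x = s x"
    using lext_obtain[OF assms(1) zero_less_one] by metis
  show ?thesis
    by (rule lextI[OF r(1) holo_on_cmult[OF r(2)]]) (use r(3) in auto)
qed

lemma lext_diff: "lext A s z \<Longrightarrow> lext A t z \<Longrightarrow> lext A (\<lambda>x. s x - t x) z"
  using lext_add[of A s z "\<lambda>x. (-1) * t x"] lext_cmult[of A t z "-1"] by simp

lemma lext_sum: "(\<And>i. i \<in> I \<Longrightarrow> lext A (s i) z) \<Longrightarrow> lext A (\<lambda>x. \<Sum>i\<in>I. s i x) z"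
  by (induction I rule: infinite_finite_induct) (auto intro: lext_add lext_const)

lemma suminf_geometric_tail:
  fixes d :: "nat \<Rightarrow> complex"
  assumes "\<And>i. i < m \<Longrightarrow> d i = 0" "\<And>i. cmod (d i) \<le> (1/2) ^ i"
  shows "cmod (suminf d) \<le> 2 * (1/2) ^ m"
proof -
  have geo: "summable (\<lambda>i. (1/2 :: real) ^ i)" by (simp add: summable_geometric)
  have sd: "summable d" by (rule summable_comparison_test'[OF geo]) (use assms(2) in auto)
  have "suminf d = (\<Sum>i. d (i + m)) + (\<Sum>i<m. d i)" by (rule suminf_split_initial_segment[OF sd])
  then have "suminf d = (\<Sum>i. d (i + m))" using assms(1) by simp
  also have "cmod \<dots> \<le> (\<Sum>i. (1/2) ^ m * (1/2) ^ i)"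
  proof (rule norm_suminf_le)
    show "cmod (d (i + m)) \<le> (1/2) ^ m * (1/2) ^ i" for i
      using assms(2)[of "i + m"] by (simp add: power_add mult.commute)
  qed (intro summable_mult geo)
  also have "\<dots> = 2 * (1/2) ^ m" by (subst suminf_mult[OF geo]) (simp add: suminf_geometric)
  finally show ?thesis .
qed

text \<open>The 0-1 combinations of the \<open>t\<^sub>j\<close> form a Cantor space; by Baire and Montel those over some
  cylinder extend with a common bound to a common ball, and \<open>t\<^sub>j\<close> is a difference of two of them.\<close>

lemma uniform_extension:
  fixes t :: "nat \<Rightarrow> complex^'n \<Rightarrow> complex"
  assumes R: "R > 0" and bound: "\<And>j x. x \<in> A \<Longrightarrow> x \<in> ball z R \<Longrightarrow> cmod (t j x) \<le> (1/2) ^ j"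
    and ext: "\<And>a :: nat \<Rightarrow> bool. lext A (\<lambda>x. \<Sum>j. if a j then t j x else 0) z"
  obtains r C n where "r > 0" "\<forall>j\<ge>n. \<exists>F. holo_on (ball z r) F \<and>
     (\<forall>x\<in>ball z r. cmod (F x) \<le> C) \<and> (\<forall>x\<in>A \<inter> ball z r. F x = t j x)"
proof -
  define g where "g a x = (\<Sum>j. if a j then t j x else 0)" for a x
  \<comment> \<open>One natural number controls both the radius and the bound, which makes the cover
    countable.\<close>
  define P where "P N a \<longleftrightarrow> (\<exists>F. holo_on (ball z (1 / real (Suc N))) F \<and>
     (\<forall>x\<in>ball z (1 / real (Suc N)). cmod (F x) \<le> real N) \<and> (\<forall>x\<in>A \<inter> ball z (1 / real (Suc N)). F x = g a x))" for N a
  have geo: "summable (\<lambda>i. (1/2 :: real) ^ i)" by (simp add: summable_geometric)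
  have cover: "\<exists>N. P N a" for a
  proof -
    have "lext A (g a) z" using ext[of a] by (simp add: g_def[abs_def])
    then obtain r F where r: "r > 0" "holo_on (ball z r) F" "\<And>x. x \<in> A \<Longrightarrow> x \<in> ball z r \<Longrightarrow> F x = g a x"
      unfolding lext_def by blast
    have sub: "cball z (r/2) \<subseteq> ball z r" using r(1) by auto
    have "compact (F ` cball z (r/2))"
      using holo_on_continuous[OF r(2)] sub by (meson compact_cball compact_continuous_image continuous_on_subset)
    then obtain B where B: "\<And>w. w \<in> cball z (r/2) \<Longrightarrow> cmod (F w) \<le> B"
      by (meson bounded_iff compact_imp_bounded image_eqI)
    obtain N1 :: nat where N1: "B \<le> real N1" using real_arch_simple by blast
    obtain N2 :: nat where N2: "1 / real (Suc N2) < r/2" using nat_approx_posE[of "r/2"] r(1) by auto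
    define N where "N = max N1 N2"
    have "1 / real (Suc N) \<le> 1 / real (Suc N2)" by (rule frac_le) (auto simp: N_def)
    then have sub2: "ball z (1 / real (Suc N)) \<subseteq> cball z (r/2)" using N2 by auto
    have "P N a"
      unfolding P_def
    proof (intro exI[of _ F] conjI ballI)
      show "holo_on (ball z (1 / real (Suc N))) F" using holo_on_subset[OF r(2)] sub sub2 by blast
      show "cmod (F x) \<le> real N" if "x \<in> ball z (1 / real (Suc N))" for x
      proof -
        have "cmod (F x) \<le> B" using B sub2 that by blast
        also have "\<dots> \<le> real N" using N1 by (simp add: N_def)
        finally show ?thesis .
      qed
      show "F x = g a x" if "x \<in> A \<inter> ball z (1 / real (Suc N))" for x
        using that r(3) sub sub2 by blast
    qed
    then show ?thesis by blast
  qed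
  from Cantor_Baire[of P, OF cover] obtain N a n where N: "\<And>b m. (\<forall>i<n. b i = a i) \<Longrightarrow> \<exists>c. (\<forall>i<m. c i = b i) \<and> P N c"
    by blast
  define \<rho> where "\<rho> = 1 / real (Suc N)"
  have \<rho>: "\<rho> > 0" by (simp add: \<rho>_def)
  define r where "r = min (\<rho>/2) R"
  have r: "r > 0" "ball z r \<subseteq> ball z (\<rho>/2)" "ball z r \<subseteq> ball z R" "ball z r \<subseteq> ball z \<rho>"
    using R \<rho> by (auto simp: r_def)
  have sm: "summable (\<lambda>j. if b j then t j x else 0)" if "x \<in> A" "x \<in> ball z r" for b :: "nat \<Rightarrow> bool" and x
    by (rule summable_comparison_test'[OF geo]) (use bound[OF that(1)] that(2) r(3) in auto)
  \<comment> \<open>Density in the cylinder becomes equality by a normal family argument. The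
    sequence \<open>c m\<close> shares its first \<open>m\<close> digits with \<open>b\<close>, so
    the two series differ on \<open>A\<close> by at most \<open>2 * (1/2)^m\<close>, and a limit of
    the bounded extensions for \<open>c m\<close> extends the series of \<open>b\<close>.\<close>
  have claim: "\<exists>F. holo_on (ball z r) F \<and> (\<forall>x\<in>ball z r. cmod (F x) \<le> real N) \<and> (\<forall>x\<in>A \<inter> ball z r. F x = g b x)"
    if b: "\<forall>i<n. b i = a i" for b
  proof -
    have "\<exists>c F. (\<forall>i<m. c i = b i) \<and> holo_on (ball z \<rho>) F \<and> (\<forall>x\<in>ball z \<rho>. cmod (F x) \<le> real N) \<and>
        (\<forall>x\<in>A \<inter> ball z \<rho>. F x = g c x)" for m
      using N[OF b, of m] unfolding P_def \<rho>_def by blast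
    then obtain c F where c: "\<And>m i. i < m \<Longrightarrow> c m i = b i" and F: "\<And>m. holo_on (ball z \<rho>) (F m)"
      "\<And>m x. x \<in> ball z \<rho> \<Longrightarrow> cmod (F m x) \<le> real N" "\<And>m x. x \<in> A \<Longrightarrow> x \<in> ball z \<rho> \<Longrightarrow> F m x = g (c m) x"
      by (metis IntI)
    obtain G k where G: "strict_mono (k :: nat \<Rightarrow> nat)" "holo_on (ball z (\<rho>/2)) G"
      "\<And>x. x \<in> ball z (\<rho>/2) \<Longrightarrow> (\<lambda>m. F (k m) x) \<longlonglongrightarrow> G x" "\<And>x. x \<in> ball z (\<rho>/2) \<Longrightarrow> cmod (G x) \<le> real N"
      using Montel_ball[of z \<rho> F "real N", OF F(1,2) \<rho>] by metis
    have "G x = g b x" if x: "x \<in> A" "x \<in> ball z r" for x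
    proof -
      have le: "cmod (g (c m) x - g b x) \<le> 2 * (1/2) ^ m" for m
      proof -
        have "g (c m) x - g b x = (\<Sum>j. (if c m j then t j x else 0) - (if b j then t j x else 0))"
          unfolding g_def by (rule suminf_diff[OF sm[OF x] sm[OF x]])
        also have "cmod \<dots> \<le> 2 * (1/2) ^ m"
          by (rule suminf_geometric_tail) (use c bound[OF x(1)] x(2) r(3) in \<open>auto simp: subset_iff\<close>)
        finally show ?thesis .
      qed
      have "(\<lambda>m. 2 * (1/2 :: real) ^ m) \<longlonglongrightarrow> 0"
        using tendsto_mult_right_zero[OF LIMSEQ_power_zero[of "1/2 :: real"]] by simp
      then have "(\<lambda>m. g (c m) x - g b x) \<longlonglongrightarrow> 0"
        by (rule Lim_null_comparison[rotated]) (intro always_eventually allI le)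
      then have "(\<lambda>m. g (c m) x) \<longlonglongrightarrow> g b x" by (simp add: LIM_zero_iff)
      from LIMSEQ_subseq_LIMSEQ[OF this G(1)] have "(\<lambda>m. F (k m) x) \<longlonglongrightarrow> g b x"
        using F(3) x r(4) by (simp add: o_def subset_iff)
      then show ?thesis using G(3) x(2) r(2) LIMSEQ_unique by blast
    qed
    moreover have "holo_on (ball z r) G" by (rule holo_on_subset[OF G(2) r(2)])
    ultimately show ?thesis using G(4) r(2) by blast
  qed
  have "\<exists>F. holo_on (ball z r) F \<and> (\<forall>x\<in>ball z r. cmod (F x) \<le> 2 * real N) \<and> (\<forall>x\<in>A \<inter> ball z r. F x = t j x)"
    if j: "j \<ge> n" for j
  proof -
    \<comment> \<open>For \<open>j \<ge> n\<close> changing digit \<open>j\<close> does not leave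
      the cylinder.\<close>
    obtain F F' where F: "holo_on (ball z r) F" "\<forall>x\<in>ball z r. cmod (F x) \<le> real N" "\<forall>x\<in>A \<inter> ball z r. F x = g (a(j := True)) x"
      and F': "holo_on (ball z r) F'" "\<forall>x\<in>ball z r. cmod (F' x) \<le> real N" "\<forall>x\<in>A \<inter> ball z r. F' x = g (a(j := False)) x"
      using claim[of "a(j := True)"] claim[of "a(j := False)"] j by auto
    have "F x - F' x = t j x" if x: "x \<in> A \<inter> ball z r" for x
    proof -
      have "F x - F' x = g (a(j := True)) x - g (a(j := False)) x" using F(3) F'(3) x by simp
      also have "\<dots> = (\<Sum>i. (if (a(j := True)) i then t i x else 0) - (if (a(j := False)) i then t i x else 0))"
        unfolding g_def by (rule suminf_diff[OF sm sm]) (use x in auto)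
      also have "\<dots> = (\<Sum>i. if i = j then t i x else 0)"
        by (rule arg_cong[where f = suminf]) auto
      also have "\<dots> = t j x" using sums_single[of j "\<lambda>i. t i x"] by (simp add: sums_iff)
      finally show ?thesis .
    qed
    moreover have "cmod (F x - F' x) \<le> 2 * real N" if "x \<in> ball z r" for x
      using norm_triangle_ineq4[of "F x" "F' x"] F(2) F'(2) that by fastforce
    ultimately show ?thesis using holo_on_diff[OF F(1) F'(1)] by blast
  qed
  then show ?thesis using that r(1) by blast
qed

section \<open>Removing an isolated point\<close>

text \<open>The derivative of a section: the choice does not matter where germs of extensions are unique.\<close>

definition dsec :: "(complex^'n) set \<Rightarrow> complex^'n \<Rightarrow> (complex^'n \<Rightarrow> complex) \<Rightarrow> complex^'n \<Rightarrow> complex" where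
  "dsec A v s z = ddir v (SOME F. \<exists>r>0. holo_on (ball z r) F \<and> (\<forall>x\<in>A \<inter> ball z r. F x = s x)) z"

text \<open>\<open>A\<close> stands for the image of the submanifold in a chart. The axiom makes it
  a set of uniqueness around each of its points; for the submanifold it is supplied by
  \<open>unique_in_chart\<close>.\<close>

locale local_trace =
  fixes A :: "(complex^'n) set" and p :: "complex^'n" and R :: real
  assumes unique: "\<And>z r F x. z \<in> A \<Longrightarrow> r > 0 \<Longrightarrow> ball z r \<subseteq> ball p R \<Longrightarrow> holo_on (ball z r) F \<Longrightarrow>
      (\<And>x. x \<in> A \<Longrightarrow> x \<in> ball z r \<Longrightarrow> F x = 0) \<Longrightarrow> x \<in> ball z r \<Longrightarrow> F x = 0"
begin

definition sec :: "(complex^'n \<Rightarrow> complex) \<Rightarrow> bool" where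
  "sec s \<longleftrightarrow> (\<forall>z\<in>A \<inter> ball p R. lext A s z)"

lemma sub_ball:
  assumes "z \<in> ball p R" obtains e where "e > 0" "ball z e \<subseteq> ball p R"
  using assms open_ball open_contains_ball by blast

lemma dsec_eq:
  assumes F: "holo_on (ball z r) F" "\<And>x. x \<in> A \<Longrightarrow> x \<in> ball z r \<Longrightarrow> F x = s x"
    and x: "x \<in> A" "x \<in> ball z r" "x \<in> ball p R"
  shows "dsec A v s x = ddir v F x"
proof -
  obtain e where e: "e > 0" "ball x e \<subseteq> ball p R" using sub_ball[OF x(3)] by blast
  obtain e' where e': "e' > 0" "ball x e' \<subseteq> ball z r" using x(2) open_ball open_contains_ball by blast
  define G where "G = (SOME F. \<exists>r>0. holo_on (ball x r) F \<and> (\<forall>y\<in>A \<inter> ball x r. F y = s y))"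
  have "\<exists>r>0. holo_on (ball x r) F \<and> (\<forall>y\<in>A \<inter> ball x r. F y = s y)"
    using e' F holo_on_subset by blast
  then have "\<exists>r>0. holo_on (ball x r) G \<and> (\<forall>y\<in>A \<inter> ball x r. G y = s y)"
    unfolding G_def by (rule someI[where P = "\<lambda>F. \<exists>r>0. holo_on (ball x r) F \<and> (\<forall>y\<in>A \<inter> ball x r. F y = s y)"])
  then obtain r' where r': "r' > 0" "holo_on (ball x r') G" "\<And>y. y \<in> A \<Longrightarrow> y \<in> ball x r' \<Longrightarrow> G y = s y" by blast
  define d where "d = min e (min e' r')"
  have d: "d > 0" "ball x d \<subseteq> ball p R" "ball x d \<subseteq> ball z r" "ball x d \<subseteq> ball x r'"
    using e e' r'(1) by (auto simp: d_def)
  have "G y - F y = 0" if "y \<in> ball x d" for y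
  proof (rule unique[OF x(1) d(1,2)])
    show "holo_on (ball x d) (\<lambda>y. G y - F y)"
      by (intro holo_on_diff holo_on_subset[OF r'(2) d(4)] holo_on_subset[OF F(1) d(3)])
    show "G y - F y = 0" if "y \<in> A" "y \<in> ball x d" for y
      using r'(3)[OF that(1)] F(2)[OF that(1)] that(2) d(3,4) by (simp add: subset_iff)
  qed (fact that)
  then have "frechet_derivative G (at x) = frechet_derivative F (at x)"
    by (intro ddir_eq_on_open[OF open_ball, of x x d]) (use d(1) in auto)
  then show ?thesis by (simp add: dsec_def G_def)
qed

lemma sec_dsec: assumes "sec s" shows "sec (dsec A v s)"
  unfolding sec_def
proof
  fix z assume z: "z \<in> A \<inter> ball p R"
  obtain e where e: "e > 0" "ball z e \<subseteq> ball p R" using sub_ball z by blast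
  have "lext A s z" using assms z unfolding sec_def by blast
  then obtain r F where r: "0 < r" "r \<le> e" "holo_on (ball z r) F" "\<And>x. x \<in> A \<Longrightarrow> x \<in> ball z r \<Longrightarrow> F x = s x"
    using lext_obtain[OF _ e(1)] by blast
  show "lext A (dsec A v s) z"
  proof (rule lextI[OF r(1) holo_on_ddir[OF r(3) open_ball]])
    fix x assume x: "x \<in> A" "x \<in> ball z r"
    then have "x \<in> ball p R" using r(2) e(2) by (meson subset_ball subsetD)
    then show "ddir v F x = dsec A v s x" using dsec_eq[OF r(3,4) x] by simp
  qed
qed

lemma sec_iter: "sec s \<Longrightarrow> sec ((dsec A v ^^ m) s)"
  by (induction m) (auto intro: sec_dsec)

lemma iter_dsec_eq:
  assumes F: "holo_on (ball z r) F" "\<And>x. x \<in> A \<Longrightarrow> x \<in> ball z r \<Longrightarrow> F x = s x" and sub: "ball z r \<subseteq> ball p R"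
    and x: "x \<in> A" "x \<in> ball z r"
  shows "(dsec A v ^^ m) s x = (ddir v ^^ m) F x"
  using x
proof (induction m arbitrary: x)
  case (Suc m)
  have "dsec A v ((dsec A v ^^ m) s) x = ddir v ((ddir v ^^ m) F) x"
    by (rule dsec_eq[OF holo_on_iter_ddir[OF F(1) open_ball] _ Suc.prems]) (use Suc sub in auto)
  then show ?case by simp
qed (use F in auto)

text \<open>Continuation along the connected set \<open>A \<inter> N\<close>. If \<open>F\<close>
  extends \<open>s\<close> to a ball and \<open>H\<close> agrees with \<open>s\<close> on
  \<open>A\<close> near one point of that ball, then \<open>F - H\<close> vanishes near this point
  because \<open>A\<close> is a set of uniqueness, hence on the whole ball. Thus agreement spreads
  over each such ball.\<close>

lemma eq_near_connected:
  assumes s: "sec s" and r: "ball p r \<subseteq> ball p R" and H: "holo_on (ball p r) H"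
    and N: "open N" "N \<subseteq> ball p r" "connected (A \<inter> N)"
    and x: "x \<in> A \<inter> N" "\<delta> > 0" "\<And>y. y \<in> A \<Longrightarrow> y \<in> ball x \<delta> \<Longrightarrow> H y = s y"
    and y: "y \<in> A \<inter> N"
  shows "H y = s y"
proof -
  let ?P = "\<lambda>x. \<exists>\<delta>>0. \<forall>y\<in>A \<inter> ball x \<delta>. H y = s y"
  have "?P y"
  proof (rule connected_induction_simple[OF N(3), where P = ?P])
    show "?P x" using x by blast
    fix a assume a: "a \<in> A \<inter> N"
    obtain e where e: "e > 0" "ball a e \<subseteq> N" using a N(1) open_contains_ball by blast
    have "lext A s a" using s a N(2) r unfolding sec_def by blast
    then obtain \<rho> F where F: "0 < \<rho>" "\<rho> \<le> e" "holo_on (ball a \<rho>) F" "\<And>x. x \<in> A \<Longrightarrow> x \<in> ball a \<rho> \<Longrightarrow> F x = s x"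
      using lext_obtain[OF _ e(1)] by blast
    have sub: "ball a \<rho> \<subseteq> N" using F(2) e(2) by (meson subset_ball order_trans)
    have hol: "holo_on (ball a \<rho>) (\<lambda>x. F x - H x)"
      by (intro holo_on_diff F(3) holo_on_subset[OF H]) (use sub N(2) in blast)
    have spread: "?P c" if b: "b \<in> (A \<inter> N) \<inter> ball a \<rho>" and Pb: "?P b" and c: "c \<in> (A \<inter> N) \<inter> ball a \<rho>" for b c
    proof -
      obtain \<delta> where \<delta>: "\<delta> > 0" "\<forall>y\<in>A \<inter> ball b \<delta>. H y = s y" using Pb by blast
      obtain e' where e': "e' > 0" "ball b e' \<subseteq> ball a \<rho>" using b open_ball open_contains_ball by blast
      define d where "d = min \<delta> e'"
      have d: "d > 0" "ball b d \<subseteq> ball a \<rho>" "ball b d \<subseteq> ball b \<delta>" using \<delta> e' by (auto simp: d_def)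
      have z1: "F y - H y = 0" if y: "y \<in> ball b d" for y
      proof (rule unique[of b d "\<lambda>y. F y - H y"])
        show "ball b d \<subseteq> ball p R" using d(2) sub N(2) r by blast
        show "holo_on (ball b d) (\<lambda>y. F y - H y)" by (rule holo_on_subset[OF hol d(2)])
        show "F y - H y = 0" if "y \<in> A" "y \<in> ball b d" for y
          using F(4)[OF that(1)] \<delta>(2) that d(2,3) by (auto simp: subset_iff)
      qed (use b d(1) y in auto)
      have z2: "F y - H y = 0" if "y \<in> ball a \<rho>" for y
        by (rule holo_on_eq_0_ball[OF hol _ d(1) _ that, of b]) (use b z1 in auto)
      obtain e'' where e'': "e'' > 0" "ball c e'' \<subseteq> ball a \<rho>" using c open_ball open_contains_ball by blast
      have "H y = s y" if "y \<in> A \<inter> ball c e''" for y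
        using z2[of y] F(4)[of y] that e''(2) by (auto simp: subset_iff)
      then show ?thesis using e''(1) by blast
    qed
    show "\<exists>T. openin (top_of_set (A \<inter> N)) T \<and> a \<in> T \<and> (\<forall>x\<in>T. \<forall>y\<in>T. ?P x \<longrightarrow> ?P y)"
    proof (rule exI[of _ "(A \<inter> N) \<inter> ball a \<rho>"], intro conjI ballI impI)
      show "openin (top_of_set (A \<inter> N)) ((A \<inter> N) \<inter> ball a \<rho>)" by (intro openin_open_Int open_ball)
      show "a \<in> (A \<inter> N) \<inter> ball a \<rho>" using a F(1) by simp
    qed (rule spread)
  qed (use x y in auto)
  then obtain \<delta> where "\<delta> > 0" "\<forall>z\<in>A \<inter> ball y \<delta>. H z = s z" by blast
  then show ?thesis using y by auto
qed

end

text \<open>What is known around a point of the discrete set: limits extend at all other points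
  (\<open>ext_off\<close>), and the value at \<open>p\<close> of a locally extendible function is
  bounded by its values on small spheres (\<open>maximum\<close>). The outcome is
  \<open>limit_extends\<close>, the property \<open>ext_off\<close> at \<open>p\<close>
  itself.\<close>

locale removable_point = local_trace +
  assumes R: "R > 0" and p: "p \<in> A"
    and compact: "\<And>\<epsilon>. 0 < \<epsilon> \<Longrightarrow> \<epsilon> < R \<Longrightarrow> compact (A \<inter> cball p \<epsilon>)"
    and maximum: "\<And>\<epsilon> s C. 0 < \<epsilon> \<Longrightarrow> \<epsilon> < R \<Longrightarrow> (\<And>z. z \<in> A \<Longrightarrow> z \<in> cball p \<epsilon> \<Longrightarrow> lext A s z) \<Longrightarrow>
        (\<And>z. z \<in> A \<Longrightarrow> z \<in> sphere p \<epsilon> \<Longrightarrow> cmod (s z) \<le> C) \<Longrightarrow> cmod (s p) \<le> C"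
    and ext_off: "\<And>q s f \<delta>. q \<in> A \<Longrightarrow> q \<in> ball p R \<Longrightarrow> q \<noteq> p \<Longrightarrow> \<delta> > 0 \<Longrightarrow>
        (\<And>m z. z \<in> A \<Longrightarrow> z \<in> ball q \<delta> \<Longrightarrow> lext A (s m) z) \<Longrightarrow>
        uniform_limit (A \<inter> ball q \<delta>) s f sequentially \<Longrightarrow> lext A f q"
    and connected_nbhd: "\<And>r. r > 0 \<Longrightarrow> \<exists>N. open N \<and> p \<in> N \<and> N \<subseteq> ball p r \<and> connected (A \<inter> N)"
begin

text \<open>The factor \<open>2^j\<close> leaves terms of size \<open>(1/2)^j\<close>, which is what
  \<open>uniform_extension\<close> can sum; dividing by it afterwards turns the uniform bound
  \<open>C\<close> into \<open>C * (1/2)^j\<close>. Partial sums of the series are finite sums of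
  sections, so \<open>ext_off\<close> applies to every 0-1 series.\<close>

lemma uniform_extension_off:
  assumes d: "\<And>j. sec (d j)" and bd: "\<And>j x. x \<in> A \<Longrightarrow> x \<in> ball p R \<Longrightarrow> cmod (d j x) \<le> (1/4) ^ j"
    and q: "q \<in> A" "q \<in> ball p R" "q \<noteq> p"
  obtains r C n where "r > 0" "\<forall>j\<ge>n. \<exists>F. holo_on (ball q r) F \<and>
     (\<forall>x\<in>ball q r. cmod (F x) \<le> C * (1/2) ^ j) \<and> (\<forall>x\<in>A \<inter> ball q r. F x = d j x)"
proof -
  obtain e where e: "e > 0" "ball q e \<subseteq> ball p R" using sub_ball[OF q(2)] by blast
  define t where "t j x = 2 ^ j * d j x" for j x
  have bt: "cmod (t j x) \<le> (1/2) ^ j" if "x \<in> A" "x \<in> ball q e" for j x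
  proof -
    have "cmod (t j x) = 2 ^ j * cmod (d j x)" by (simp add: t_def norm_mult norm_power)
    also have "\<dots> \<le> 2 ^ j * (1/4) ^ j" by (intro mult_left_mono bd) (use that e(2) in auto)
    also have "\<dots> = (1/2) ^ j" by (simp add: power_mult_distrib[symmetric])
    finally show ?thesis .
  qed
  have lt: "lext A (t j) z" if "z \<in> A" "z \<in> ball q e" for j z
    unfolding t_def using d[of j] that e(2) by (intro lext_cmult) (auto simp: sec_def)
  have ext: "lext A (\<lambda>x. \<Sum>j. if a j then t j x else 0) q" for a :: "nat \<Rightarrow> bool"
  proof (rule ext_off[OF q e(1)])
    have "uniform_limit (A \<inter> ball q e) (\<lambda>n x. \<Sum>j<n. if a j then t j x else 0)
        (\<lambda>x. \<Sum>j. if a j then t j x else 0) sequentially"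
    proof (rule Weierstrass_m_test)
      show "cmod (if a j then t j x else 0) \<le> (1/2) ^ j" if "x \<in> A \<inter> ball q e" for j x
        using bt[of x j] that by simp
    qed (simp add: summable_geometric)
    then show "uniform_limit (A \<inter> ball q e) (\<lambda>n x. \<Sum>j<n. if a j then t j x else 0)
        (\<lambda>x. \<Sum>j. if a j then t j x else 0) sequentially" .
    show "lext A (\<lambda>x. \<Sum>j<n. if a j then t j x else 0) z" if "z \<in> A" "z \<in> ball q e" for n z
    proof (rule lext_sum)
      show "lext A (\<lambda>x. if a j then t j x else 0) z" for j
        using lt[OF that] lext_const by (cases "a j") auto
    qed
  qed
  obtain r C n where r: "r > 0" "\<forall>j\<ge>n. \<exists>F. holo_on (ball q r) F \<and>
     (\<forall>x\<in>ball q r. cmod (F x) \<le> C) \<and> (\<forall>x\<in>A \<inter> ball q r. F x = t j x)"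
    by (rule uniform_extension[of e A q t, OF e(1) bt ext]; (assumption | rule that; assumption))
  show ?thesis
  proof (rule that[OF r(1)], intro allI impI)
    fix j assume "j \<ge> n"
    then obtain F where F: "holo_on (ball q r) F" "\<forall>x\<in>ball q r. cmod (F x) \<le> C" "\<forall>x\<in>A \<inter> ball q r. F x = t j x"
      using r(2) by blast
    have "holo_on (ball q r) (\<lambda>x. (1/2) ^ j * F x)" by (rule holo_on_cmult[OF F(1)])
    moreover have "\<forall>x\<in>ball q r. cmod ((1/2) ^ j * F x) \<le> C * (1/2) ^ j"
      using F(2) by (simp add: norm_mult norm_power norm_divide)
    moreover have "\<forall>x\<in>A \<inter> ball q r. (1/2) ^ j * F x = d j x"
      using F(3) by (simp add: t_def power_mult_distrib[symmetric] mult.assoc[symmetric])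
    ultimately show "\<exists>F. holo_on (ball q r) F \<and>
     (\<forall>x\<in>ball q r. cmod (F x) \<le> C * (1/2) ^ j) \<and> (\<forall>x\<in>A \<inter> ball q r. F x = d j x)" by blast
  qed
qed

text \<open>Finitely many of the halved balls cover the compact trace of the sphere, and a ball of
  the smallest halved radius about any point of it lies in one of the full balls.\<close>

lemma uniform_extension_sphere:
  assumes d: "\<And>j. sec (d j)" and bd: "\<And>j x. x \<in> A \<Longrightarrow> x \<in> ball p R \<Longrightarrow> cmod (d j x) \<le> (1/4) ^ j"
    and \<epsilon>: "0 < \<epsilon>" "\<epsilon> < R"
  obtains r C n where "r > 0" "\<forall>j\<ge>n. \<forall>z\<in>A \<inter> sphere p \<epsilon>. \<exists>F. holo_on (ball z r) F \<and>
     (\<forall>x\<in>ball z r. cmod (F x) \<le> C * (1/2) ^ j) \<and> (\<forall>x\<in>A \<inter> ball z r. F x = d j x)"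
proof -
  let ?S = "A \<inter> sphere p \<epsilon>"
  have "?S = (A \<inter> cball p \<epsilon>) \<inter> sphere p \<epsilon>" by auto
  then have "compact ?S" using compact[OF \<epsilon>] by (metis closed_sphere compact_Int_closed)
  have "\<exists>r C n. r > 0 \<and> (\<forall>j\<ge>n. \<exists>F. holo_on (ball q r) F \<and>
     (\<forall>x\<in>ball q r. cmod (F x) \<le> C * (1/2) ^ j) \<and> (\<forall>x\<in>A \<inter> ball q r. F x = d j x))" if "q \<in> ?S" for q
  proof -
    have q: "q \<in> A" "q \<in> ball p R" "q \<noteq> p" using that \<epsilon> by auto
    show ?thesis
      by (rule uniform_extension_off[of d q, OF d bd q]; (assumption | intro exI conjI; assumption))
  qed
  then obtain r C n where rCn: "\<And>q. q \<in> ?S \<Longrightarrow> r q > 0" "\<And>q. q \<in> ?S \<Longrightarrow> \<forall>j\<ge>n q. \<exists>F. holo_on (ball q (r q)) F \<and>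
     (\<forall>x\<in>ball q (r q). cmod (F x) \<le> C q * (1/2) ^ j) \<and> (\<forall>x\<in>A \<inter> ball q (r q). F x = d j x)"
    by metis
  have cov: "?S \<subseteq> (\<Union>q\<in>?S. ball q (r q / 2))"
  proof
    fix q assume q: "q \<in> ?S"
    then have "q \<in> ball q (r q / 2)" using rCn(1)[OF q] by simp
    with q show "q \<in> (\<Union>q\<in>?S. ball q (r q / 2))" by blast
  qed
  obtain T where T: "T \<subseteq> ?S" "finite T" "?S \<subseteq> (\<Union>q\<in>T. ball q (r q / 2))"
    using compactE_image[of ?S ?S "\<lambda>q. ball q (r q / 2)", OF \<open>compact ?S\<close> open_ball cov] by blast
  \<comment> \<open>The inserted elements give the extrema a meaning when the sphere does not meet
    \<open>A\<close> and \<open>T\<close> is empty.\<close>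
  define r0 where "r0 = Min (insert 1 ((\<lambda>q. r q / 2) ` T))"
  define C0 where "C0 = Max (insert 0 (C ` T))"
  define n0 where "n0 = Max (insert 0 (n ` T))"
  have "r q > 0" if "q \<in> T" for q using rCn(1) T(1) that by blast
  then have r0: "r0 > 0" using T(2) by (simp add: r0_def)
  show ?thesis
  proof (rule that[OF r0], intro allI impI ballI)
    fix j z assume j: "j \<ge> n0" and "z \<in> A \<inter> sphere p \<epsilon>"
    then have z: "z \<in> A" "z \<in> sphere p \<epsilon>" by auto
    obtain q where q: "q \<in> T" "z \<in> ball q (r q / 2)" using T(3) z by blast
    have "n q \<le> n0" unfolding n0_def using T(2) q(1) by (intro Max_ge) auto
    then have nj: "n q \<le> j" using j by simp
    have qS: "q \<in> ?S" using q(1) T(1) by blast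
    obtain F where F: "holo_on (ball q (r q)) F" "\<And>x. x \<in> ball q (r q) \<Longrightarrow> cmod (F x) \<le> C q * (1/2) ^ j"
      "\<And>x. x \<in> A \<Longrightarrow> x \<in> ball q (r q) \<Longrightarrow> F x = d j x"
      using rCn(2)[OF qS] nj by blast
    have "r0 \<le> r q / 2" unfolding r0_def using T(2) q(1) by (intro Min_le) auto
    then have sub: "ball z r0 \<subseteq> ball q (r q)"
      using q(2) by (intro subsetI) (simp, smt (verit) dist_triangle dist_commute field_sum_of_halves)
    have "C q \<le> C0" unfolding C0_def using T(2) q(1) by (intro Max_ge) auto
    then have "C q * (1/2) ^ j \<le> C0 * (1/2) ^ j" by (simp add: mult_right_mono)
    then have "\<forall>x\<in>ball z r0. cmod (F x) \<le> C0 * (1/2) ^ j" using F(2) sub by (meson order_trans subsetD)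
    then show "\<exists>F. holo_on (ball z r0) F \<and> (\<forall>x\<in>ball z r0. cmod (F x) \<le> C0 * (1/2) ^ j) \<and>
        (\<forall>x\<in>A \<inter> ball z r0. F x = d j x)"
      using holo_on_subset[OF F(1) sub] F(3) sub by blast
  qed
qed

text \<open>The maximum principle for the iterated derivatives of \<open>d\<^sub>j\<close> carries Cauchy's estimates from a
  sphere around \<open>p\<close> to \<open>p\<close> itself, so that the Taylor series of \<open>d\<^sub>j\<close> at \<open>p\<close> converge in a ball that
  does not depend on \<open>j\<close>.\<close>

lemma extension_at_centre:
  assumes d: "\<And>j. sec (d j)" and bd: "\<And>j x. x \<in> A \<Longrightarrow> x \<in> ball p R \<Longrightarrow> cmod (d j x) \<le> (1/4) ^ j"
  obtains r C n N where "r > 0" "open N" "p \<in> N" "N \<subseteq> ball p r" "N \<subseteq> ball p R"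
     "\<forall>j\<ge>n. \<exists>H. holo_on (ball p r) H \<and>
     (\<forall>x\<in>ball p r. cmod (H x) \<le> C * (1/2) ^ j) \<and> (\<forall>x\<in>A \<inter> N. H x = d j x)"
proof -
  \<comment> \<open>Spheres of radius \<open>R/2\<close> leave room: balls of radius at most
    \<open>R/2\<close> about their points stay in \<open>ball p R\<close>, where derivatives of
    sections are defined.\<close>
  have \<epsilon>: "0 < R/2" "R/2 < R" using R by auto
  obtain r0 C n where r0: "r0 > 0" "\<forall>j\<ge>n. \<forall>z\<in>A \<inter> sphere p (R/2). \<exists>F. holo_on (ball z r0) F \<and>
     (\<forall>x\<in>ball z r0. cmod (F x) \<le> C * (1/2) ^ j) \<and> (\<forall>x\<in>A \<inter> ball z r0. F x = d j x)"
    by (rule uniform_extension_sphere[of d "R/2", OF d bd \<epsilon>]; (assumption | rule that; assumption))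
  define r where "r = min r0 (R/2)"
  have r: "r > 0" "r \<le> r0" "r \<le> R/2" using r0(1) R by (auto simp: r_def)
  obtain N where N: "open N" "p \<in> N" "N \<subseteq> ball p (r/2)" "connected (A \<inter> N)"
    using connected_nbhd[of "r/2"] r(1) by auto
  have subR: "ball p (r/2) \<subseteq> ball p R" using r R by auto
  show ?thesis
  proof (rule that[of "r/2" N n "2 * C"])
    show "N \<subseteq> ball p R" using N(3) subR by blast
    show "\<forall>j\<ge>n. \<exists>H. holo_on (ball p (r/2)) H \<and>
     (\<forall>x\<in>ball p (r/2). cmod (H x) \<le> 2 * C * (1/2) ^ j) \<and> (\<forall>x\<in>A \<inter> N. H x = d j x)"
    proof (intro allI impI)
      fix j assume j: "j \<ge> n"
      \<comment> \<open>The maximum principle needs one function on all of the trace, which is why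
        it is applied to iterates of \<open>dsec\<close>; near the sphere these are derivatives of
        the bounded extensions, so that Cauchy's estimate supplies the bound.\<close>
      have bound: "cmod ((dsec A v ^^ m) (d j) p) \<le> fact m * (C * (1/2) ^ j)" if v: "norm v < r" for v m
      proof (rule maximum[OF \<epsilon>])
        fix z assume z: "z \<in> A" "z \<in> cball p (R/2)"
        then show "lext A ((dsec A v ^^ m) (d j)) z"
          using sec_iter[OF d[of j], of m v] \<epsilon> unfolding sec_def by auto
      next
        fix z assume z: "z \<in> A" "z \<in> sphere p (R/2)"
        obtain F where F: "holo_on (ball z r0) F" "\<And>x. x \<in> ball z r0 \<Longrightarrow> cmod (F x) \<le> C * (1/2) ^ j"
          "\<And>x. x \<in> A \<Longrightarrow> x \<in> ball z r0 \<Longrightarrow> F x = d j x"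
          using r0(2) j z by blast
        have sub0: "ball z r \<subseteq> ball z r0" using r(2) by auto
        have sub: "ball z r \<subseteq> ball p R"
        proof
          fix x assume "x \<in> ball z r"
          then show "x \<in> ball p R" using z(2) r(3) dist_triangle[of p x z] by simp
        qed
        have "(dsec A v ^^ m) (d j) z = (ddir v ^^ m) F z"
          by (rule iter_dsec_eq[OF holo_on_subset[OF F(1) sub0] _ sub z(1)]) (use F(3) sub0 r(1) in auto)
        also have "cmod \<dots> \<le> fact m * (C * (1/2) ^ j)"
          by (rule iter_ddir_bound[OF holo_on_subset[OF F(1) sub0] _ v]) (use F(2) sub0 in auto)
        finally show "cmod ((dsec A v ^^ m) (d j) z) \<le> fact m * (C * (1/2) ^ j)" .
      qed
      have "lext A (d j) p" using d[of j] p R by (auto simp: sec_def)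
      then obtain \<rho> D where D: "0 < \<rho>" "\<rho> \<le> R" "holo_on (ball p \<rho>) D" "\<And>x. x \<in> A \<Longrightarrow> x \<in> ball p \<rho> \<Longrightarrow> D x = d j x"
        using lext_obtain[OF _ R] by blast
      have pin: "p \<in> ball p \<rho>" using D(1) by simp
      have subD: "ball p \<rho> \<subseteq> ball p R" using D(2) by auto
      have bound': "cmod ((ddir v ^^ m) D p) \<le> fact m * (C * (1/2) ^ j)" if "norm v < r" for v m
        using bound[OF that, of m] iter_dsec_eq[OF D(3,4) subD p pin, of m v] by simp
      obtain H \<delta> where H: "holo_on (ball p (r/2)) H" "\<And>x. x \<in> ball p (r/2) \<Longrightarrow> cmod (H x) \<le> 2 * (C * (1/2) ^ j)"
        "\<delta> > 0" "\<And>x. x \<in> ball p \<delta> \<Longrightarrow> H x = D x"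
        using Taylor_extension[OF D(3) open_ball pin r(1) bound'] by blast
      \<comment> \<open>So far \<open>H\<close> agrees with \<open>d j\<close> only on a ball that
        depends on \<open>j\<close>; the connected set \<open>A \<inter> N\<close> was chosen before
        \<open>j\<close>.\<close>
      have "H x = d j x" if "x \<in> A \<inter> N" for x
      proof (rule eq_near_connected[OF d[of j] subR H(1) N(1,3,4) _ _ _ that])
        show "p \<in> A \<inter> N" using p N(2) by blast
        show "min \<delta> \<rho> > 0" using H(3) D(1) by simp
        show "H y = d j y" if "y \<in> A" "y \<in> ball p (min \<delta> \<rho>)" for y
          using H(4) D(4) that by simp
      qed
      then show "\<exists>H. holo_on (ball p (r/2)) H \<and>
       (\<forall>x\<in>ball p (r/2). cmod (H x) \<le> 2 * C * (1/2) ^ j) \<and> (\<forall>x\<in>A \<inter> N. H x = d j x)"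
        using H(1,2) by (intro exI[of _ H]) (simp add: mult.assoc)
    qed
  qed (use r(1) N in auto)
qed

theorem limit_extends:
  assumes s: "\<And>m. sec (s m)" and lim: "uniform_limit (A \<inter> ball p R) s f sequentially"
  shows "lext A f p"
proof -
  \<comment> \<open>With this rate consecutive members of the thinned sequence differ by at most
    \<open>(1/4)^j\<close>.\<close>
  have "\<exists>N. \<forall>n\<ge>N. \<forall>x\<in>A \<inter> ball p R. dist (s n x) (f x) < (1/4) ^ j / 2" for j :: nat
    using uniform_limitD[OF lim, of "(1/4) ^ j / 2"] unfolding eventually_sequentially by simp
  then obtain \<phi> where \<phi>: "\<And>j n x. n \<ge> \<phi> j \<Longrightarrow> x \<in> A \<Longrightarrow> x \<in> ball p R \<Longrightarrow> cmod (s n x - f x) < (1/4) ^ j / 2"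
    unfolding dist_norm by (metis IntI)
  define d where "d j x = s (\<phi> (Suc j)) x - s (\<phi> j) x" for j x
  have sec_d: "sec (d j)" for j
    unfolding d_def sec_def using s unfolding sec_def by (blast intro: lext_diff)
  have bd: "cmod (d j x) \<le> (1/4) ^ j" if x: "x \<in> A" "x \<in> ball p R" for j x
  proof -
    have "d j x = (s (\<phi> (Suc j)) x - f x) - (s (\<phi> j) x - f x)" by (simp add: d_def)
    then have "cmod (d j x) \<le> cmod (s (\<phi> (Suc j)) x - f x) + cmod (s (\<phi> j) x - f x)"
      using norm_triangle_ineq4 by metis
    also have "\<dots> \<le> (1/4) ^ Suc j / 2 + (1/4) ^ j / 2"
      using \<phi>[OF order_refl x, of "Suc j"] \<phi>[OF order_refl x, of j] by linarith
    also have "\<dots> \<le> (1/4) ^ j" by simp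
    finally show ?thesis .
  qed
  obtain r C n N where r: "r > 0" and N: "open N" "p \<in> N" "N \<subseteq> ball p r" "N \<subseteq> ball p R"
    and H: "\<forall>j\<ge>n. \<exists>H. holo_on (ball p r) H \<and>
     (\<forall>x\<in>ball p r. cmod (H x) \<le> C * (1/2) ^ j) \<and> (\<forall>x\<in>A \<inter> N. H x = d j x)"
    by (rule extension_at_centre[of d, OF sec_d bd]; (assumption | rule that; assumption))
  \<comment> \<open>Only the differences from \<open>n\<close> on extend to the common ball. The
    earlier ones are absorbed by the single section \<open>s (\<phi> n)\<close>, to which the
    telescoping series is added.\<close>
  have "\<forall>i. \<exists>h. holo_on (ball p r) h \<and>
     (\<forall>x\<in>ball p r. cmod (h x) \<le> C * (1/2) ^ (i + n)) \<and> (\<forall>x\<in>A \<inter> N. h x = d (i + n) x)"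
    using H by simp
  then obtain h where h: "\<And>i. holo_on (ball p r) (h i)" "\<And>i x. x \<in> ball p r \<Longrightarrow> cmod (h i x) \<le> C * (1/2) ^ (i + n)"
    "\<And>i x. x \<in> A \<Longrightarrow> x \<in> N \<Longrightarrow> h i x = d (i + n) x"
    by (metis IntI)
  have unif: "uniform_limit (ball p r) (\<lambda>m x. \<Sum>i<m. h i x) (\<lambda>x. \<Sum>i. h i x) sequentially"
  proof (rule Weierstrass_m_test)
    show "cmod (h i x) \<le> C * (1/2) ^ n * (1/2) ^ i" if "x \<in> ball p r" for i x
      using h(2)[OF that, of i] by (simp add: power_add mult_ac)
    show "summable (\<lambda>i. C * (1/2) ^ n * (1/2) ^ i)" by (intro summable_mult summable_geometric) simp
  qed
  have hol: "holo_on (ball p r) (\<lambda>x. \<Sum>i. h i x)"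
    by (rule holo_on_uniform_limit[OF _ open_ball unif]) (intro holo_on_sum h(1))
  have "lext A (\<lambda>x. \<Sum>i. d (i + n) x) p"
  proof (rule lext_open[OF N(1,2) holo_on_subset[OF hol N(3)]])
    show "(\<Sum>i. h i x) = (\<Sum>i. d (i + n) x)" if "x \<in> A" "x \<in> N" for x using h(3)[OF that] by simp
  qed
  then have l: "lext A (\<lambda>x. s (\<phi> n) x + (\<Sum>i. d (i + n) x)) p"
    using s[of "\<phi> n"] p R by (intro lext_add) (auto simp: sec_def)
  have eq: "s (\<phi> n) x + (\<Sum>i. d (i + n) x) = f x" if x: "x \<in> A" "x \<in> N" for x
  proof -
    have xR: "x \<in> ball p R" using x N(4) by blast
    have "(\<lambda>j. s (\<phi> j) x - f x) \<longlonglongrightarrow> 0"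
    proof (rule Lim_null_comparison)
      show "\<forall>\<^sub>F j in sequentially. cmod (s (\<phi> j) x - f x) \<le> (1/4) ^ j"
      proof (intro always_eventually allI)
        fix j
        have "(1/4 :: real) ^ j / 2 \<le> (1/4) ^ j" by simp
        then show "cmod (s (\<phi> j) x - f x) \<le> (1/4) ^ j"
          using \<phi>[OF order_refl x(1) xR, of j] by linarith
      qed
      show "(\<lambda>j. (1/4 :: real) ^ j) \<longlonglongrightarrow> 0" by (rule LIMSEQ_power_zero) simp
    qed
    then have "(\<lambda>j. s (\<phi> j) x) \<longlonglongrightarrow> f x" by (simp add: LIM_zero_iff)
    then have "(\<lambda>j. s (\<phi> (j + n)) x) \<longlonglongrightarrow> f x" by (rule LIMSEQ_ignore_initial_segment)
    from telescope_sums[OF this] have "(\<lambda>i. d (i + n) x) sums (f x - s (\<phi> n) x)" by (simp add: d_def)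
    then show ?thesis by (simp add: sums_iff)
  qed
  obtain \<rho> F where F: "0 < \<rho>" "holo_on (ball p \<rho>) F" "\<And>x. x \<in> A \<Longrightarrow> x \<in> ball p \<rho> \<Longrightarrow> F x = s (\<phi> n) x + (\<Sum>i. d (i + n) x)"
    using l unfolding lext_def by blast
  show ?thesis
  proof (rule lext_open[of "N \<inter> ball p \<rho>" p F])
    show "holo_on (N \<inter> ball p \<rho>) F" using holo_on_subset[OF F(2)] by blast
  qed (use N F eq in auto)
qed

end

section \<open>Complex manifolds\<close>

locale complex_manifold =
  fixes \<A> :: "('x::{t2_space, second_countable_topology}, 'n::finite) chart set"
  assumes atlas: "complex_atlas \<A>"
begin

lemma chart_open: "(U, \<phi>) \<in> \<A> \<Longrightarrow> open U"
  using atlas unfolding complex_atlas_def by blast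

lemma chart_homeomorphism:
  assumes "(U, \<phi>) \<in> \<A>" shows "homeomorphism U (\<phi> ` U) \<phi> (inv_into U \<phi>)"
proof -
  obtain \<psi> where \<psi>: "homeomorphism U (\<phi> ` U) \<phi> \<psi>"
    using assms atlas unfolding complex_atlas_def by blast
  then have inj: "inj_on \<phi> U" by (metis homeomorphism_apply1 inj_onI)
  have eq: "inv_into U \<phi> y = \<psi> y" if "y \<in> \<phi> ` U" for y
    using that inj \<psi> by (metis homeomorphism_apply1 imageE inv_into_f_f)
  show ?thesis
    by (rule homeomorphism_cong[OF \<psi>]) (use eq in auto)
qed

lemma chart_inj: "(U, \<phi>) \<in> \<A> \<Longrightarrow> inj_on \<phi> U"
  by (rule inj_on_inverseI, rule homeomorphism_apply1[OF chart_homeomorphism])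

lemma chart_continuous: "(U, \<phi>) \<in> \<A> \<Longrightarrow> continuous_on U \<phi>"
  using chart_homeomorphism homeomorphism_cont1 by blast

lemma chart_inv_continuous: "(U, \<phi>) \<in> \<A> \<Longrightarrow> continuous_on (\<phi> ` U) (inv_into U \<phi>)"
  using chart_homeomorphism homeomorphism_cont2 by blast

lemma chart_inv [simp]: "(U, \<phi>) \<in> \<A> \<Longrightarrow> x \<in> U \<Longrightarrow> inv_into U \<phi> (\<phi> x) = x"
  using chart_inj by (simp add: inv_into_f_f)

lemma chart_image_open:
  assumes c: "(U, \<phi>) \<in> \<A>" and W: "open W" shows "open (\<phi> ` (U \<inter> W))"
proof -
  have "openin (top_of_set U) (U \<inter> W)" using W by blast
  then have "openin (top_of_set (\<phi> ` U)) (\<phi> ` (U \<inter> W))"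
    using homeomorphism_imp_open_map[OF chart_homeomorphism[OF c]] by blast
  moreover have "open (\<phi> ` U)" using atlas c unfolding complex_atlas_def by blast
  ultimately show ?thesis using openin_open_trans by blast
qed

lemma chart_preimage_open:
  assumes c: "(U, \<phi>) \<in> \<A>" and B: "open B" shows "open (U \<inter> \<phi> -` B)"
  using continuous_open_preimage[OF chart_continuous[OF c] chart_open[OF c] B] .

lemma chart_exists: obtains U \<phi> where "(U, \<phi>) \<in> \<A>" "x \<in> U"
  using atlas unfolding complex_atlas_def by blast

lemma chart_at:
  obtains U \<phi> where "chart_at \<A> x = (U, \<phi>)" "(U, \<phi>) \<in> \<A>" "x \<in> U"
proof -
  have "\<exists>c. c \<in> \<A> \<and> x \<in> fst c" using chart_exists[of x] by (metis fst_conv)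
  then have "chart_at \<A> x \<in> \<A> \<and> x \<in> fst (chart_at \<A> x)" unfolding chart_at_def by (rule someI_ex)
  then show ?thesis using that[of "fst (chart_at \<A> x)" "snd (chart_at \<A> x)"] by simp
qed

lemma transition_holo:
  assumes "(U, \<phi>) \<in> \<A>" "(V, \<psi>) \<in> \<A>" "B \<subseteq> \<phi> ` (U \<inter> V)"
  shows "holo_on B (\<lambda>z. \<psi> (inv_into U \<phi> z) $ i)"
proof -
  have "holo_on (\<phi> ` (U \<inter> V)) (\<lambda>z. \<psi> (inv_into U \<phi> z) $ i)"
    using atlas assms(1,2) unfolding complex_atlas_def by blast
  then show ?thesis using assms(3) by (rule holo_on_subset)
qed

text \<open>Injectivity comes from the chain rule for the two mutually inverse transitions. It
  ensures that the coordinates of one chart separate directions when they are read in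
  another.\<close>

lemma transition_derivative:
  assumes c: "(U, \<phi>) \<in> \<A>" "(V, \<psi>) \<in> \<A>" and q: "q \<in> U" "q \<in> V"
  obtains D where "((\<lambda>z. \<psi> (inv_into U \<phi> z)) has_derivative D) (at (\<phi> q))"
    "\<And>a v. D (a *s v) = a *s D v" "\<And>v. D v = 0 \<Longrightarrow> v = 0"
proof -
  have q1: "\<phi> q \<in> \<phi> ` (U \<inter> V)" and q2: "\<psi> q \<in> \<psi> ` (V \<inter> U)" using q by auto
  obtain D where D: "((\<lambda>z. \<psi> (inv_into U \<phi> z)) has_derivative D) (at (\<phi> q))" "\<And>a v. D (a *s v) = a *s D v"
    using holo_on_vector_derivative[of "\<phi> ` (U \<inter> V)" "\<lambda>z. \<psi> (inv_into U \<phi> z)", OF transition_holo[OF c order_refl] q1] by metis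
  obtain D' where D': "((\<lambda>z. \<phi> (inv_into V \<psi> z)) has_derivative D') (at (\<psi> q))"
    using holo_on_vector_derivative[of "\<psi> ` (V \<inter> U)" "\<lambda>z. \<phi> (inv_into V \<psi> z)", OF transition_holo[OF c(2,1) order_refl] q2] by metis
  have "((\<lambda>z. \<phi> (inv_into V \<psi> z)) has_derivative D') (at (\<psi> (inv_into U \<phi> (\<phi> q))))"
    using D' c(1) q(1) by simp
  from diff_chain_at[OF D(1) this]
  have "((\<lambda>z. \<phi> (inv_into V \<psi> (\<psi> (inv_into U \<phi> z)))) has_derivative (\<lambda>v. D' (D v))) (at (\<phi> q))"
    by (simp add: o_def)
  then have "((\<lambda>z. z) has_derivative (\<lambda>v. D' (D v))) (at (\<phi> q))"
    by (rule has_derivative_transform_within_open[OF _ chart_image_open[OF c(1) chart_open[OF c(2)]] q1])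
       (use c in auto)
  then have id: "(\<lambda>v. D' (D v)) = (\<lambda>v. v)" using has_derivative_ident has_derivative_unique by blast
  have "v = 0" if "D v = 0" for v
  proof -
    have "v = D' (D v)" using id by metis
    then show ?thesis using that linear_0[OF has_derivative_linear[OF D']] by simp
  qed
  then show ?thesis using that D by blast
qed

lemma holomorphic_fun_chart:
  "holomorphic_fun \<A> W F \<Longrightarrow> (U, \<phi>) \<in> \<A> \<Longrightarrow> holo_on (\<phi> ` (U \<inter> W)) (\<lambda>z. F (inv_into U \<phi> z))"
  unfolding holomorphic_fun_def by blast

lemma holomorphic_funI:
  assumes c: "(U, \<phi>) \<in> \<A>" and W: "W \<subseteq> U" and G: "holo_on B G" "\<phi> ` W \<subseteq> B"
  shows "holomorphic_fun \<A> W (\<lambda>x. G (\<phi> x))"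
  unfolding holomorphic_fun_def
proof (clarify)
  fix V \<psi> assume V: "(V, \<psi>) \<in> \<A>"
  show "holo_on (\<psi> ` (V \<inter> W)) (\<lambda>z. G (\<phi> (inv_into V \<psi> z)))"
  proof (rule holo_on_compose[OF G(1)])
    show "holo_on (\<psi> ` (V \<inter> W)) (\<lambda>z. \<phi> (inv_into V \<psi> z) $ i)" for i
      by (rule transition_holo[OF V c]) (use W in auto)
    show "(\<lambda>z. \<phi> (inv_into V \<psi> z)) ` \<psi> ` (V \<inter> W) \<subseteq> B" using G(2) V by auto
  qed
qed

lemma holomorphic_fun_subset: "holomorphic_fun \<A> W F \<Longrightarrow> W' \<subseteq> W \<Longrightarrow> holomorphic_fun \<A> W' F"
  unfolding holomorphic_fun_def by (smt (verit) Int_mono case_prodD case_prodI2 holo_on_subset image_mono order_refl)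

lemma holomorphic_fun_smooth:
  assumes "holomorphic_fun \<A> W F" "open W" shows "smooth_fun \<A> W F"
  unfolding smooth_fun_def
proof clarify
  fix U \<phi> assume c: "(U, \<phi>) \<in> \<A>"
  show "Cinf_on (\<phi> ` (U \<inter> W)) (\<lambda>z. F (inv_into U \<phi> z))"
    by (rule holo_on_imp_Cinf_on[OF holomorphic_fun_chart[OF assms(1) c] chart_image_open[OF c assms(2)]])
qed

lemma holomorphic_fun_continuous:
  assumes "holomorphic_fun \<A> W F" "open W" shows "continuous_on W F"
  unfolding continuous_on_eq_continuous_at[OF assms(2)]
proof
  fix x assume x: "x \<in> W"
  obtain U \<phi> where c: "(U, \<phi>) \<in> \<A>" "x \<in> U" by (rule chart_exists)
  have "continuous_on (U \<inter> W) (\<lambda>y. F (inv_into U \<phi> (\<phi> y)))"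
    by (rule continuous_on_compose2[OF holo_on_continuous[OF holomorphic_fun_chart[OF assms(1) c(1)]]
        continuous_on_subset[OF chart_continuous[OF c(1)]]]) auto
  then have "continuous_on (U \<inter> W) F" by (rule continuous_on_eq) (use c in auto)
  moreover have "open (U \<inter> W)" using chart_open[OF c(1)] assms(2) by blast
  ultimately show "isCont F x" using x c(2) by (simp add: continuous_on_eq_continuous_at)
qed

section \<open>Extendibility near a point, germs, defining functions in charts\<close>

definition ext_at :: "'x set \<Rightarrow> ('x \<Rightarrow> complex) \<Rightarrow> 'x \<Rightarrow> bool" where
  "ext_at A f x \<longleftrightarrow> (\<exists>W F. open W \<and> x \<in> W \<and> holomorphic_fun \<A> W F \<and> (\<forall>y\<in>W \<inter> A. F y = f y))"

lemma ext_at_iff_lext: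
  assumes c: "(U, \<phi>) \<in> \<A>" and x: "x \<in> U"
  shows "ext_at A f x \<longleftrightarrow> lext (\<phi> ` (A \<inter> U)) (\<lambda>z. f (inv_into U \<phi> z)) (\<phi> x)"
proof
  assume "ext_at A f x"
  then obtain W F where W: "open W" "x \<in> W" "holomorphic_fun \<A> W F" "\<forall>y\<in>W \<inter> A. F y = f y"
    unfolding ext_at_def by blast
  show "lext (\<phi> ` (A \<inter> U)) (\<lambda>z. f (inv_into U \<phi> z)) (\<phi> x)"
  proof (rule lext_open[OF chart_image_open[OF c W(1)] _ holomorphic_fun_chart[OF W(3) c]])
    show "\<phi> x \<in> \<phi> ` (U \<inter> W)" using x W(2) by blast
    show "F (inv_into U \<phi> z) = f (inv_into U \<phi> z)" if "z \<in> \<phi> ` (A \<inter> U)" "z \<in> \<phi> ` (U \<inter> W)" for z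
    proof -
      from that obtain y y' where y: "y \<in> A \<inter> U" "z = \<phi> y" "y' \<in> U \<inter> W" "z = \<phi> y'" by blast
      then have "y = y'" using chart_inj[OF c] by (auto dest: inj_onD)
      then show ?thesis using W(4) y c by auto
    qed
  qed
next
  assume "lext (\<phi> ` (A \<inter> U)) (\<lambda>z. f (inv_into U \<phi> z)) (\<phi> x)"
  then obtain r F where r: "r > 0" "holo_on (ball (\<phi> x) r) F"
    "\<And>z. z \<in> \<phi> ` (A \<inter> U) \<Longrightarrow> z \<in> ball (\<phi> x) r \<Longrightarrow> F z = f (inv_into U \<phi> z)"
    unfolding lext_def by blast
  let ?W = "U \<inter> \<phi> -` ball (\<phi> x) r"
  have "holomorphic_fun \<A> ?W (\<lambda>x. F (\<phi> x))" by (rule holomorphic_funI[OF c _ r(2)]) auto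
  moreover have "F (\<phi> y) = f y" if "y \<in> ?W \<inter> A" for y using r(3)[of "\<phi> y"] that c by auto
  ultimately show "ext_at A f x"
    unfolding ext_at_def using chart_preimage_open[OF c open_ball[of "\<phi> x" r]] x r(1)
    by (intro exI[of _ ?W] exI[of _ "\<lambda>x. F (\<phi> x)"]) auto
qed

lemma germ_eq_iff:
  assumes "x \<in> A"
  shows "germ A x f = germ A x g \<longleftrightarrow> (\<exists>W. open W \<and> x \<in> W \<and> (\<forall>y\<in>W \<inter> A. f y = g y))"
proof
  assume eq: "germ A x f = germ A x g"
  have "\<exists>U. openin (top_of_set A) U \<and> x \<in> U \<and> (\<forall>y\<in>U. f y = f y)"
    using assms by (intro exI[of _ A]) auto
  then have "f \<in> snd (germ A x f)" by (simp add: germ_def)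
  then have "f \<in> snd (germ A x g)" using eq by simp
  then obtain U where "openin (top_of_set A) U" "x \<in> U" "\<forall>y\<in>U. f y = g y" by (auto simp: germ_def)
  then show "\<exists>W. open W \<and> x \<in> W \<and> (\<forall>y\<in>W \<inter> A. f y = g y)" unfolding openin_open by blast
next
  assume "\<exists>W. open W \<and> x \<in> W \<and> (\<forall>y\<in>W \<inter> A. f y = g y)"
  then obtain W where W: "open W" "x \<in> W" "\<forall>y\<in>W \<inter> A. f y = g y" by blast
  have W': "openin (top_of_set A) (A \<inter> W)" using W(1) by blast
  have "(\<exists>U. openin (top_of_set A) U \<and> x \<in> U \<and> (\<forall>y\<in>U. h y = f y)) \<longleftrightarrow>
        (\<exists>U. openin (top_of_set A) U \<and> x \<in> U \<and> (\<forall>y\<in>U. h y = g y))" for h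
  proof
    assume "\<exists>U. openin (top_of_set A) U \<and> x \<in> U \<and> (\<forall>y\<in>U. h y = f y)"
    then obtain U where "openin (top_of_set A) U" "x \<in> U" "\<forall>y\<in>U. h y = f y" by blast
    then show "\<exists>U. openin (top_of_set A) U \<and> x \<in> U \<and> (\<forall>y\<in>U. h y = g y)"
      using W assms W' by (intro exI[of _ "U \<inter> (A \<inter> W)"]) (auto intro: openin_Int)
  next
    assume "\<exists>U. openin (top_of_set A) U \<and> x \<in> U \<and> (\<forall>y\<in>U. h y = g y)"
    then obtain U where "openin (top_of_set A) U" "x \<in> U" "\<forall>y\<in>U. h y = g y" by blast
    then show "\<exists>U. openin (top_of_set A) U \<and> x \<in> U \<and> (\<forall>y\<in>U. h y = f y)"
      using W assms W' by (intro exI[of _ "U \<inter> (A \<inter> W)"]) (auto intro: openin_Int)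
  qed
  then show "germ A x f = germ A x g" by (simp add: germ_def)
qed

lemma holomorphic_germ_iff: "germ A x f \<in> holomorphic_germs \<A> A \<longleftrightarrow> x \<in> A \<and> ext_at A f x"
proof
  assume "germ A x f \<in> holomorphic_germs \<A> A"
  then obtain x' F W where F: "germ A x f = germ A x' F" "x' \<in> A" "open W" "x' \<in> W" "holomorphic_fun \<A> W F"
    unfolding holomorphic_germs_def by blast
  have "x' = x" using F(1) by (simp add: germ_def)
  then have "x \<in> A" "germ A x f = germ A x F" using F(1,2) by simp_all
  then obtain W' where W': "open W'" "x \<in> W'" "\<forall>y\<in>W' \<inter> A. f y = F y"
    using germ_eq_iff[of x A f F] by blast
  have "holomorphic_fun \<A> (W \<inter> W') F" by (rule holomorphic_fun_subset[OF F(5)]) auto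
  then have "ext_at A f x"
    unfolding ext_at_def using W' F(3,4) \<open>x' = x\<close> by (intro exI[of _ "W \<inter> W'"] exI[of _ F]) auto
  then show "x \<in> A \<and> ext_at A f x" using F(2) \<open>x' = x\<close> by simp
next
  assume "x \<in> A \<and> ext_at A f x"
  then obtain W F where "x \<in> A" "open W" "x \<in> W" "holomorphic_fun \<A> W F" "\<forall>y\<in>W \<inter> A. F y = f y"
    unfolding ext_at_def by blast
  moreover from this have "germ A x f = germ A x F" using germ_eq_iff[of x A f F] by force
  ultimately show "germ A x f \<in> holomorphic_germs \<A> A" unfolding holomorphic_germs_def by blast
qed

text \<open>\<open>differential\<close>, \<open>del\<close> and \<open>hessian_at\<close> are read
  in the chart that \<open>chart_at\<close> selects, so the translation is made in that chart. The
  nonvanishing wedge product becomes a system of vectors dual to the differentials.\<close>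

lemma defining_functions_in_chart:
  assumes def: "defining_functions \<A> k M q W \<rho>" and q: "q \<in> M" and c: "chart_at \<A> q = (U, \<phi>)" "(U, \<phi>) \<in> \<A>" "q \<in> U"
  obtains u where "open (\<phi> ` (U \<inter> W))" "\<phi> q \<in> \<phi> ` (U \<inter> W)" "coord_at \<A> q = \<phi> q"
    "\<forall>j<k. Cinf_on (\<phi> ` (U \<inter> W)) (\<lambda>z. \<rho> j (inv_into U \<phi> z))"
    "\<forall>j<k. \<rho> j (inv_into U \<phi> (\<phi> q)) = 0"
    "\<forall>i<k. \<forall>j<k.
       frechet_derivative (\<lambda>z. \<rho> i (inv_into U \<phi> z)) (at (\<phi> q)) (u j) = (if i = j then 1 else 0)"
    "\<forall>z\<in>\<phi> ` (U \<inter> W). inv_into U \<phi> z \<in> M \<longleftrightarrow> (\<forall>j<k. \<rho> j (inv_into U \<phi> z) = 0)"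
    "\<forall>j v. differential \<A> q (\<rho> j) v = frechet_derivative (\<lambda>z. \<rho> j (inv_into U \<phi> z)) (at (\<phi> q)) v"
proof -
  have W: "open W" "q \<in> W" "\<And>j. j < k \<Longrightarrow> smooth_fun \<A> W (\<rho> j)" "M \<inter> W = {x \<in> W. \<forall>j<k. \<rho> j x = 0}"
    "\<exists>v. wedge k (\<lambda>j. differential \<A> q (\<rho> j)) v \<noteq> 0"
    using def unfolding defining_functions_def by blast+
  have op: "open (\<phi> ` (U \<inter> W))" by (rule chart_image_open[OF c(2) W(1)])
  have in': "\<phi> q \<in> \<phi> ` (U \<inter> W)" using c(3) W(2) by blast
  have coord: "coord_at \<A> q = \<phi> q" by (simp add: coord_at_def c(1))
  have diff: "differential \<A> q (\<rho> j) = frechet_derivative (\<lambda>z. \<rho> j (inv_into U \<phi> z)) (at (\<phi> q))" for j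
    by (simp add: fun_eq_iff differential_def local_rep_def c(1) coord)
  have smooth: "Cinf_on (\<phi> ` (U \<inter> W)) (\<lambda>z. \<rho> j (inv_into U \<phi> z))" if "j < k" for j
    using W(3)[OF that] c(2) unfolding smooth_fun_def by blast
  have lin: "linear (differential \<A> q (\<rho> j))" if "j < k" for j
  proof -
    have "Ck_on (Suc 0) (\<phi> ` (U \<inter> W)) (\<lambda>z. \<rho> j (inv_into U \<phi> z))"
      using smooth[OF that] unfolding Cinf_on_def by blast
    then have "\<forall>z\<in>\<phi> ` (U \<inter> W). (\<lambda>z. \<rho> j (inv_into U \<phi> z)) differentiable (at z)"
      unfolding Ck_on.simps by (rule conjunct1)
    then show ?thesis unfolding diff using in' linear_frechet_derivative by blast
  qed
  obtain v where "wedge k (\<lambda>j. differential \<A> q (\<rho> j)) v \<noteq> 0" using W(5) by blast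
  then obtain u where u: "\<And>i j. i < k \<Longrightarrow> j < k \<Longrightarrow> differential \<A> q (\<rho> i) (u j) = (if i = j then 1 else 0)"
    using wedge_dual_vectors[of k "\<lambda>j. differential \<A> q (\<rho> j)" v, OF lin] by blast
  show ?thesis
  proof (rule that[OF op in' coord], safe)
    show "Cinf_on (\<phi> ` (U \<inter> W)) (\<lambda>z. \<rho> j (inv_into U \<phi> z))" if "j < k" for j by (rule smooth[OF that])
    show "\<rho> j (inv_into U \<phi> (\<phi> q)) = 0" if "j < k" for j
      using W(2,4) q that c(2,3) by auto
    show "frechet_derivative (\<lambda>z. \<rho> i (inv_into U \<phi> z)) (at (\<phi> q)) (u j) = (if i = j then 1 else 0)"
      if "i < k" "j < k" for i j using u[OF that] by (simp add: diff)
    have M_iff: "inv_into U \<phi> (\<phi> y) \<in> M \<longleftrightarrow> (\<forall>j<k. \<rho> j (inv_into U \<phi> (\<phi> y)) = 0)" if "y \<in> U" "y \<in> W" for y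
      using W(4) that c(2) by auto
    show "\<rho> j (inv_into U \<phi> (\<phi> y)) = 0" if "y \<in> U" "y \<in> W" "inv_into U \<phi> (\<phi> y) \<in> M" "j < k" for y j
      using M_iff that by blast
    show "inv_into U \<phi> (\<phi> y) \<in> M" if "y \<in> U" "y \<in> W" "\<forall>j<k. \<rho> j (inv_into U \<phi> (\<phi> y)) = 0" for y
      using M_iff that by blast
    show "differential \<A> q (\<rho> j) v = frechet_derivative (\<lambda>z. \<rho> j (inv_into U \<phi> z)) (at (\<phi> q)) v" for j v
      by (simp add: diff)
  qed
qed

lemma submanifold_locally_connected:
  assumes M: "real_submanifold \<A> k M" and q: "q \<in> M" and O: "open N" "q \<in> N"
  obtains N' where "open N'" "q \<in> N'" "N' \<subseteq> N" "connected (M \<inter> N')"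
proof -
  obtain W \<rho> where def: "defining_functions \<A> k M q W \<rho>" using M q unfolding real_submanifold_def by blast
  obtain U \<phi> where c: "chart_at \<A> q = (U, \<phi>)" "(U, \<phi>) \<in> \<A>" "q \<in> U" by (rule chart_at)
  let ?\<rho> = "\<lambda>j z. \<rho> j (inv_into U \<phi> z)"
  obtain u where d0: "open (\<phi> ` (U \<inter> W))" "\<phi> q \<in> \<phi> ` (U \<inter> W)"
    "\<forall>j<k. Cinf_on (\<phi> ` (U \<inter> W)) (?\<rho> j)" "\<forall>j<k. ?\<rho> j (\<phi> q) = 0"
    "\<forall>i<k. \<forall>j<k. frechet_derivative (?\<rho> i) (at (\<phi> q)) (u j) = (if i = j then 1 else 0)"
    "\<forall>z\<in>\<phi> ` (U \<inter> W). inv_into U \<phi> z \<in> M \<longleftrightarrow> (\<forall>j<k. ?\<rho> j z = 0)"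
    by (rule defining_functions_in_chart[OF def q c]) (rule that; assumption)
  note d = d0[rule_format]
  let ?B = "\<phi> ` (U \<inter> W) \<inter> \<phi> ` (U \<inter> N)"
  have B: "open ?B" "\<phi> q \<in> ?B" using d(1,2) chart_image_open[OF c(2) O(1)] O(2) c(3) by auto
  have C1: "Ck_on (Suc 0) ?B (?\<rho> j)" if "j < k" for j
  proof -
    have "Ck_on (Suc 0) (\<phi> ` (U \<inter> W)) (?\<rho> j)" using d(3)[OF that] unfolding Cinf_on_def by blast
    then show ?thesis by (auto intro: continuous_on_subset)
  qed
  obtain B' where B': "open B'" "\<phi> q \<in> B'" "B' \<subseteq> ?B" "connected {z \<in> B'. \<forall>j<k. ?\<rho> j z = 0}"
    using connected_neighbourhood_in_zero_set[of ?B "\<phi> q" k ?\<rho> u, OF B C1 d(4,5)] by blast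
  let ?N = "U \<inter> \<phi> -` B'"
  have "M \<inter> ?N = inv_into U \<phi> ` {z \<in> B'. \<forall>j<k. ?\<rho> j z = 0}"
  proof (intro equalityI subsetI)
    fix x assume x: "x \<in> M \<inter> ?N"
    then have "\<phi> x \<in> \<phi> ` (U \<inter> W)" using B'(3) by blast
    then have "\<phi> x \<in> {z \<in> B'. \<forall>j<k. ?\<rho> j z = 0}" using d(6)[of "\<phi> x"] x c(2) by auto
    moreover have "x = inv_into U \<phi> (\<phi> x)" using x c(2) by simp
    ultimately show "x \<in> inv_into U \<phi> ` {z \<in> B'. \<forall>j<k. ?\<rho> j z = 0}" by blast
  next
    fix x assume "x \<in> inv_into U \<phi> ` {z \<in> B'. \<forall>j<k. ?\<rho> j z = 0}"
    then obtain z where z: "z \<in> B'" "\<forall>j<k. ?\<rho> j z = 0" "x = inv_into U \<phi> z" by blast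
    then have "z \<in> \<phi> ` (U \<inter> W)" using B'(3) by blast
    then have "x \<in> M" using d(6) z by blast
    moreover have "x \<in> U" "\<phi> x = z" using \<open>z \<in> \<phi> ` (U \<inter> W)\<close> z(3) c(2) by auto
    ultimately show "x \<in> M \<inter> ?N" using z(1) by simp
  qed
  moreover have "connected (inv_into U \<phi> ` {z \<in> B'. \<forall>j<k. ?\<rho> j z = 0})"
    by (rule connected_continuous_image[OF continuous_on_subset[OF chart_inv_continuous[OF c(2)]] B'(4)])
       (use B'(3) in auto)
  moreover have "?N \<subseteq> N"
  proof
    fix x assume x: "x \<in> ?N"
    then obtain y where "y \<in> U \<inter> N" "\<phi> x = \<phi> y" using B'(3) by blast
    then show "x \<in> N" using x chart_inj[OF c(2)] by (auto dest: inj_onD)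
  qed
  ultimately show ?thesis
    using that[of ?N] chart_preimage_open[OF c(2) B'(1)] c(3) B'(2) by simp
qed

text \<open>Along curves in \<open>M\<close> the function is constant, so its derivative vanishes on
  the tangent space; being complex linear, it vanishes on \<open>T + \<i> T\<close>, which is
  everything by genericity. The computation takes place in the selected chart and is carried to the
  chart \<open>\<phi>\<close> by the chain rule.\<close>

lemma holomorphic_derivative_zero_generic:
  assumes M: "real_submanifold \<A> k M" "generic \<A> k M" and q: "q \<in> M"
    and F: "open W" "q \<in> W" "holomorphic_fun \<A> W F" "\<And>x. x \<in> M \<Longrightarrow> x \<in> W \<Longrightarrow> F x = 0"
    and c: "(U, \<phi>) \<in> \<A>" "q \<in> U"
  shows "ddir v (\<lambda>z. F (inv_into U \<phi> z)) (\<phi> q) = 0"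
proof -
  obtain W1 \<rho> where def: "defining_functions \<A> k M q W1 \<rho>" using M(1) q unfolding real_submanifold_def by blast
  obtain V \<psi> where cV: "chart_at \<A> q = (V, \<psi>)" "(V, \<psi>) \<in> \<A>" "q \<in> V" by (rule chart_at)
  let ?\<rho> = "\<lambda>j z. \<rho> j (inv_into V \<psi> z)"
  obtain u where d0: "open (\<psi> ` (V \<inter> W1))" "\<psi> q \<in> \<psi> ` (V \<inter> W1)"
    "\<forall>j<k. Cinf_on (\<psi> ` (V \<inter> W1)) (?\<rho> j)" "\<forall>j<k. ?\<rho> j (\<psi> q) = 0"
    "\<forall>i<k. \<forall>j<k. frechet_derivative (?\<rho> i) (at (\<psi> q)) (u j) = (if i = j then 1 else 0)"
    "\<forall>z\<in>\<psi> ` (V \<inter> W1). inv_into V \<psi> z \<in> M \<longleftrightarrow> (\<forall>j<k. ?\<rho> j z = 0)"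
    "\<forall>j v. differential \<A> q (\<rho> j) v = frechet_derivative (?\<rho> j) (at (\<psi> q)) v"
    by (rule defining_functions_in_chart[OF def q cV]) (rule that; assumption)
  note d = d0[rule_format]
  let ?B = "\<psi> ` (V \<inter> W1) \<inter> \<psi> ` (V \<inter> W)"
  have B: "open ?B" "\<psi> q \<in> ?B" using d(1,2) chart_image_open[OF cV(2) F(1)] F(2) cV(3) by auto
  have C1: "Ck_on (Suc 0) ?B (?\<rho> j)" if "j < k" for j
  proof -
    have "Ck_on (Suc 0) (\<psi> ` (V \<inter> W1)) (?\<rho> j)" using d(3)[OF that] unfolding Cinf_on_def by blast
    then show ?thesis by (auto intro: continuous_on_subset)
  qed
  let ?G = "\<lambda>z. F (inv_into V \<psi> z)"
  have G: "holo_on ?B ?G" by (rule holo_on_subset[OF holomorphic_fun_chart[OF F(3) cV(2)]]) auto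
  have tan0: "ddir v ?G (\<psi> q) = 0" if v: "v \<in> tangent_space \<A> k M q" for v
  proof -
    have "differential \<A> q (\<rho> j) v = 0" if "j < k" for j
      using v def that unfolding tangent_space_def by blast
    then have v': "frechet_derivative (?\<rho> j) (at (\<psi> q)) v = 0" if "j < k" for j using d(7) that by simp
    obtain \<gamma> \<delta> where \<gamma>: "\<gamma> 0 = \<psi> q" "(\<gamma> has_vector_derivative v) (at 0)" "\<delta> > (0::real)"
      "\<And>t. \<bar>t\<bar> < \<delta> \<Longrightarrow> \<gamma> t \<in> ?B" "\<And>t j. \<bar>t\<bar> < \<delta> \<Longrightarrow> j < k \<Longrightarrow> ?\<rho> j (\<gamma> t) = 0"
      using tangent_curve[of ?B "\<psi> q" k ?\<rho> u v, OF B C1 d(4,5) v'] by blast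
    have zero: "?G (\<gamma> t) = 0" if "t \<in> ball 0 \<delta>" for t
    proof -
      have t: "\<bar>t\<bar> < \<delta>" using that by simp
      have "inv_into V \<psi> (\<gamma> t) \<in> M" using d(6)[of "\<gamma> t"] \<gamma>(4)[OF t] \<gamma>(5)[OF t] by blast
      moreover have "inv_into V \<psi> z \<in> W" if "z \<in> \<psi> ` (V \<inter> W)" for z using that cV(2) by auto
      then have "inv_into V \<psi> (\<gamma> t) \<in> W" using \<gamma>(4)[OF t] by blast
      ultimately show ?thesis using F(4) by blast
    qed
    have "((\<lambda>t. ?G (\<gamma> t)) has_vector_derivative ddir v ?G (\<psi> q)) (at 0)"
      using holo_on_curve_derivative[OF G _ \<gamma>(2)] \<gamma>(1) B(2) by simp
    then have "((\<lambda>t. 0) has_vector_derivative ddir v ?G (\<psi> q)) (at (0::real))"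
      by (rule has_vector_derivative_transform_within_open[OF _ open_ball[of 0 \<delta>]]) (use zero \<gamma>(3) in auto)
    then show ?thesis using vector_derivative_unique_at has_vector_derivative_const by blast
  qed
  have all0: "ddir x ?G (\<psi> q) = 0" for x
  proof -
    have "x \<in> {v + \<i> *s w | v w. v \<in> tangent_space \<A> k M q \<and> w \<in> tangent_space \<A> k M q}"
      using M(2) q unfolding generic_def by blast
    then obtain v w where x: "x = v + \<i> *s w" and "v \<in> tangent_space \<A> k M q" "w \<in> tangent_space \<A> k M q" by blast
    then have "ddir v ?G (\<psi> q) = 0" "ddir w ?G (\<psi> q) = 0" using tan0 by auto
    then show ?thesis
      using linear_add[OF holo_on_linear[OF G B(2)], of v "\<i> *s w"] holo_on_smult[OF G B(2), of \<i> w] x by simp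
  qed
  obtain D where D: "((\<lambda>z. \<psi> (inv_into U \<phi> z)) has_derivative D) (at (\<phi> q))"
    using transition_derivative[OF c(1) cV(2) c(2) cV(3)] by metis
  have "((\<lambda>z. ?G (\<psi> (inv_into U \<phi> z))) has_derivative (\<lambda>v. ddir (D v) ?G (\<psi> q))) (at (\<phi> q))"
    using diff_chain_at[OF D, of ?G] holo_on_has_derivative[OF G B(2)] c by (simp add: o_def)
  then have "((\<lambda>z. F (inv_into U \<phi> z)) has_derivative (\<lambda>v. ddir (D v) ?G (\<psi> q))) (at (\<phi> q))"
    by (rule has_derivative_transform_within_open[OF _ chart_image_open[OF c(1) chart_open[OF cV(2)]]])
       (use c cV in auto)
  from frechet_derivative_at[OF this] show ?thesis using all0 by metis
qed

end

section \<open>Weakly pseudoconcave submanifolds\<close>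

lemma lext_cong: "(\<And>x. x \<in> A \<Longrightarrow> s x = t x) \<Longrightarrow> lext A s z = lext A t z"
  unfolding lext_def by (metis IntD1)

lemma lext_continuous:
  assumes "\<And>z. z \<in> K \<Longrightarrow> lext A s z" "K \<subseteq> A" shows "continuous_on K s"
  unfolding continuous_on_eq_continuous_within
proof
  fix z assume z: "z \<in> K"
  obtain r F where r: "r > 0" "holo_on (ball z r) F" "\<And>x. x \<in> A \<Longrightarrow> x \<in> ball z r \<Longrightarrow> F x = s x"
    using assms(1)[OF z] unfolding lext_def by blast
  have "continuous (at z within K) F"
    using holo_on_continuous[OF r(2)] r(1) by (simp add: continuous_on_eq_continuous_at continuous_at_imp_continuous_within)
  then show "continuous (at z within K) s"
    by (rule continuous_transform_within[OF _ r(1) z]) (use r(3) assms(2) in \<open>auto simp: dist_commute\<close>)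
qed

lemma (in complex_manifold) ext_at_chart_iff:
  assumes c: "(U, \<phi>) \<in> \<A>" and y: "y \<in> U"
  shows "ext_at A (\<lambda>y. h (\<phi> y)) y \<longleftrightarrow> lext (\<phi> ` (A \<inter> U)) h (\<phi> y)"
proof -
  have "lext (\<phi> ` (A \<inter> U)) (\<lambda>z. h (\<phi> (inv_into U \<phi> z))) (\<phi> y) = lext (\<phi> ` (A \<inter> U)) h (\<phi> y)"
    by (rule lext_cong) (use c in auto)
  then show ?thesis using ext_at_iff_lext[OF c y, of A "\<lambda>y. h (\<phi> y)"] by simp
qed

locale pseudoconcave_submanifold = complex_manifold \<A>
  for \<A> :: "('x::{t2_space, second_countable_topology}, 'n::finite) chart set" +
  fixes k :: nat and M E :: "'x set"
  assumes M_closed: "locally_closed M" and submanifold: "real_submanifold \<A> k M"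
    and concave: "weakly_pseudoconcave \<A> k 1 M"
    and E_closed: "closedin (top_of_set M) E" and E_discrete: "discrete E"
    and reg_dense: "M \<subseteq> closure (reg_points \<A> k M)"
    and reg_CR: "CR_submanifold \<A> k (reg_points \<A> k M)"
    and reg_generic: "generic \<A> k (reg_points \<A> k M)"
    and off_E: "\<forall>p\<in>M - E. holo_extension_at \<A> (M - E) p"
begin

text \<open>At generic points the derivatives of a function vanishing on \<open>M\<close> vanish
  too. These derivatives are again holomorphic and zero on the regular part, so the argument repeats
  for every order, at all regular points of the ball simultaneously. Density provides one such
  point; around it the Taylor series is zero, and the identity theorem fills the ball.\<close>

lemma unique_in_chart:
  assumes c: "(U, \<phi>) \<in> \<A>" and z: "z \<in> \<phi> ` (M \<inter> U)" and r: "r > 0" "ball z r \<subseteq> \<phi> ` U"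
    and F: "holo_on (ball z r) F" "\<And>x. x \<in> \<phi> ` (M \<inter> U) \<Longrightarrow> x \<in> ball z r \<Longrightarrow> F x = 0"
    and x: "x \<in> ball z r"
  shows "F x = 0"
proof -
  let ?R = "reg_points \<A> k M" and ?N = "U \<inter> \<phi> -` ball z r"
  have R: "real_submanifold \<A> k ?R" using reg_CR unfolding CR_submanifold_def by blast
  have RM: "?R \<subseteq> M" by (auto simp: reg_points_def)
  have N: "open ?N" by (rule chart_preimage_open[OF c open_ball])
  have inv: "\<phi> (inv_into U \<phi> w) = w" if "w \<in> ball z r" for w using that r(2) by (simp add: f_inv_into_f subset_iff)
  have zero: "(ddir v ^^ m) F (\<phi> q) = 0" if "q \<in> ?R" "q \<in> ?N" for v m q
    using that
  proof (induction m arbitrary: q)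
    case 0
    then show ?case using F(2) RM by auto
  next
    case (Suc m)
    have "ddir v (\<lambda>w. (ddir v ^^ m) F (\<phi> (inv_into U \<phi> w))) (\<phi> q) = 0"
    proof (rule holomorphic_derivative_zero_generic[OF R reg_generic Suc.prems(1) N Suc.prems(2) _ _ c])
      show "holomorphic_fun \<A> ?N (\<lambda>x. (ddir v ^^ m) F (\<phi> x))"
        by (rule holomorphic_funI[OF c _ holo_on_iter_ddir[OF F(1) open_ball]]) auto
      show "(ddir v ^^ m) F (\<phi> x) = 0" if "x \<in> ?R" "x \<in> ?N" for x using Suc.IH[OF that] .
      show "q \<in> U" using Suc.prems by blast
    qed
    moreover have "frechet_derivative (\<lambda>w. (ddir v ^^ m) F (\<phi> (inv_into U \<phi> w))) (at (\<phi> q))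
        = frechet_derivative ((ddir v ^^ m) F) (at (\<phi> q))"
      by (rule ddir_eq_on_open[OF open_ball, of _ z r]) (use Suc.prems inv in auto)
    ultimately show ?case by simp
  qed
  obtain y where y: "y \<in> M" "y \<in> U" "z = \<phi> y" using z by blast
  have "y \<in> ?N \<inter> closure ?R" using y r(1) reg_dense by auto
  then obtain q where q: "q \<in> ?R" "q \<in> ?N" using open_Int_closure_eq_empty[OF N, of ?R] by blast
  obtain e where e: "e > 0" "ball (\<phi> q) e \<subseteq> ball z r" using q(2) open_ball open_contains_ball by blast
  have "F w = 0" if "w \<in> ball (\<phi> q) e" for w
  proof -
    have "(\<lambda>m. (ddir (w - \<phi> q) ^^ m) F (\<phi> q) / fact m) sums F w"
      by (rule iter_ddir_sums[OF holo_on_subset[OF F(1) e(2)] that])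
    then have "(\<lambda>m. 0) sums F w" by (simp only: zero[OF q] div_0)
    then show ?thesis using sums_unique2 sums_zero by blast
  qed
  then show ?thesis using holo_on_eq_0_ball[OF F(1) _ e(1) _ x, of "\<phi> q"] q(2) by blast
qed

text \<open>A positive count forces some eigenvalue \<open>r \<le> 0\<close> with an eigenvector
  \<open>w \<noteq> 0\<close>, for which the form takes the value \<open>r\<close> times the squared
  length of \<open>w\<close>. For real defining functions \<open>del\<close> vanishes at
  \<open>w\<close> exactly when the differential vanishes at both \<open>w\<close> and
  \<open>\<i> *s w\<close>.\<close>

lemma nonpositive_direction:
  assumes def: "defining_functions \<A> k M q W \<rho>" and q: "q \<in> M" and c: "chart_at \<A> q = (U, \<phi>)" "(U, \<phi>) \<in> \<A>" "q \<in> U"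
  shows "\<exists>w. w \<noteq> 0 \<and>
      (\<forall>j<k. frechet_derivative (\<lambda>z. \<rho> j (inv_into U \<phi> z)) (at (\<phi> q)) w = 0 \<and>
             frechet_derivative (\<lambda>z. \<rho> j (inv_into U \<phi> z)) (at (\<phi> q)) (\<i> *s w) = 0) \<and>
      Re (herm_form (complex_hessian (\<lambda>z. complex_of_real (\<Sum>j<k. c j * \<rho> j (inv_into U \<phi> z))) (\<phi> q)) w w) \<le> 0"
proof -
  let ?H = "hessian_at \<A> q (\<lambda>x. \<Sum>j<k. c j * \<rho> j x)" and ?T = "T10 \<A> k M q"
  have coord: "coord_at \<A> q = \<phi> q" by (simp add: coord_at_def c(1))
  have "1 \<le> num_nonpos_eigenvalues ?H ?T"
    using concave def q unfolding weakly_pseudoconcave_def by blast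
  then have "{r. r \<le> 0 \<and> (\<exists>w\<in>eigenspace_on ?H ?T r. w \<noteq> 0)} \<noteq> {}"
    unfolding num_nonpos_eigenvalues_def by (metis (no_types, lifting) not_one_le_zero sum.empty)
  then obtain r w where rw: "r \<le> 0" "w \<in> eigenspace_on ?H ?T r" "w \<noteq> 0" by blast
  then have w: "w \<in> ?T" "herm_form ?H w w = complex_of_real r * herm_inner w w"
    by (auto simp: eigenspace_on_def)
  have "herm_inner w w = complex_of_real (\<Sum>i\<in>UNIV. (cmod (w $ i))\<^sup>2)"
    unfolding herm_inner_def of_real_sum by (intro sum.cong refl) (simp add: complex_norm_square[symmetric])
  then have "Re (herm_form ?H w w) = r * (\<Sum>i\<in>UNIV. (cmod (w $ i))\<^sup>2)" using w(2) by simp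
  moreover have "(\<Sum>i\<in>UNIV. (cmod (w $ i))\<^sup>2) \<ge> 0" by (intro sum_nonneg) simp
  ultimately have neg: "Re (herm_form ?H w w) \<le> 0" using rw(1) by (simp add: mult_nonpos_nonneg)
  have H: "?H = complex_hessian (\<lambda>z. complex_of_real (\<Sum>j<k. c j * \<rho> j (inv_into U \<phi> z))) (\<phi> q)"
    by (simp only: hessian_at_def coord local_rep_def c(1) fst_conv snd_conv)
  have tan: "frechet_derivative (\<lambda>z. \<rho> j (inv_into U \<phi> z)) (at (\<phi> q)) w = 0 \<and>
      frechet_derivative (\<lambda>z. \<rho> j (inv_into U \<phi> z)) (at (\<phi> q)) (\<i> *s w) = 0" if j: "j < k" for j
  proof -
    let ?\<rho> = "\<lambda>z. \<rho> j (inv_into U \<phi> z)"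
    define D where "D = frechet_derivative ?\<rho> (at (\<phi> q))"
    have "smooth_fun \<A> W (\<rho> j)" "q \<in> W" using def j unfolding defining_functions_def by blast+
    then have "Cinf_on (\<phi> ` (U \<inter> W)) ?\<rho>" "\<phi> q \<in> \<phi> ` (U \<inter> W)" using c(2,3) unfolding smooth_fun_def by blast+
    then have "?\<rho> differentiable (at (\<phi> q))" unfolding Cinf_on_def by (metis Ck_on.simps(2))
    then have D: "(?\<rho> has_derivative D) (at (\<phi> q))" by (simp add: D_def frechet_derivative_works)
    have l: "frechet_derivative (\<lambda>z. complex_of_real (?\<rho> z)) (at (\<phi> q)) = (\<lambda>v. complex_of_real (D v))"
      by (rule frechet_derivative_at[symmetric], rule bounded_linear.has_derivative[OF bounded_linear_of_real D])
    have lin: "linear (\<lambda>v. complex_of_real (D v))"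
      using linear_compose[OF has_derivative_linear[OF D] bounded_linear.linear[OF bounded_linear_of_real]]
      by (simp add: o_def)
    have "del \<A> q (\<rho> j) w = 0" using w(1) def j unfolding T10_def by blast
    moreover have "del \<A> q (\<rho> j) w = (complex_of_real (D w) - \<i> * complex_of_real (D (\<i> *s w))) / 2"
    proof -
      have "del \<A> q (\<rho> j) w = (\<Sum>i\<in>UNIV. w $ i * (complex_of_real (D (axis i 1)) - \<i> * complex_of_real (D (axis i \<i>)))) / 2"
        unfolding del_def sum_divide_distrib dz_def local_rep_def c(1) fst_conv snd_conv coord l
        by (intro sum.cong refl) simp
      then show ?thesis unfolding wirtinger_sum[OF lin] .
    qed
    ultimately have "D w = 0 \<and> D (\<i> *s w) = 0" by (simp add: complex_eq_iff)
    then show ?thesis by (simp add: D_def)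
  qed
  show ?thesis using rw(3) tan neg unfolding H by blast
qed

text \<open>At an interior maximum of the strictly plurisubharmonic function \<open>|s|\<^sup>2 + \<delta> |z - p|\<^sup>2\<close> on the
  submanifold, a nonpositive direction of the Levi form contradicts the second order condition.\<close>

lemma maximum_in_chart:
  assumes c: "(U, \<phi>) \<in> \<A>" and p: "p \<in> \<phi> ` (M \<inter> U)" and \<epsilon>: "0 < \<epsilon>" "cball p \<epsilon> \<subseteq> \<phi> ` U"
    and K: "compact (\<phi> ` (M \<inter> U) \<inter> cball p \<epsilon>)"
    and s: "\<And>z. z \<in> \<phi> ` (M \<inter> U) \<Longrightarrow> z \<in> cball p \<epsilon> \<Longrightarrow> lext (\<phi> ` (M \<inter> U)) s z"
    and C: "\<And>z. z \<in> \<phi> ` (M \<inter> U) \<Longrightarrow> z \<in> sphere p \<epsilon> \<Longrightarrow> cmod (s z) \<le> C"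
  shows "cmod (s p) \<le> C"
proof (rule ccontr)
  assume "\<not> cmod (s p) \<le> C"
  then have big: "C < cmod (s p)" by simp
  let ?A = "\<phi> ` (M \<inter> U)"
  \<comment> \<open>\<open>\<delta>\<close> is so small that the perturbation keeps the values on
    the sphere below the value at \<open>p\<close>: it uses half of the gap. The empty sphere is
    split off because only a point on the sphere shows \<open>C \<ge> 0\<close>.\<close>
  obtain \<delta> :: real where \<delta>: "\<delta> > 0" "\<And>z. z \<in> ?A \<Longrightarrow> z \<in> sphere p \<epsilon> \<Longrightarrow> (cmod (s z))\<^sup>2 + \<delta> * \<epsilon>\<^sup>2 < (cmod (s p))\<^sup>2"
  proof (cases "?A \<inter> sphere p \<epsilon> = {}")
    case True
    show ?thesis
    proof (rule that[of 1])
      show "(cmod (s z))\<^sup>2 + 1 * \<epsilon>\<^sup>2 < (cmod (s p))\<^sup>2" if "z \<in> ?A" "z \<in> sphere p \<epsilon>" for z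
        using True that by blast
    qed simp
  next
    case False
    then have "C \<ge> 0" using C by (meson IntE equals0I norm_ge_zero order_trans)
    then have lt: "C\<^sup>2 < (cmod (s p))\<^sup>2" using big by (simp add: power_strict_mono)
    show ?thesis
    proof (rule that[of "((cmod (s p))\<^sup>2 - C\<^sup>2) / (2 * \<epsilon>\<^sup>2)"])
      show "((cmod (s p))\<^sup>2 - C\<^sup>2) / (2 * \<epsilon>\<^sup>2) > 0" using lt \<epsilon>(1) by simp
      fix z assume "z \<in> ?A" "z \<in> sphere p \<epsilon>"
      then have "(cmod (s z))\<^sup>2 \<le> C\<^sup>2" using C by (simp add: power_mono)
      moreover have "((cmod (s p))\<^sup>2 - C\<^sup>2) / (2 * \<epsilon>\<^sup>2) * \<epsilon>\<^sup>2 = ((cmod (s p))\<^sup>2 - C\<^sup>2) / 2" using \<epsilon>(1) by simp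
      ultimately show "(cmod (s z))\<^sup>2 + ((cmod (s p))\<^sup>2 - C\<^sup>2) / (2 * \<epsilon>\<^sup>2) * \<epsilon>\<^sup>2 < (cmod (s p))\<^sup>2"
        using lt by simp
    qed
  qed
  define f where "f z = (cmod (s z))\<^sup>2 + \<delta> * (norm (z - p))\<^sup>2" for z
  have "continuous_on (?A \<inter> cball p \<epsilon>) f"
    unfolding f_def by (intro continuous_intros lext_continuous[of _ ?A s]) (use s in auto)
  moreover have pK: "p \<in> ?A \<inter> cball p \<epsilon>" using p \<epsilon>(1) by auto
  ultimately obtain z1 where z1: "z1 \<in> ?A \<inter> cball p \<epsilon>" "\<And>z. z \<in> ?A \<inter> cball p \<epsilon> \<Longrightarrow> f z \<le> f z1"
    using continuous_attains_sup[OF K, of f] by blast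
  have "z1 \<notin> sphere p \<epsilon>"
  proof
    assume "z1 \<in> sphere p \<epsilon>"
    then have "f z1 < (cmod (s p))\<^sup>2" using \<delta>(2) z1(1) by (auto simp: f_def dist_norm norm_minus_commute)
    moreover have "f p \<le> f z1" using z1(2) pK by blast
    ultimately show False by (simp add: f_def)
  qed
  then have z1b: "z1 \<in> ball p \<epsilon>" using z1(1) by auto
  obtain r0 where r0: "r0 > 0" "ball z1 r0 \<subseteq> ball p \<epsilon>" using z1b open_ball open_contains_ball by blast
  have "lext ?A s z1" using s z1(1) by blast
  then obtain r F where F: "0 < r" "r \<le> r0" "holo_on (ball z1 r) F" "\<And>x. x \<in> ?A \<Longrightarrow> x \<in> ball z1 r \<Longrightarrow> F x = s x"
    using lext_obtain[OF _ r0(1)] by blast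
  have sub: "ball z1 r \<subseteq> cball p \<epsilon>" using F(2) r0(2) by (meson ball_subset_cball order_trans subset_ball)
  obtain q where q: "q \<in> M" "q \<in> U" "z1 = \<phi> q" using z1(1) by blast
  obtain W \<rho> where def: "defining_functions \<A> k M q W \<rho>" using submanifold q(1) unfolding real_submanifold_def by blast
  obtain V \<psi> where cV: "chart_at \<A> q = (V, \<psi>)" "(V, \<psi>) \<in> \<A>" "q \<in> V" by (rule chart_at)
  \<comment> \<open>The pseudoconcavity condition refers to the chart selected at \<open>q\<close>,
    whereas \<open>s\<close> and the ball live in the chart \<open>\<phi>\<close>; \<open>?T\<close>
    passes from the first to the second.\<close>
  let ?\<rho> = "\<lambda>j z. \<rho> j (inv_into V \<psi> z)" and ?T = "\<lambda>z. \<phi> (inv_into V \<psi> z)"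
  obtain u where d0: "open (\<psi> ` (V \<inter> W))" "\<psi> q \<in> \<psi> ` (V \<inter> W)"
    "\<forall>j<k. Cinf_on (\<psi> ` (V \<inter> W)) (?\<rho> j)" "\<forall>j<k. ?\<rho> j (\<psi> q) = 0"
    "\<forall>i<k. \<forall>j<k. frechet_derivative (?\<rho> i) (at (\<psi> q)) (u j) = (if i = j then 1 else 0)"
    "\<forall>z\<in>\<psi> ` (V \<inter> W). inv_into V \<psi> z \<in> M \<longleftrightarrow> (\<forall>j<k. ?\<rho> j z = 0)"
    by (rule defining_functions_in_chart[OF def q(1) cV]) (rule that; assumption)
  note d = d0[rule_format]
  let ?N = "U \<inter> \<phi> -` ball z1 r"
  let ?B = "\<psi> ` (V \<inter> W) \<inter> \<psi> ` (V \<inter> ?N)"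
  have N: "open ?N" by (rule chart_preimage_open[OF c open_ball])
  have qN: "q \<in> ?N" using q(2,3) F(1) by simp
  have B: "open ?B" "\<psi> q \<in> ?B" using d(1,2) chart_image_open[OF cV(2) N] qN cV(3) by auto
  have Tq: "?T (\<psi> q) = z1" using cV q(3) by simp
  have TB: "?T z \<in> ball z1 r" "inv_into V \<psi> z \<in> U" if "z \<in> ?B" for z
    using that cV(2) by auto
  have smooth: "Cinf_on ?B (?\<rho> j)" if "j < k" for j
  proof -
    have "Ck_on m S f \<Longrightarrow> S' \<subseteq> S \<Longrightarrow> Ck_on m S' f" for m and S S' :: "(complex^'n) set" and f :: "complex^'n \<Rightarrow> real"
      by (induction m arbitrary: f) (auto intro: continuous_on_subset)
    then show ?thesis using d(3)[OF that] unfolding Cinf_on_def by blast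
  qed
  obtain D where D: "(?T has_derivative D) (at (\<psi> q))" "\<And>v. D v = 0 \<Longrightarrow> v = 0"
    using transition_derivative[OF cV(2) c cV(3) q(2)] by metis
  have Tholo: "holo_on ?B (\<lambda>z. ?T z $ i)" for i
    by (rule transition_holo[OF cV(2) c]) auto
  \<comment> \<open>The perturbed function as a sum of squares of holomorphic functions, the form
    that \<open>no_local_maximum\<close> expects; the scaled coordinates make the joint derivative
    injective.\<close>
  define g where "g i z = (case i of None \<Rightarrow> F (?T z) | Some i \<Rightarrow> complex_of_real (sqrt \<delta>) * (?T z $ i - p $ i))" for i z
  have gsum: "(\<Sum>i\<in>UNIV. (cmod (g i z))\<^sup>2) = (cmod (F (?T z)))\<^sup>2 + \<delta> * (norm (?T z - p))\<^sup>2" for z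
  proof -
    have "(\<Sum>i\<in>UNIV. (cmod (g i z))\<^sup>2) = (cmod (g None z))\<^sup>2 + (\<Sum>i\<in>UNIV. (cmod (g (Some i) z))\<^sup>2)"
      by (simp add: UNIV_option_conv sum.reindex)
    also have "(\<Sum>i\<in>UNIV. (cmod (g (Some i) z))\<^sup>2) = \<delta> * (\<Sum>i\<in>UNIV. (cmod ((?T z - p) $ i))\<^sup>2)"
      using \<delta>(1) by (simp add: g_def norm_mult power_mult_distrib sum_distrib_left)
    also have "(\<Sum>i\<in>UNIV. (cmod ((?T z - p) $ i))\<^sup>2) = (norm (?T z - p))\<^sup>2"
      by (simp add: norm_vec_def L2_set_def sum_nonneg)
    finally show ?thesis by (simp add: g_def)
  qed
  show False
  proof (rule no_local_maximum[of ?B "\<psi> q" k ?\<rho> u UNIV g, OF B smooth d(4,5)])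
    show "holo_on ?B (g i)" for i
    proof (cases i)
      case None
      have "holo_on ?B (\<lambda>z. F (?T z))" by (rule holo_on_compose[OF F(3) Tholo]) (use TB(1) in blast)
      then show ?thesis by (simp add: g_def[abs_def] None)
    next
      case (Some i')
      have "holo_on ?B (\<lambda>z. complex_of_real (sqrt \<delta>) * (?T z $ i' - p $ i'))"
        by (intro holo_on_cmult holo_on_diff Tholo holo_on_const)
      then show ?thesis by (simp add: g_def[abs_def] Some)
    qed
    show "w = 0" if w: "\<And>i. i \<in> UNIV \<Longrightarrow> ddir w (g i) (\<psi> q) = 0" for w
    proof (rule D(2))
      show "D w = 0"
        unfolding vec_eq_iff
      proof
        fix i
        have "(g (Some i) has_derivative (\<lambda>v. complex_of_real (sqrt \<delta>) * (D v $ i - 0))) (at (\<psi> q))"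
          unfolding g_def option.case
          by (intro has_derivative_mult_right has_derivative_diff has_derivative_const
              bounded_linear.has_derivative[OF bounded_linear_vec_nth D(1)])
        from frechet_derivative_at[OF this] w[of "Some i"]
        have "complex_of_real (sqrt \<delta>) * (D w $ i) = 0" by (metis UNIV_I diff_zero)
        then show "D w $ i = 0 $ i" using \<delta>(1) by simp
      qed
    qed
    show "(\<Sum>i\<in>UNIV. (cmod (g i z))\<^sup>2) \<le> (\<Sum>i\<in>UNIV. (cmod (g i (\<psi> q)))\<^sup>2)"
      if z: "z \<in> ?B" "\<And>j. j < k \<Longrightarrow> ?\<rho> j z = 0" for z
    proof -
      have "inv_into V \<psi> z \<in> M" using d(6)[of z] z by blast
      then have TA: "?T z \<in> ?A" using TB(2)[OF z(1)] by blast
      have "f (?T z) \<le> f z1" using z1(2) TA TB(1)[OF z(1)] sub by blast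
      moreover have "F (?T z) = s (?T z)" using F(4) TA TB(1)[OF z(1)] by blast
      moreover have "F z1 = s z1" using F(1,4) z1(1) by simp
      ultimately show ?thesis unfolding gsum Tq by (simp add: f_def)
    qed
    show "\<exists>w. w \<noteq> 0 \<and>
        (\<forall>j<k. frechet_derivative (?\<rho> j) (at (\<psi> q)) w = 0 \<and> frechet_derivative (?\<rho> j) (at (\<psi> q)) (\<i> *s w) = 0) \<and>
        Re (herm_form (complex_hessian (\<lambda>z. complex_of_real (\<Sum>j<k. c j * ?\<rho> j z)) (\<psi> q)) w w) \<le> 0" for c
      by (rule nonpositive_direction[OF def q(1) cV])
    show "finite (UNIV :: 'n option set)" by (rule finite_class.finite_UNIV)
  qed
qed

section \<open>Stability of extendibility under limits\<close>

lemma ext_at_subset: "ext_at A f x \<Longrightarrow> B \<subseteq> A \<Longrightarrow> ext_at B f x"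
  unfolding ext_at_def by blast

lemma ext_at_continuous:
  assumes "\<And>x. x \<in> U \<Longrightarrow> ext_at A f x" "U \<subseteq> A" shows "continuous_on U f"
  unfolding continuous_on_eq_continuous_within
proof
  fix x assume x: "x \<in> U"
  obtain W F where W: "open W" "x \<in> W" "holomorphic_fun \<A> W F" "\<And>y. y \<in> W \<Longrightarrow> y \<in> A \<Longrightarrow> F y = f y"
    using assms(1)[OF x] unfolding ext_at_def by blast
  have "isCont F x" using holomorphic_fun_continuous[OF W(3,1)] W(1,2) by (simp add: continuous_on_eq_continuous_at)
  then have "(F \<longlongrightarrow> F x) (at x within U)" unfolding isCont_def by (rule tendsto_within_subset) simp
  moreover have "\<forall>\<^sub>F y in at x within U. F y = f y"
    using W assms(2) unfolding eventually_at_topological by blast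
  ultimately have "(f \<longlongrightarrow> F x) (at x within U)" by (rule Lim_transform_eventually)
  then show "continuous (at x within U) f"
    using W(2,4) x assms(2) by (simp add: continuous_within subset_iff)
qed

text \<open>The extension property is given for \<open>M - E\<close> as a space of its own, so the
  limit must be recognised as LACR there. A limit of extendible functions lies in every class of
  germs that contains the holomorphic ones and is stable under limits, hence in the intersection of
  these classes.\<close>

lemma limit_ext_off_E:
  assumes q: "q \<in> M" "q \<notin> E" and N: "open N" "q \<in> N"
    and t: "\<And>m y. y \<in> M \<Longrightarrow> y \<in> N \<Longrightarrow> ext_at M (t m) y" and lim: "uniform_limit (M \<inter> N) t g sequentially"
  shows "ext_at M g q"
proof -
  have "openin (top_of_set M) (M - E)" using E_closed by (simp add: openin_diff)
  then obtain Ob where Ob: "open Ob" "M - E = M \<inter> Ob" unfolding openin_open by blast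
  let ?U = "M \<inter> (N \<inter> Ob)"
  have U: "?U = (M - E) \<inter> (N \<inter> Ob)" using Ob(2) by blast
  have opU: "openin (top_of_set (M - E)) ?U" unfolding U using N(1) Ob(1) by blast
  have cont: "continuous_on ?U (t m)" for m by (rule ext_at_continuous[where A = M]) (use t in auto)
  have unif: "uniform_limit ?U t g sequentially" by (rule uniform_limit_on_subset[OF lim]) auto
  have contg: "continuous_on ?U g"
    by (rule uniform_limit_theorem[OF _ unif]) (auto intro: always_eventually cont)
  have "germ (M - E) y g \<in> LACR_germs \<A> (M - E)" if y: "y \<in> ?U" for y
    unfolding LACR_germs_def limit_closure_def
  proof (rule InterI)
    fix \<K> assume "\<K> \<in> {\<K>. \<K> \<subseteq> continuous_germs (M - E) \<and> holomorphic_germs \<A> (M - E) \<subseteq> \<K> \<and> limit_germs (M - E) \<K> \<subseteq> \<K>}"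
    then have \<K>: "holomorphic_germs \<A> (M - E) \<subseteq> \<K>" "limit_germs (M - E) \<K> \<subseteq> \<K>" by auto
    have "t m \<in> sections (M - E) \<K> ?U" for m
    proof -
      have "germ (M - E) x (t m) \<in> \<K>" if "x \<in> ?U" for x
      proof -
        have "ext_at M (t m) x" using t that by blast
        then have "ext_at (M - E) (t m) x" by (rule ext_at_subset) blast
        then have "germ (M - E) x (t m) \<in> holomorphic_germs \<A> (M - E)"
          using holomorphic_germ_iff[of "M - E" x "t m"] U that by blast
        then show ?thesis using \<K>(1) by blast
      qed
      then show ?thesis using cont by (simp add: sections_def)
    qed
    moreover have "\<forall>K. compact K \<and> K \<subseteq> ?U \<longrightarrow> uniform_limit K t g sequentially"
      using unif uniform_limit_on_subset by blast
    ultimately have "germ (M - E) y g \<in> limit_germs (M - E) \<K>"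
      unfolding limit_germs_def using opU y contg by blast
    then show "germ (M - E) y g \<in> \<K>" using \<K>(2) by blast
  qed
  then have "g \<in> LACR \<A> (M - E) ?U" unfolding LACR_def sections_def using contg by blast
  moreover have qU: "q \<in> ?U" using q N(2) Ob(2) by blast
  moreover have "holo_extension_at \<A> (M - E) q" using off_E q by blast
  ultimately have "\<exists>W F. open W \<and> q \<in> W \<and> holomorphic_fun \<A> W F \<and> (\<forall>x\<in>W \<inter> ?U. F x = g x)"
    using opU unfolding holo_extension_at_def by meson
  then obtain W F where W: "open W" "q \<in> W" "holomorphic_fun \<A> W F" "\<forall>x\<in>W \<inter> ?U. F x = g x"
    by blast
  have "holomorphic_fun \<A> (W \<inter> (N \<inter> Ob)) F" by (rule holomorphic_fun_subset[OF W(3)]) auto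
  moreover have "open (W \<inter> (N \<inter> Ob))" "q \<in> W \<inter> (N \<inter> Ob)" using W(1,2) N Ob(1) qU by auto
  moreover have "\<forall>x\<in>(W \<inter> (N \<inter> Ob)) \<inter> M. F x = g x" using W(4) by blast
  ultimately show ?thesis unfolding ext_at_def by blast
qed

lemma isolated_nbhd:
  assumes "x \<in> M" obtains N where "open N" "x \<in> N" "N \<inter> E \<subseteq> {x}"
proof (cases "x \<in> E")
  case True
  then show ?thesis using E_discrete that unfolding discrete_def isolated_in_def by blast
next
  case False
  have "openin (top_of_set M) (M - E)" using E_closed by (simp add: openin_diff)
  then obtain Ob where "open Ob" "M - E = M \<inter> Ob" unfolding openin_open by blast
  moreover have "E \<subseteq> M" using E_closed closedin_subset by fastforce
  ultimately show ?thesis using that[of Ob] False assms by blast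
qed

text \<open>Being the intersection of an open set \<open>Q\<close> with a closed set,
  \<open>M\<close> is relatively closed in \<open>Q\<close> and meets compact subsets of
  \<open>Q\<close> in compact sets.\<close>

lemma compact_trace:
  assumes c: "(U, \<phi>) \<in> \<A>" and x: "x \<in> M"
  obtains Q where "open Q" "x \<in> Q"
    "\<And>K. compact K \<Longrightarrow> K \<subseteq> \<phi> ` (U \<inter> Q) \<Longrightarrow> compact (\<phi> ` (M \<inter> U) \<inter> K)"
proof -
  obtain Q C where Q: "open Q" "closed C" "M = Q \<inter> C" using M_closed unfolding locally_closed_def by blast
  have "compact (\<phi> ` (M \<inter> U) \<inter> K)" if K: "compact K" "K \<subseteq> \<phi> ` (U \<inter> Q)" for K
  proof -
    let ?i = "inv_into U \<phi>"
    have iQ: "?i z \<in> U" "?i z \<in> Q" "\<phi> (?i z) = z" if "z \<in> K" for z using K(2) that c by auto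
    have "continuous_on K ?i"
      by (rule continuous_on_subset[OF chart_inv_continuous[OF c]]) (use K(2) in blast)
    then have "closed (K \<inter> ?i -` C)" using continuous_closed_preimage Q(2) compact_imp_closed[OF K(1)] by blast
    moreover have "\<phi> ` (M \<inter> U) \<inter> K = K \<inter> (K \<inter> ?i -` C)"
    proof (intro equalityI subsetI)
      fix z assume z: "z \<in> \<phi> ` (M \<inter> U) \<inter> K"
      then obtain y where "y \<in> M" "y \<in> U" "z = \<phi> y" by blast
      then show "z \<in> K \<inter> (K \<inter> ?i -` C)" using z c Q(3) by auto
    next
      fix z assume z: "z \<in> K \<inter> (K \<inter> ?i -` C)"
      then have "?i z \<in> M \<inter> U" "z = \<phi> (?i z)" using iQ Q(3) by auto
      then show "z \<in> \<phi> ` (M \<inter> U) \<inter> K" using z by blast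
    qed
    ultimately show ?thesis by (metis compact_Int_closed K(1))
  qed
  then show ?thesis using that[of Q] Q x by blast
qed

text \<open>An instance of \<open>removable_point\<close> in a chart around \<open>x\<close>, on a
  ball so small that it contains no point of \<open>E\<close> except possibly \<open>x\<close>, that
  it lies in \<open>N\<close>, and that the trace of \<open>M\<close> on closed balls is compact. It
  makes no difference whether \<open>x\<close> belongs to \<open>E\<close>.\<close>

theorem limit_ext:
  assumes x: "x \<in> M" and N: "open N" "x \<in> N"
    and s: "\<And>m y. y \<in> M \<Longrightarrow> y \<in> N \<Longrightarrow> ext_at M (s m) y"
    and lim: "\<And>K. compact K \<Longrightarrow> K \<subseteq> M \<inter> N \<Longrightarrow> uniform_limit K s f sequentially"
  shows "ext_at M f x"
proof -
  obtain U \<phi> where c: "(U, \<phi>) \<in> \<A>" "x \<in> U" by (rule chart_exists)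
  obtain Q where Q: "open Q" "x \<in> Q" "\<And>K. compact K \<Longrightarrow> K \<subseteq> \<phi> ` (U \<inter> Q) \<Longrightarrow> compact (\<phi> ` (M \<inter> U) \<inter> K)"
    using compact_trace[OF c(1) x] by blast
  obtain N' where N': "open N'" "x \<in> N'" "N' \<inter> E \<subseteq> {x}" using isolated_nbhd[OF x] by blast
  let ?Q = "Q \<inter> N \<inter> N'" and ?A = "\<phi> ` (M \<inter> U)" and ?p = "\<phi> x" and ?i = "inv_into U \<phi>"
  have "open ?Q" "x \<in> ?Q" using Q(1,2) N N'(1,2) by auto
  then have "open (\<phi> ` (U \<inter> ?Q))" "?p \<in> \<phi> ` (U \<inter> ?Q)" using chart_image_open[OF c(1)] c(2) by auto
  then obtain R where R: "R > 0" "cball ?p R \<subseteq> \<phi> ` (U \<inter> ?Q)" using open_contains_cball by blast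
  have RU: "cball ?p R \<subseteq> \<phi> ` U" using R(2) by blast
  have iQ: "?i z \<in> U" "?i z \<in> ?Q" "\<phi> (?i z) = z" if "z \<in> cball ?p R" for z
    using R(2) that c(1) by auto
  have iM: "?i z \<in> M" "?i z \<in> U" if "z \<in> ?A" for z using that c(1) by auto
  have comp: "compact (?A \<inter> cball ?p e)" if "e \<le> R" for e
  proof (rule Q(3)[OF compact_cball])
    have "cball ?p e \<subseteq> cball ?p R" using that by auto
    then show "cball ?p e \<subseteq> \<phi> ` (U \<inter> Q)" using R(2) by blast
  qed
  interpret removable_point ?A ?p R
  proof
    show "F w = 0" if "z \<in> ?A" "r > 0" "ball z r \<subseteq> ball ?p R" "holo_on (ball z r) F"
      "\<And>x. x \<in> ?A \<Longrightarrow> x \<in> ball z r \<Longrightarrow> F x = 0" "w \<in> ball z r" for z r F w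
    proof (rule unique_in_chart[OF c(1) that(1,2) _ that(4,5,6)])
      have "ball ?p R \<subseteq> cball ?p R" by (rule ball_subset_cball)
      then show "ball z r \<subseteq> \<phi> ` U" using that(3) RU by blast
    qed
    show "R > 0" by fact
    show "?p \<in> ?A" using x c(2) by blast
    show "compact (?A \<inter> cball ?p e)" if "0 < e" "e < R" for e using comp that by simp
    show "cmod (s ?p) \<le> B" if "0 < e" "e < R" "\<And>z. z \<in> ?A \<Longrightarrow> z \<in> cball ?p e \<Longrightarrow> lext ?A s z"
      "\<And>z. z \<in> ?A \<Longrightarrow> z \<in> sphere ?p e \<Longrightarrow> cmod (s z) \<le> B" for e s B
    proof (rule maximum_in_chart[OF c(1) _ that(1) _ _ that(3,4)])
      show "?p \<in> ?A" using x c(2) by blast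
      have "cball ?p e \<subseteq> cball ?p R" using that(2) by auto
      then show "cball ?p e \<subseteq> \<phi> ` U" using RU by blast
      show "compact (?A \<inter> cball ?p e)" using comp that(2) by simp
    qed
    show "lext ?A g q" if q: "q \<in> ?A" "q \<in> ball ?p R" "q \<noteq> ?p" and \<delta>: "\<delta> > 0"
      and t: "\<And>m z. z \<in> ?A \<Longrightarrow> z \<in> ball q \<delta> \<Longrightarrow> lext ?A (t m) z"
      and l: "uniform_limit (?A \<inter> ball q \<delta>) t g sequentially" for q t g \<delta>
    proof -
      let ?N = "U \<inter> \<phi> -` ball q \<delta>"
      have qc: "q \<in> cball ?p R" using q(2) by auto
      have "ext_at M (\<lambda>y. g (\<phi> y)) (?i q)"
      proof (rule limit_ext_off_E)
        show "?i q \<in> M" using iM q(1) by blast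
        show "?i q \<notin> E"
        proof
          assume "?i q \<in> E"
          then have "?i q = x" using iQ(2)[OF qc] N'(3) by blast
          then show False using iQ(3)[OF qc] q(3) by simp
        qed
        show "open ?N" by (rule chart_preimage_open[OF c(1) open_ball])
        show "?i q \<in> ?N" using iQ[OF qc] \<delta> by simp
        show "ext_at M (\<lambda>y. t m (\<phi> y)) y" if "y \<in> M" "y \<in> ?N" for m y
          using ext_at_chart_iff[OF c(1), of y M "t m"] t[of "\<phi> y" m] that by blast
        show "uniform_limit (M \<inter> ?N) (\<lambda>m y. t m (\<phi> y)) (\<lambda>y. g (\<phi> y)) sequentially"
          by (rule uniform_limit_compose'[OF l]) auto
      qed
      then show ?thesis using ext_at_chart_iff[OF c(1) iQ(1)[OF qc]] iQ(3)[OF qc] by simp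
    qed
    show "\<exists>B. open B \<and> ?p \<in> B \<and> B \<subseteq> ball ?p r \<and> connected (?A \<inter> B)" if r: "r > 0" for r
    proof -
      let ?N = "U \<inter> \<phi> -` ball ?p r"
      have "open ?N" by (rule chart_preimage_open[OF c(1) open_ball])
      moreover have "x \<in> ?N" using c(2) r by simp
      ultimately obtain B where B: "open B" "x \<in> B" "B \<subseteq> ?N" "connected (M \<inter> B)"
        using submanifold_locally_connected[OF submanifold x] by blast
      have "?A \<inter> \<phi> ` (U \<inter> B) = \<phi> ` (M \<inter> B)"
      proof (intro equalityI subsetI)
        fix z assume "z \<in> ?A \<inter> \<phi> ` (U \<inter> B)"
        then obtain y y' where y: "y \<in> M" "y \<in> U" "z = \<phi> y" "y' \<in> U" "y' \<in> B" "z = \<phi> y'" by blast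
        then have "y = y'" using chart_inj[OF c(1)] by (auto dest: inj_onD)
        then show "z \<in> \<phi> ` (M \<inter> B)" using y by blast
      qed (use B(3) in auto)
      moreover have "connected (\<phi> ` (M \<inter> B))"
        by (rule connected_continuous_image[OF continuous_on_subset[OF chart_continuous[OF c(1)]] B(4)])
           (use B(3) in auto)
      ultimately have "connected (?A \<inter> \<phi> ` (U \<inter> B))" by simp
      then show ?thesis
        using chart_image_open[OF c(1) B(1)] c(2) B(2,3) by (intro exI[of _ "\<phi> ` (U \<inter> B)"]) auto
    qed
  qed
  have "lext ?A (\<lambda>z. f (?i z)) ?p"
  proof (rule limit_extends)
    show "sec (\<lambda>z. s m (?i z))" for m
      unfolding sec_def
    proof
      fix z assume z: "z \<in> ?A \<inter> ball ?p R"
      then have zc: "z \<in> cball ?p R" by auto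
      have "ext_at M (s m) (?i z)" using s iM(1) iQ(2)[OF zc] z by blast
      then show "lext ?A (\<lambda>z. s m (?i z)) z" using ext_at_iff_lext[OF c(1) iQ(1)[OF zc]] iQ(3)[OF zc] by simp
    qed
    have "compact (?i ` (?A \<inter> cball ?p R))"
      by (rule compact_continuous_image[OF continuous_on_subset[OF chart_inv_continuous[OF c(1)]] comp]) auto
    moreover have "?i ` (?A \<inter> cball ?p R) \<subseteq> M \<inter> N" using iM(1) iQ(2) by blast
    ultimately have "uniform_limit (?i ` (?A \<inter> cball ?p R)) s f sequentially" by (rule lim)
    then show "uniform_limit (?A \<inter> ball ?p R) (\<lambda>m z. s m (?i z)) (\<lambda>z. f (?i z)) sequentially"
      by (rule uniform_limit_compose') auto
  qed
  then show ?thesis using ext_at_iff_lext[OF c] by simp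
qed

end

section \<open>Gluing\<close>

context complex_manifold
begin

lemma holomorphic_fun_local:
  assumes "\<And>x. x \<in> W \<Longrightarrow> \<exists>N G. open N \<and> x \<in> N \<and> holomorphic_fun \<A> N G \<and> (\<forall>y\<in>N. F y = G y)"
  shows "holomorphic_fun \<A> W F"
  unfolding holomorphic_fun_def
proof clarify
  fix U \<phi> assume c: "(U, \<phi>) \<in> \<A>"
  show "holo_on (\<phi> ` (U \<inter> W)) (\<lambda>z. F (inv_into U \<phi> z))"
  proof (rule holo_on_local)
    fix z assume "z \<in> \<phi> ` (U \<inter> W)"
    then obtain x where x: "x \<in> U" "x \<in> W" "z = \<phi> x" by blast
    obtain N G where N: "open N" "x \<in> N" "holomorphic_fun \<A> N G" "\<And>y. y \<in> N \<Longrightarrow> F y = G y"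
      using assms[OF x(2)] by blast
    have "holo_on (\<phi> ` (U \<inter> N)) (\<lambda>z. F (inv_into U \<phi> z))"
    proof (rule holo_on_cong[OF holomorphic_fun_chart[OF N(3) c] chart_image_open[OF c N(1)]])
      show "F (inv_into U \<phi> w) = G (inv_into U \<phi> w)" if "w \<in> \<phi> ` (U \<inter> N)" for w
        using that N(4) c by auto
    qed
    moreover have "z \<in> \<phi> ` (U \<inter> N)" using x N(2) by blast
    ultimately show "\<exists>T. z \<in> T \<and> holo_on T (\<lambda>z. F (inv_into U \<phi> z))" by (intro exI conjI)
  qed
qed

text \<open>Continuity of the extension by zero is the Hausdorff property at work: the preimage of
  the closed coordinate ball is compact, hence closed, and its complement together with the chart
  domain covers the manifold by open sets.\<close>

lemma bump_function:
  assumes N: "open N" "x \<in> N"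
  obtains h :: "'x \<Rightarrow> real" and V where "continuous_on UNIV h" "open V" "x \<in> V"
    "\<And>y. y \<in> V \<Longrightarrow> h y = 1" "\<And>y. y \<notin> N \<Longrightarrow> h y = 0"
proof -
  obtain U \<phi> where c: "(U, \<phi>) \<in> \<A>" "x \<in> U" by (rule chart_exists)
  have "open (\<phi> ` (U \<inter> N))" "\<phi> x \<in> \<phi> ` (U \<inter> N)" using chart_image_open[OF c(1) N(1)] c(2) N(2) by auto
  then obtain r where r: "r > 0" "cball (\<phi> x) r \<subseteq> \<phi> ` (U \<inter> N)" using open_contains_cball by blast
  \<comment> \<open>Equal to 1 up to distance \<open>r/2\<close> from the centre and to 0 from
    distance \<open>r\<close> on.\<close>
  define b where "b y = max 0 (min 1 (2 - 2 / r * dist (\<phi> x) (\<phi> y)))" for y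
  define h where "h y = (if y \<in> U then b y else 0)" for y
  define K where "K = inv_into U \<phi> ` cball (\<phi> x) r"
  have "compact K"
    unfolding K_def
    by (rule compact_continuous_image[OF continuous_on_subset[OF chart_inv_continuous[OF c(1)]] compact_cball])
       (use r(2) in blast)
  then have K: "closed K" by (rule compact_imp_closed)
  have b0: "b y = 0" if "dist (\<phi> x) (\<phi> y) \<ge> r" for y
    using that r(1) by (simp add: b_def max_def min_def field_simps)
  have h0: "h y = 0" if "y \<notin> K" for y
  proof (cases "y \<in> U \<and> dist (\<phi> x) (\<phi> y) \<le> r")
    case True
    then have "y \<in> K" unfolding K_def using c(1) by (intro image_eqI[of _ _ "\<phi> y"]) auto
    then show ?thesis using that by simp
  next
    case False
    then show ?thesis using b0[of y] by (auto simp: h_def)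
  qed
  have in_N: "y \<in> N" if "y \<in> U" "dist (\<phi> x) (\<phi> y) \<le> r" for y
  proof -
    have "\<phi> y \<in> \<phi> ` (U \<inter> N)" using that(2) r(2) by auto
    then show ?thesis using that(1) chart_inj[OF c(1)] by (auto dest: inj_onD)
  qed
  have "K \<subseteq> U" unfolding K_def using r(2) c(1) by auto
  have "continuous_on U b"
    unfolding b_def by (intro continuous_intros chart_continuous[OF c(1)])
  then have hU: "continuous_on U h" by (rule continuous_on_eq) (simp add: h_def)
  have hK: "continuous_on (- K) h" by (rule continuous_on_eq[OF continuous_on_const[of _ 0]]) (simp add: h0)
  have "continuous_on (U \<union> - K) h"
    by (rule continuous_on_open_Un[OF chart_open[OF c(1)] _ hU hK]) (use K in \<open>simp add: open_closed\<close>)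
  moreover have "U \<union> - K = UNIV" using \<open>K \<subseteq> U\<close> by blast
  ultimately have cont: "continuous_on UNIV h" by simp
  show ?thesis
  proof (rule that[OF cont, of "U \<inter> \<phi> -` ball (\<phi> x) (r/2)"])
    show "open (U \<inter> \<phi> -` ball (\<phi> x) (r/2))" by (rule chart_preimage_open[OF c(1) open_ball])
    show "x \<in> U \<inter> \<phi> -` ball (\<phi> x) (r/2)" using c(2) r(1) by simp
    show "h y = 1" if "y \<in> U \<inter> \<phi> -` ball (\<phi> x) (r/2)" for y
      using that r(1) by (simp add: h_def b_def max_def min_def field_simps)
    show "h y = 0" if "y \<notin> N" for y
      using in_N[of y] that b0[of y] by (cases "dist (\<phi> x) (\<phi> y) \<le> r") (auto simp: h_def)
  qed
qed

text \<open>A countable family of bump functions embeds the manifold into the metric space of real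
  sequences; the metric serves to shrink neighbourhoods uniformly when extensions are glued.\<close>

lemma separating_map:
  obtains \<Phi> :: "'x \<Rightarrow> nat \<Rightarrow> real" where "continuous_on UNIV \<Phi>"
    "\<And>x N. open N \<Longrightarrow> x \<in> N \<Longrightarrow> \<exists>e>0. \<forall>y. dist (\<Phi> x) (\<Phi> y) < e \<longrightarrow> y \<in> N"
proof -
  obtain \<B> :: "'x set set" where \<B>: "countable \<B>" "topological_basis \<B>" using ex_countable_basis by blast
  \<comment> \<open>Pairs of basic open sets instead of points with neighbourhoods keep the family
    of bump functions countable.\<close>
  define P where "P = {(B, B'). B \<in> \<B> \<and> B' \<in> \<B> \<and>
     (\<exists>h :: 'x \<Rightarrow> real. continuous_on UNIV h \<and> (\<forall>y\<in>B. h y = 1) \<and> (\<forall>y. y \<notin> B' \<longrightarrow> h y = 0))}"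
  have "countable P" by (rule countable_subset[of _ "\<B> \<times> \<B>"]) (use \<B>(1) in \<open>auto simp: P_def\<close>)
  have pairs: "\<exists>B B'. (B, B') \<in> P \<and> x \<in> B \<and> B' \<subseteq> N" if N: "open N" "x \<in> N" for x N
  proof -
    obtain B' where B': "B' \<in> \<B>" "x \<in> B'" "B' \<subseteq> N" using topological_basisE[OF \<B>(2) N] by blast
    obtain h :: "'x \<Rightarrow> real" and V where h: "continuous_on UNIV h" "open V" "x \<in> V"
      "\<And>y. y \<in> V \<Longrightarrow> h y = 1" "\<And>y. y \<notin> B' \<Longrightarrow> h y = 0"
      using bump_function[OF topological_basis_open[OF \<B>(2) B'(1)] B'(2)] by blast
    obtain B where B: "B \<in> \<B>" "x \<in> B" "B \<subseteq> V" using topological_basisE[OF \<B>(2) h(2,3)] by blast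
    have "(B, B') \<in> P" unfolding P_def using B B'(1) h(1,4,5) by blast
    then show ?thesis using B(2) B'(3) by blast
  qed
  then have "P \<noteq> {}" using open_UNIV by blast
  have "\<exists>h :: 'x \<Rightarrow> real. continuous_on UNIV h \<and> (\<forall>y\<in>fst p. h y = 1) \<and> (\<forall>y. y \<notin> snd p \<longrightarrow> h y = 0)"
    if "p \<in> P" for p using that by (auto simp: P_def)
  then obtain h :: "'x set \<times> 'x set \<Rightarrow> 'x \<Rightarrow> real" where h: "\<And>p. p \<in> P \<Longrightarrow> continuous_on UNIV (h p)"
    "\<And>p y. p \<in> P \<Longrightarrow> y \<in> fst p \<Longrightarrow> h p y = 1" "\<And>p y. p \<in> P \<Longrightarrow> y \<notin> snd p \<Longrightarrow> h p y = 0" by metis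
  define \<Phi> where "\<Phi> x i = h (from_nat_into P i) x" for x i
  show ?thesis
  proof
    show "continuous_on UNIV \<Phi>"
    proof (rule continuous_on_coordinatewise_then_product)
      show "continuous_on UNIV (\<lambda>x. \<Phi> x i)" for i
        unfolding \<Phi>_def using h(1) from_nat_into[OF \<open>P \<noteq> {}\<close>] by blast
    qed
    fix x N assume N: "open N" "(x :: 'x) \<in> N"
    obtain B B' where B: "(B, B') \<in> P" "x \<in> B" "B' \<subseteq> N" using pairs[OF N] by blast
    obtain i where i: "from_nat_into P i = (B, B')"
      using from_nat_into_surj[OF \<open>countable P\<close> B(1)] by blast
    \<comment> \<open>The coordinate that belongs to \<open>(B, B')\<close> equals 1 at
      \<open>x\<close> and is positive only on \<open>B'\<close>; its positivity is an open
      condition in the product topology, hence holds on a metric ball.\<close>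
    have "open ((\<lambda>f :: nat \<Rightarrow> real. f i) -` {0<..})"
      by (rule open_vimage[OF open_greaterThan continuous_on_product_coordinates])
    moreover have "\<Phi> x \<in> (\<lambda>f. f i) -` {0<..}" using h(2)[OF B(1)] B(2) by (simp add: \<Phi>_def i)
    ultimately obtain e where e: "e > 0" "ball (\<Phi> x) e \<subseteq> (\<lambda>f. f i) -` {0<..}"
      using open_contains_ball by blast
    have "y \<in> N" if "dist (\<Phi> x) (\<Phi> y) < e" for y
    proof -
      have "\<Phi> y i > 0" using e(2) that by auto
      then have "y \<in> B'" using h(3)[OF B(1), of y] by (auto simp: \<Phi>_def i)
      then show ?thesis using B(3) by blast
    qed
    then show "\<exists>e>0. \<forall>y. dist (\<Phi> x) (\<Phi> y) < e \<longrightarrow> y \<in> N" using e(1) by blast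
  qed
qed

end

context pseudoconcave_submanifold
begin

text \<open>By \<open>limit_ext\<close> the holomorphic germs are themselves stable under limits, so
  they form one of the classes whose intersection defines the LACR germs.\<close>

lemma LACR_germs_eq: "LACR_germs \<A> M = holomorphic_germs \<A> M"
proof
  show "holomorphic_germs \<A> M \<subseteq> LACR_germs \<A> M"
    unfolding LACR_germs_def limit_closure_def by blast
  have "holomorphic_germs \<A> M \<subseteq> continuous_germs M"
  proof
    fix \<gamma> assume "\<gamma> \<in> holomorphic_germs \<A> M"
    then obtain x F W where F: "\<gamma> = germ M x F" "x \<in> M" "open W" "x \<in> W" "holomorphic_fun \<A> W F"
      unfolding holomorphic_germs_def by blast
    have "openin (top_of_set M) (M \<inter> W)" "x \<in> M \<inter> W" "continuous_on (M \<inter> W) F"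
      using F(2,3,4) continuous_on_subset[OF holomorphic_fun_continuous[OF F(5,3)]] by auto
    then show "\<gamma> \<in> continuous_germs M" unfolding continuous_germs_def F(1) by blast
  qed
  moreover have "limit_germs M (holomorphic_germs \<A> M) \<subseteq> holomorphic_germs \<A> M"
  proof
    fix \<gamma> assume "\<gamma> \<in> limit_germs M (holomorphic_germs \<A> M)"
    then obtain x f U s where f: "\<gamma> = germ M x f" "openin (top_of_set M) U" "x \<in> U"
      "\<forall>m::nat. s m \<in> sections M (holomorphic_germs \<A> M) U"
      "\<forall>K. compact K \<and> K \<subseteq> U \<longrightarrow> uniform_limit K s f sequentially"
      unfolding limit_germs_def mem_Collect_eq by (elim exE conjE)
    obtain N where N: "open N" "U = M \<inter> N" using f(2) unfolding openin_open by blast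
    have "ext_at M f x"
    proof (rule limit_ext[OF _ N(1)])
      show "x \<in> M" "x \<in> N" using f(3) N(2) by auto
      show "ext_at M (s m) y" if "y \<in> M" "y \<in> N" for m y
        using f(4) that N(2) holomorphic_germ_iff[of M y "s m"] by (simp add: sections_def)
      show "uniform_limit K s f sequentially" if "compact K" "K \<subseteq> M \<inter> N" for K
        using f(5) that N(2) by simp
    qed
    then show "\<gamma> \<in> holomorphic_germs \<A> M" using f(1,3) N(2) holomorphic_germ_iff by simp
  qed
  ultimately show "LACR_germs \<A> M \<subseteq> holomorphic_germs \<A> M"
    unfolding LACR_germs_def limit_closure_def by blast
qed

lemma LACR_ext_at: "f \<in> LACR \<A> M U \<Longrightarrow> x \<in> U \<Longrightarrow> ext_at M f x"
  unfolding LACR_def sections_def LACR_germs_eq using holomorphic_germ_iff by blast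

lemma LACR_smooth:
  assumes U: "openin (top_of_set M) U" and f: "f \<in> LACR \<A> M U"
  shows "smooth_on_subset \<A> U f"
  unfolding smooth_on_subset_def
proof
  fix p assume "p \<in> U"
  then obtain W F where W: "open W" "p \<in> W" "holomorphic_fun \<A> W F" "\<forall>y\<in>W \<inter> M. F y = f y"
    using LACR_ext_at[OF f] unfolding ext_at_def by blast
  moreover have "U \<subseteq> M" using openin_imp_subset[OF U] .
  ultimately show "\<exists>W F. open W \<and> p \<in> W \<and> smooth_fun \<A> W F \<and> (\<forall>x\<in>W \<inter> U. F x = f x)"
    using holomorphic_fun_smooth[OF W(3,1)] by blast
qed

text \<open>If \<open>f\<^sub>m\<close> did not extend to the ball of radius \<open>1/(m+1)\<close>, then small multiples of the \<open>f\<^sub>m\<close>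
  would contradict \<open>uniform_extension\<close>.\<close>

lemma common_extension_domain:
  assumes x: "x \<in> M" and N: "open N" "x \<in> N"
  obtains W where "open W" "x \<in> W" "\<forall>f. (\<forall>y\<in>M \<inter> N. ext_at M f y) \<longrightarrow>
     (\<exists>F. holomorphic_fun \<A> W F \<and> (\<forall>y\<in>W \<inter> M. F y = f y))"
proof (rule ccontr)
  assume neg: "\<not> thesis"
  obtain U \<phi> where c: "(U, \<phi>) \<in> \<A>" "x \<in> U" by (rule chart_exists)
  let ?A = "\<phi> ` (M \<inter> U)" and ?p = "\<phi> x" and ?i = "inv_into U \<phi>"
  let ?W = "\<lambda>m. U \<inter> \<phi> -` ball ?p (1 / real (Suc m))"
  have "\<exists>f. (\<forall>y\<in>M \<inter> N. ext_at M f y) \<and> (\<nexists>F. holomorphic_fun \<A> (?W m) F \<and> (\<forall>y\<in>?W m \<inter> M. F y = f y))" for m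
  proof (rule ccontr)
    assume "\<not> ?thesis"
    then have "\<forall>f. (\<forall>y\<in>M \<inter> N. ext_at M f y) \<longrightarrow>
        (\<exists>F. holomorphic_fun \<A> (?W m) F \<and> (\<forall>y\<in>?W m \<inter> M. F y = f y))" by blast
    moreover have "open (?W m)" by (rule chart_preimage_open[OF c(1) open_ball])
    moreover have "x \<in> ?W m" using c(2) by simp
    ultimately have thesis by (intro that)
    with neg show False ..
  qed
  then obtain f where f: "\<And>m y. y \<in> M \<Longrightarrow> y \<in> N \<Longrightarrow> ext_at M (f m) y"
    "\<And>m. \<nexists>F. holomorphic_fun \<A> (?W m) F \<and> (\<forall>y\<in>?W m \<inter> M. F y = f m y)"
    by (metis IntI)
  obtain Q where Q: "open Q" "x \<in> Q" "\<And>K. compact K \<Longrightarrow> K \<subseteq> \<phi> ` (U \<inter> Q) \<Longrightarrow> compact (?A \<inter> K)"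
    using compact_trace[OF c(1) x] by blast
  have "open (\<phi> ` (U \<inter> (Q \<inter> N)))" "?p \<in> \<phi> ` (U \<inter> (Q \<inter> N))"
    using chart_image_open[OF c(1) open_Int[OF Q(1) N(1)]] c(2) Q(2) N(2) by auto
  then obtain R where R: "R > 0" "cball ?p R \<subseteq> \<phi> ` (U \<inter> (Q \<inter> N))" using open_contains_cball by blast
  have comp: "compact (?A \<inter> cball ?p R)" by (rule Q(3)[OF compact_cball]) (use R(2) in blast)
  have iM: "?i z \<in> M" "?i z \<in> N" "?i z \<in> U" "\<phi> (?i z) = z" if "z \<in> ?A" "z \<in> cball ?p R" for z
  proof -
    show "?i z \<in> M" "?i z \<in> U" "\<phi> (?i z) = z" using that(1) c(1) by auto
    have "z \<in> \<phi> ` (U \<inter> (Q \<inter> N))" using that(2) R(2) by blast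
    then show "?i z \<in> N" using c(1) by auto
  qed
  have lext_f: "lext ?A (\<lambda>z. f m (?i z)) z" if z: "z \<in> ?A" "z \<in> cball ?p R" for m z
    using ext_at_iff_lext[OF c(1) iM(3)[OF z], of M "f m"] f(1)[OF iM(1,2)[OF z], of m] iM(4)[OF z] by simp
  have "\<exists>B\<ge>0. \<forall>z\<in>?A \<inter> cball ?p R. cmod (f m (?i z)) \<le> B" for m
  proof -
    have "continuous_on (?A \<inter> cball ?p R) (\<lambda>z. f m (?i z))"
      by (rule lext_continuous[where A = ?A]) (use lext_f in auto)
    from compact_imp_bounded[OF compact_continuous_image[OF this comp]]
    obtain B where "\<And>z. z \<in> ?A \<inter> cball ?p R \<Longrightarrow> cmod (f m (?i z)) \<le> B" unfolding bounded_iff by blast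
    then show ?thesis by (intro exI[of _ "max B 0"]) (simp add: le_max_iff_disj)
  qed
  then obtain B where B: "\<And>m. B m \<ge> 0" "\<And>m z. z \<in> ?A \<Longrightarrow> z \<in> cball ?p R \<Longrightarrow> cmod (f m (?i z)) \<le> B m"
    by (metis IntI)
  \<comment> \<open>Normalisation to size \<open>(1/2)^m\<close>; the summand 1 keeps the divisor
    positive when \<open>B m = 0\<close>.\<close>
  define c' where "c' m = complex_of_real ((1/2) ^ m / (B m + 1))" for m
  have B1: "B m + 1 > 0" for m using B(1)[of m] by simp
  have c'0: "c' m \<noteq> 0" for m using B1[of m] unfolding c'_def of_real_eq_0_iff by simp
  define t where "t m z = c' m * f m (?i z)" for m z
  have bt: "cmod (t m z) \<le> (1/2) ^ m" if "z \<in> ?A" "z \<in> cball ?p R" for m z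
  proof -
    have "cmod (t m z) = (1/2) ^ m * (cmod (f m (?i z)) / (B m + 1))"
      using B1[of m] by (simp only: t_def c'_def norm_mult norm_of_real abs_of_pos divide_pos_pos zero_less_power) simp
    also have "\<dots> \<le> (1/2) ^ m * 1"
    proof (rule mult_left_mono)
      have "cmod (f m (?i z)) \<le> B m + 1" using B(2)[OF that, of m] by simp
      then show "cmod (f m (?i z)) / (B m + 1) \<le> 1" using B1[of m] by simp
    qed simp
    finally show ?thesis by simp
  qed
  have lt: "lext ?A (t m) z" if "z \<in> ?A" "z \<in> cball ?p R" for m z
    using lext_cmult[OF lext_f[OF that, of m], of "c' m"] by (simp add: t_def[abs_def])
  \<comment> \<open>What the extension property gave off \<open>E\<close> only is now available at
    \<open>x\<close> itself, because \<open>limit_ext\<close> holds at all points of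
    \<open>M\<close>.\<close>
  have ext: "lext ?A (\<lambda>z. \<Sum>j. if a j then t j z else 0) ?p" for a :: "nat \<Rightarrow> bool"
  proof -
    let ?N = "U \<inter> \<phi> -` ball ?p R"
    have "ext_at M (\<lambda>y. \<Sum>j. if a j then t j (\<phi> y) else 0) x"
    proof (rule limit_ext[OF x, of ?N "\<lambda>n y. \<Sum>j<n. if a j then t j (\<phi> y) else 0"])
      show "open ?N" by (rule chart_preimage_open[OF c(1) open_ball])
      show "x \<in> ?N" using c(2) R(1) by simp
      show "ext_at M (\<lambda>y. \<Sum>j<n. if a j then t j (\<phi> y) else 0) y" if y: "y \<in> M" "y \<in> ?N" for n y
      proof -
        have "lext ?A (\<lambda>z. \<Sum>j<n. if a j then t j z else 0) (\<phi> y)"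
        proof (rule lext_sum)
          show "lext ?A (\<lambda>z. if a j then t j z else 0) (\<phi> y)" for j
            using lt[of "\<phi> y" j] y lext_const by (cases "a j") auto
        qed
        then show ?thesis
          using ext_at_chart_iff[OF c(1), of y M "\<lambda>z. \<Sum>j<n. if a j then t j z else 0"] y by blast
      qed
      fix K assume K: "compact K" "K \<subseteq> M \<inter> ?N"
      show "uniform_limit K (\<lambda>n y. \<Sum>j<n. if a j then t j (\<phi> y) else 0)
          (\<lambda>y. \<Sum>j. if a j then t j (\<phi> y) else 0) sequentially"
      proof (rule Weierstrass_m_test)
        show "cmod (if a j then t j (\<phi> y) else 0) \<le> (1/2) ^ j" if "y \<in> K" for j y
        proof -
          have "y \<in> M \<inter> ?N" using K(2) that by blast
          then have "\<phi> y \<in> ?A" "\<phi> y \<in> cball ?p R" by auto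
          then show ?thesis using bt[of "\<phi> y" j] by simp
        qed
      qed (simp add: summable_geometric)
    qed
    then show ?thesis
      using ext_at_chart_iff[OF c, of M "\<lambda>z. \<Sum>j. if a j then t j z else 0"] by blast
  qed
  have bt': "cmod (t j z) \<le> (1/2) ^ j" if "z \<in> ?A" "z \<in> ball ?p R" for j z using bt that by simp
  obtain r C n where r: "r > 0" "\<forall>j\<ge>n. \<exists>F. holo_on (ball ?p r) F \<and>
     (\<forall>z\<in>ball ?p r. cmod (F z) \<le> C) \<and> (\<forall>z\<in>?A \<inter> ball ?p r. F z = t j z)"
    by (rule uniform_extension[of R ?A ?p t, OF R(1) bt' ext]; (assumption | rule that; assumption))
  obtain j0 :: nat where j0: "1 / real (Suc j0) < r" using nat_approx_posE[OF r(1)] by blast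
  \<comment> \<open>From \<open>n\<close> on the functions \<open>t j\<close> extend to the common
    ball, and from \<open>j0\<close> on the ball of radius \<open>1 / real (Suc j)\<close> lies
    inside it; this index therefore contradicts the choice of \<open>f j\<close>.\<close>
  define j where "j = max n j0"
  have "1 / real (Suc j) \<le> 1 / real (Suc j0)" by (rule frac_le) (auto simp: j_def)
  then have sub: "ball ?p (1 / real (Suc j)) \<subseteq> ball ?p r" using j0 by auto
  have "n \<le> j" by (simp add: j_def)
  then obtain F where F: "holo_on (ball ?p r) F" "\<And>z. z \<in> ?A \<Longrightarrow> z \<in> ball ?p r \<Longrightarrow> F z = t j z"
    using r(2) by blast
  have "holomorphic_fun \<A> (?W j) (\<lambda>y. (1 / c' j) * F (\<phi> y))"
    by (rule holomorphic_funI[OF c(1) _ holo_on_cmult[OF F(1)]]) (use sub in auto)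
  moreover have "\<forall>y\<in>?W j \<inter> M. (1 / c' j) * F (\<phi> y) = f j y"
  proof
    fix y assume y: "y \<in> ?W j \<inter> M"
    then have "F (\<phi> y) = t j (\<phi> y)" using F(2)[of "\<phi> y"] sub by blast
    then show "(1 / c' j) * F (\<phi> y) = f j y" using y c(1) c'0[of j] by (simp add: t_def)
  qed
  ultimately show False using f(2)[of j] by blast
qed

text \<open>Two of the neighbourhoods that meet are so small that one of them lies in the domain of
  extension that belongs to the other; there the two extensions agree on \<open>M\<close>.\<close>

lemma common_extension:
  assumes \<omega>: "openin (top_of_set M) \<omega>" "connected \<omega>"
  obtains \<Omega> where "open \<Omega>" "connected \<Omega>" "\<omega> = \<Omega> \<inter> M"
    "\<forall>f. (\<forall>x\<in>\<omega>. ext_at M f x) \<longrightarrow> (\<exists>F. holomorphic_fun \<A> \<Omega> F \<and> (\<forall>x\<in>\<omega>. F x = f x))"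
    "\<forall>F G. holomorphic_fun \<A> \<Omega> F \<longrightarrow> holomorphic_fun \<A> \<Omega> G \<longrightarrow> (\<forall>x\<in>\<omega>. F x = G x) \<longrightarrow>
       (\<forall>x\<in>\<Omega>. F x = G x)"
proof -
  obtain Q where Q: "open Q" "\<omega> = M \<inter> Q" using \<omega>(1) unfolding openin_open by blast
  obtain \<Phi> :: "'x \<Rightarrow> nat \<Rightarrow> real" where \<Phi>: "continuous_on UNIV \<Phi>"
    "\<And>x N. open N \<Longrightarrow> x \<in> N \<Longrightarrow> \<exists>e>0. \<forall>y. dist (\<Phi> x) (\<Phi> y) < e \<longrightarrow> y \<in> N"
    using separating_map by blast
  have "\<exists>W. open W \<and> x \<in> W \<and> (\<forall>f. (\<forall>y\<in>\<omega>. ext_at M f y) \<longrightarrow>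
     (\<exists>F. holomorphic_fun \<A> W F \<and> (\<forall>y\<in>W \<inter> M. F y = f y)))" if "x \<in> \<omega>" for x
  proof -
    have x: "x \<in> M" "x \<in> Q" using that Q(2) by auto
    show ?thesis
      unfolding Q(2)
      by (rule common_extension_domain[OF x(1) Q(1) x(2)]) (intro exI conjI; assumption)
  qed
  then obtain W where W: "\<And>x. x \<in> \<omega> \<Longrightarrow> open (W x)" "\<And>x. x \<in> \<omega> \<Longrightarrow> x \<in> W x"
    "\<And>x f. x \<in> \<omega> \<Longrightarrow> (\<forall>y\<in>\<omega>. ext_at M f y) \<Longrightarrow> \<exists>F. holomorphic_fun \<A> (W x) F \<and> (\<forall>y\<in>W x \<inter> M. F y = f y)"
    by metis
  \<comment> \<open>The factor 3 pays for the three legs of a path from \<open>x\<close> over a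
    common point \<open>w\<close> and the centre \<open>y\<close> to an arbitrary point of the
    neighbourhood of \<open>y\<close>.\<close>
  have "\<exists>e>0. \<forall>y. dist (\<Phi> x) (\<Phi> y) < 3 * e \<longrightarrow> y \<in> W x \<inter> Q" if x: "x \<in> \<omega>" for x
  proof -
    have "open (W x \<inter> Q)" "x \<in> W x \<inter> Q" using W(1,2)[OF x] Q x by auto
    from \<Phi>(2)[OF this] obtain e where "e > 0" "\<forall>y. dist (\<Phi> x) (\<Phi> y) < e \<longrightarrow> y \<in> W x \<inter> Q" by blast
    then show ?thesis by (intro exI[of _ "e/3"]) auto
  qed
  then obtain e where e: "\<And>x. x \<in> \<omega> \<Longrightarrow> e x > 0"
    "\<And>x y. x \<in> \<omega> \<Longrightarrow> dist (\<Phi> x) (\<Phi> y) < 3 * e x \<Longrightarrow> y \<in> W x \<inter> Q" by metis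
  define P where "P x N \<longleftrightarrow> open N \<and> connected N \<and> x \<in> N \<and> N \<subseteq> {y. dist (\<Phi> x) (\<Phi> y) < e x} \<and>
     (\<forall>F G. holomorphic_fun \<A> N F \<longrightarrow> holomorphic_fun \<A> N G \<longrightarrow> (\<forall>y\<in>N \<inter> M. F y = G y) \<longrightarrow> (\<forall>y\<in>N. F y = G y))" for x N
  have "\<forall>x\<in>\<omega>. \<exists>N. P x N"
  proof
    fix x assume x: "x \<in> \<omega>"
    let ?D = "{y. dist (\<Phi> x) (\<Phi> y) < e x}"
    have xM: "x \<in> M" using x Q(2) by blast
    have "open (\<Phi> -` ball (\<Phi> x) (e x))" by (rule open_vimage[OF open_ball \<Phi>(1)])
    then have D: "open ?D" "x \<in> ?D" using e(1)[OF x] by (auto simp: vimage_def)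
    obtain U \<phi> where c: "(U, \<phi>) \<in> \<A>" "x \<in> U" by (rule chart_exists)
    have "open (\<phi> ` (U \<inter> ?D))" "\<phi> x \<in> \<phi> ` (U \<inter> ?D)" using chart_image_open[OF c(1) D(1)] c(2) D(2) by auto
    then obtain r where r: "r > 0" "ball (\<phi> x) r \<subseteq> \<phi> ` (U \<inter> ?D)" using open_contains_ball by blast
    let ?N = "U \<inter> \<phi> -` ball (\<phi> x) r"
    have N: "?N = inv_into U \<phi> ` ball (\<phi> x) r"
    proof (intro equalityI subsetI)
      fix y assume "y \<in> ?N"
      then show "y \<in> inv_into U \<phi> ` ball (\<phi> x) r" using c(1) by (intro image_eqI[of _ _ "\<phi> y"]) auto
    next
      fix y assume "y \<in> inv_into U \<phi> ` ball (\<phi> x) r"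
      then obtain z where z: "z \<in> ball (\<phi> x) r" "y = inv_into U \<phi> z" by blast
      then obtain y' where "y' \<in> U" "z = \<phi> y'" using r(2) by blast
      then show "y \<in> ?N" using z c(1) by simp
    qed
    have "connected ?N"
      unfolding N
      by (rule connected_continuous_image[OF continuous_on_subset[OF chart_inv_continuous[OF c(1)]] connected_ball])
         (use r(2) in blast)
    moreover have "open ?N" by (rule chart_preimage_open[OF c(1) open_ball])
    moreover have "x \<in> ?N" using c(2) r(1) by simp
    moreover have "?N \<subseteq> ?D"
    proof
      fix y assume y: "y \<in> ?N"
      then obtain y' where "y' \<in> U" "y' \<in> ?D" "\<phi> y = \<phi> y'" using r(2) by blast
      then show "y \<in> ?D" using y chart_inj[OF c(1)] by (auto dest: inj_onD)
    qed
    moreover have "F y = G y" if FG: "holomorphic_fun \<A> ?N F" "holomorphic_fun \<A> ?N G" "\<forall>y\<in>?N \<inter> M. F y = G y"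
      and y: "y \<in> ?N" for F G y
    proof -
      let ?H = "\<lambda>z. F (inv_into U \<phi> z) - G (inv_into U \<phi> z)"
      have sub: "ball (\<phi> x) r \<subseteq> \<phi> ` (U \<inter> ?N)" using r(2) by auto
      have "?H (\<phi> y) = 0"
      proof (rule unique_in_chart[OF c(1) _ r(1)])
        show "\<phi> x \<in> \<phi> ` (M \<inter> U)" using xM c(2) by blast
        show "ball (\<phi> x) r \<subseteq> \<phi> ` U" using r(2) by blast
        show "holo_on (ball (\<phi> x) r) ?H"
          using holomorphic_fun_chart[OF FG(1) c(1)] holomorphic_fun_chart[OF FG(2) c(1)] holo_on_subset[OF _ sub]
          by (intro holo_on_diff) blast+
        show "?H z = 0" if "z \<in> \<phi> ` (M \<inter> U)" "z \<in> ball (\<phi> x) r" for z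
          using that FG(3) c(1) by auto
        show "\<phi> y \<in> ball (\<phi> x) r" using y by simp
      qed
      then show ?thesis using y c(1) by simp
    qed
    ultimately have "P x ?N" unfolding P_def by (intro conjI allI impI ballI) auto
    then show "\<exists>N. P x N" by blast
  qed
  from bchoice[OF this] obtain N where N0: "\<And>x. x \<in> \<omega> \<Longrightarrow> P x (N x)" by blast
  have N: "\<And>x. x \<in> \<omega> \<Longrightarrow> open (N x)" "\<And>x. x \<in> \<omega> \<Longrightarrow> connected (N x)" "\<And>x. x \<in> \<omega> \<Longrightarrow> x \<in> N x"
    "\<And>x y. x \<in> \<omega> \<Longrightarrow> y \<in> N x \<Longrightarrow> dist (\<Phi> x) (\<Phi> y) < e x"
    "\<And>x F G. x \<in> \<omega> \<Longrightarrow> holomorphic_fun \<A> (N x) F \<Longrightarrow> holomorphic_fun \<A> (N x) G \<Longrightarrow>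
       (\<forall>y\<in>N x \<inter> M. F y = G y) \<Longrightarrow> (\<forall>y\<in>N x. F y = G y)"
  proof -
    fix x assume "x \<in> \<omega>"
    from N0[OF this] have P: "open (N x)" "connected (N x)" "x \<in> N x" "N x \<subseteq> {y. dist (\<Phi> x) (\<Phi> y) < e x}"
      "\<forall>F G. holomorphic_fun \<A> (N x) F \<longrightarrow> holomorphic_fun \<A> (N x) G \<longrightarrow> (\<forall>y\<in>N x \<inter> M. F y = G y) \<longrightarrow> (\<forall>y\<in>N x. F y = G y)"
      unfolding P_def by auto
    show "open (N x)" "connected (N x)" "x \<in> N x" by fact+
    show "dist (\<Phi> x) (\<Phi> y) < e x" if "y \<in> N x" for y using P(4) that by blast
    show "\<forall>y\<in>N x. F y = G y" if "holomorphic_fun \<A> (N x) F" "holomorphic_fun \<A> (N x) G" "\<forall>y\<in>N x \<inter> M. F y = G y" for F G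
      using P(5)[rule_format, OF that(1,2)] that(3) by blast
  qed
  have NW: "N x \<subseteq> W x \<inter> Q" if "x \<in> \<omega>" for x
  proof
    fix y assume "y \<in> N x"
    then show "y \<in> W x \<inter> Q" using N(4)[OF that] e(1)[OF that] by (intro e(2)[OF that]) fastforce
  qed
  define \<Omega> where "\<Omega> = (\<Union>x\<in>\<omega>. N x)"
  show ?thesis
  proof (rule that[of \<Omega>]; (intro allI impI)?)
    show "open \<Omega>" unfolding \<Omega>_def using N(1) by blast
    have "\<Omega> = \<omega> \<union> \<Union> (N ` \<omega>)" unfolding \<Omega>_def using N(3) by blast
    moreover have "connected (\<omega> \<union> \<Union> (N ` \<omega>))"
      by (rule connected_Un_UN[OF \<omega>(2)]) (use N(2,3) in auto)
    ultimately show "connected \<Omega>" by simp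
    \<comment> \<open>Each \<open>N x\<close> lies in \<open>Q\<close>, so \<open>\<Omega>\<close>
      cannot meet \<open>M\<close> outside \<open>\<omega>\<close>.\<close>
    show "\<omega> = \<Omega> \<inter> M" unfolding \<Omega>_def using N(3) NW Q(2) by blast
    show "\<forall>x\<in>\<Omega>. F x = G x" if FG: "holomorphic_fun \<A> \<Omega> F" "holomorphic_fun \<A> \<Omega> G" "\<forall>x\<in>\<omega>. F x = G x" for F G
    proof
      fix w assume "w \<in> \<Omega>"
      then obtain x where x: "x \<in> \<omega>" "w \<in> N x" unfolding \<Omega>_def by blast
      have sub: "N x \<subseteq> \<Omega>" unfolding \<Omega>_def using x(1) by blast
      have "\<forall>y\<in>N x. F y = G y"
      proof (rule N(5)[OF x(1) holomorphic_fun_subset[OF FG(1) sub] holomorphic_fun_subset[OF FG(2) sub]])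
        show "\<forall>y\<in>N x \<inter> M. F y = G y" using FG(3) NW[OF x(1)] Q(2) by blast
      qed
      then show "F w = G w" using x(2) by blast
    qed
    show "\<exists>F. holomorphic_fun \<A> \<Omega> F \<and> (\<forall>x\<in>\<omega>. F x = f x)" if f: "\<forall>x\<in>\<omega>. ext_at M f x" for f
    proof -
      have "\<exists>F. holomorphic_fun \<A> (W x) F \<and> (\<forall>y\<in>W x \<inter> M. F y = f y)" if "x \<in> \<omega>" for x
        using W(3)[OF that, of f] f by blast
      then obtain h where h: "\<And>x. x \<in> \<omega> \<Longrightarrow> holomorphic_fun \<A> (W x) (h x)"
        "\<And>x y. x \<in> \<omega> \<Longrightarrow> y \<in> W x \<Longrightarrow> y \<in> M \<Longrightarrow> h x y = f y" by (metis IntI)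
      \<comment> \<open>The neighbourhood with the smaller radius fits into the domain
        \<open>W x\<close> of the other one. On \<open>N y\<close> both extensions are then defined
        and equal \<open>f\<close> on \<open>M\<close>, and the uniqueness built into
        \<open>N y\<close> applies; the opposite order of the radii follows by symmetry.\<close>
      have le: "h x w = h y w" if xy: "x \<in> \<omega>" "y \<in> \<omega>" "w \<in> N x" "w \<in> N y" and le: "e y \<le> e x" for x y w
      proof -
        have sub: "N y \<subseteq> W x"
        proof
          fix v assume v: "v \<in> N y"
          have "dist (\<Phi> x) (\<Phi> v) \<le> dist (\<Phi> x) (\<Phi> w) + dist (\<Phi> w) (\<Phi> v)" by (rule dist_triangle)
          also have "dist (\<Phi> w) (\<Phi> v) \<le> dist (\<Phi> y) (\<Phi> w) + dist (\<Phi> y) (\<Phi> v)" by (rule dist_triangle3)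
          finally have "dist (\<Phi> x) (\<Phi> v) < 3 * e x"
            using N(4)[OF xy(1,3)] N(4)[OF xy(2,4)] N(4)[OF xy(2) v] le by linarith
          then show "v \<in> W x" using e(2)[OF xy(1)] by blast
        qed
        have sub': "N y \<subseteq> W y" using NW[OF xy(2)] by blast
        have "\<forall>v\<in>N y. h x v = h y v"
        proof (rule N(5)[OF xy(2) holomorphic_fun_subset[OF h(1)[OF xy(1)] sub] holomorphic_fun_subset[OF h(1)[OF xy(2)] sub']])
          show "\<forall>v\<in>N y \<inter> M. h x v = h y v"
            using h(2)[OF xy(1)] h(2)[OF xy(2)] sub sub' by (metis IntE subsetD)
        qed
        then show ?thesis using xy(4) by blast
      qed
      have agree: "h x w = h y w" if xy: "x \<in> \<omega>" "y \<in> \<omega>" "w \<in> N x" "w \<in> N y" for x y w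
        using le[OF xy] le[OF xy(2,1,4,3)] by (cases "e y \<le> e x") auto
      define x0 where "x0 w = (SOME x. x \<in> \<omega> \<and> w \<in> N x)" for w
      have x0: "x0 w \<in> \<omega>" "w \<in> N (x0 w)" if "w \<in> N x" "x \<in> \<omega>" for x w
      proof -
        have "\<exists>x. x \<in> \<omega> \<and> w \<in> N x" using that by blast
        then have "x0 w \<in> \<omega> \<and> w \<in> N (x0 w)" unfolding x0_def by (rule someI_ex)
        then show "x0 w \<in> \<omega>" "w \<in> N (x0 w)" by auto
      qed
      define F where "F w = h (x0 w) w" for w
      have F: "F w = h x w" if "w \<in> N x" "x \<in> \<omega>" for x w
        unfolding F_def by (rule agree[OF x0(1)[OF that] that(2) x0(2)[OF that] that(1)])
      have "holomorphic_fun \<A> \<Omega> F"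
      proof (rule holomorphic_fun_local)
        fix w assume "w \<in> \<Omega>"
        then obtain x where x: "x \<in> \<omega>" "w \<in> N x" unfolding \<Omega>_def by blast
        have "holomorphic_fun \<A> (N x) (h x)" by (rule holomorphic_fun_subset[OF h(1)[OF x(1)]]) (use NW[OF x(1)] in blast)
        then show "\<exists>N G. open N \<and> w \<in> N \<and> holomorphic_fun \<A> N G \<and> (\<forall>y\<in>N. F y = G y)"
          using N(1)[OF x(1)] x F by (intro exI[of _ "N x"] exI[of _ "h x"]) blast
      qed
      moreover have "\<forall>x\<in>\<omega>. F x = f x"
      proof
        fix x assume x: "x \<in> \<omega>"
        then show "F x = f x" using F[OF N(3)[OF x] x] h(2)[OF x W(2)[OF x]] Q(2) by auto
      qed
      ultimately show ?thesis by blast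
    qed
  qed
qed

end

theorem theorem6p1:
  fixes \<A> :: "('x::{t2_space, second_countable_topology}, 'n::finite) chart set"
    and k :: nat
    and M E :: "'x set"
  assumes "complex_atlas \<A>"
    and "locally_closed M"
    and "real_submanifold \<A> k M"
    and "weakly_pseudoconcave \<A> k 1 M"
    and "closedin (top_of_set M) E" and "discrete E"
    and "openin (top_of_set M) (reg_points \<A> k M)"
    and "M \<subseteq> closure (reg_points \<A> k M)"
    and "CR_submanifold \<A> k (reg_points \<A> k M)"
    and "generic \<A> k (reg_points \<A> k M)"
    and "\<forall>p\<in>M - E. holo_extension_at \<A> (M - E) p"
  shows "(\<forall>\<omega>. openin (top_of_set M) \<omega> \<and> connected \<omega> \<longrightarrow>
           (\<exists>\<Omega>. open \<Omega> \<and> connected \<Omega> \<and> \<omega> = \<Omega> \<inter> M \<and>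
              (\<forall>f\<in>LACR \<A> M \<omega>.
                 \<exists>F. holomorphic_fun \<A> \<Omega> F \<and> (\<forall>x\<in>\<omega>. F x = f x) \<and>
                   (\<forall>G. holomorphic_fun \<A> \<Omega> G \<and> (\<forall>x\<in>\<omega>. G x = f x) \<longrightarrow> (\<forall>x\<in>\<Omega>. G x = F x)))))
       \<and> (\<forall>U. openin (top_of_set M) U \<longrightarrow> (\<forall>f\<in>LACR \<A> M U. smooth_on_subset \<A> U f))
       \<and> LACR_germs \<A> M = holomorphic_germs \<A> M"
proof -
  interpret pseudoconcave_submanifold \<A> k M E
    by unfold_locales (use assms in blast)+
  show ?thesis
  proof (intro conjI allI impI ballI)
    fix \<omega> assume "openin (top_of_set M) \<omega> \<and> connected \<omega>"
    then have \<omega>: "openin (top_of_set M) \<omega>" "connected \<omega>" by auto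
    obtain \<Omega> where \<Omega>: "open \<Omega>" "connected \<Omega>" "\<omega> = \<Omega> \<inter> M"
      "\<forall>f. (\<forall>x\<in>\<omega>. ext_at M f x) \<longrightarrow> (\<exists>F. holomorphic_fun \<A> \<Omega> F \<and> (\<forall>x\<in>\<omega>. F x = f x))"
      "\<forall>F G. holomorphic_fun \<A> \<Omega> F \<longrightarrow> holomorphic_fun \<A> \<Omega> G \<longrightarrow> (\<forall>x\<in>\<omega>. F x = G x) \<longrightarrow>
         (\<forall>x\<in>\<Omega>. F x = G x)"
      by (rule common_extension[OF \<omega>]) (rule that; assumption)
    have "\<exists>F. holomorphic_fun \<A> \<Omega> F \<and> (\<forall>x\<in>\<omega>. F x = f x) \<and>
        (\<forall>G. holomorphic_fun \<A> \<Omega> G \<and> (\<forall>x\<in>\<omega>. G x = f x) \<longrightarrow> (\<forall>x\<in>\<Omega>. G x = F x))" if fL: "f \<in> LACR \<A> M \<omega>" for f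
    proof -
      obtain F where F: "holomorphic_fun \<A> \<Omega> F" "\<forall>x\<in>\<omega>. F x = f x"
        using \<Omega>(4) LACR_ext_at[OF fL] by blast
      have "\<forall>x\<in>\<Omega>. G x = F x" if "holomorphic_fun \<A> \<Omega> G" "\<forall>x\<in>\<omega>. G x = f x" for G
        using \<Omega>(5)[rule_format, OF that(1) F(1)] that(2) F(2) by simp
      then show ?thesis using F by blast
    qed
    then show "\<exists>\<Omega>. open \<Omega> \<and> connected \<Omega> \<and> \<omega> = \<Omega> \<inter> M \<and>
              (\<forall>f\<in>LACR \<A> M \<omega>.
                 \<exists>F. holomorphic_fun \<A> \<Omega> F \<and> (\<forall>x\<in>\<omega>. F x = f x) \<and>
                   (\<forall>G. holomorphic_fun \<A> \<Omega> G \<and> (\<forall>x\<in>\<omega>. G x = f x) \<longrightarrow> (\<forall>x\<in>\<Omega>. G x = F x)))"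
      using \<Omega>(1,2,3) by blast
  next
    show "smooth_on_subset \<A> U f" if "openin (top_of_set M) U" "f \<in> LACR \<A> M U" for U f
      using that by (rule LACR_smooth)
    show "LACR_germs \<A> M = holomorphic_germs \<A> M" by (rule LACR_germs_eq)
  qed
qed

end
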